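(* Let $\mathbb{P}$ denote the Pe\l czy\'nski space. There exists a compact convex subset $K$ of $\mathbb{P}$ such that $\mathbb{P}$ is (linearly) isomorphic to the Lipschitz free space $\mathcal{F}(K)$.
   Context: Banach spaces are real, and "isomorphic" means that there is a bounded linear bijection with bounded inverse. Lipschitz free spaces: for a metric space $(M,d)$ with a distinguished point $0\in M$ (a pointed metric space), let $\mathrm{Lip}_0(M)=\{f\in\mathbb{R}^M : f \text{ Lipschitz}, f(0)=0\}$, a Banach space with the norm $\|f\|_L=\sup\{\frac{f(x)-f(y)}{d(x,y)} : x\neq y\}$. For $x\in M$ let $\delta(x)\in \mathrm{Lip}_0(M)^*$ be the evaluation functional $f\mapsto f(x)$. The Lipschitz free space $\mathcal{F}(M)$ is the norm-closed linear span of $\{\delta(x): x\in M\}$ in $\mathrm{Lip}_0(M)^*$. Up to isometric isomorphism, $\mathcal{F}(M)$ does not depend on the choice of the distinguished point. A subset $K$ of a Banach space is regarded as a metric space with the metric induced by the norm. Bounded approximation property: a Banach space $X$ has the bounded approximation property (BAP) if there exists $\lambda>0$ such that for every $x_1,\ldots,x_n\in X$ and every $\varepsilon>0$ there exists a finite-rank linear operator $T:X\to X$ with $\|T\|\leq\lambda$ and $\|x_i-Tx_i\|\leq\varepsilon$ for all $1\leq i\leq n$. Pe\l czy\'nski space: $\mathbb{P}$ is, up to isomorphism, the unique separable Banach space with a Schauder basis such that every separable Banach space with the BAP is isomorphic to a complemented subspace of $\mathbb{P}$. *)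

theory Defs
  imports "HOL-Analysis.Analysis" "HOL-Library.Function_Algebras"
begin

instantiation "fun" :: (type, real_vector) real_vector
begin

definition scaleR_fun :: "real \<Rightarrow> ('a \<Rightarrow> 'b) \<Rightarrow> 'a \<Rightarrow> 'b"
  where "scaleR_fun c f = (\<lambda>x. c *\<^sub>R f x)"

instance
  by standard (simp_all add: scaleR_fun_def fun_eq_iff scaleR_add_right scaleR_add_left)

end

section \<open>Normed spaces as linear subspaces carrying a norm\<close>

text \<open>
  Free spaces of subsets of a Banach space depend on a term (the subset) and so cannot be types.
  A normed space is therefore given by a linear subspace \<open>V\<close> of some real vector space
  together with a function \<open>N\<close> that is a norm on \<open>V\<close>; for a normed vector type, or a
  subspace of one, \<open>N\<close> is \<^const>\<open>norm\<close>.
\<close>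

definition linear_map_on :: "'a::real_vector set \<Rightarrow> ('a \<Rightarrow> 'b::real_vector) \<Rightarrow> bool"
  where "linear_map_on V T \<longleftrightarrow>
    (\<forall>x\<in>V. \<forall>y\<in>V. T (x + y) = T x + T y) \<and> (\<forall>c. \<forall>x\<in>V. T (c *\<^sub>R x) = c *\<^sub>R T x)"

definition isomorphic_normed ::
  "'a::real_vector set \<Rightarrow> ('a \<Rightarrow> real) \<Rightarrow> 'b::real_vector set \<Rightarrow> ('b \<Rightarrow> real) \<Rightarrow> bool"
  where "isomorphic_normed V N W N' \<longleftrightarrow>
    (\<exists>T. linear_map_on V T \<and> bij_betw T V W \<and>
      (\<exists>C. \<forall>x\<in>V. N' (T x) \<le> C * N x) \<and>
      (\<exists>C. \<forall>y\<in>W. N (inv_into V T y) \<le> C * N' y))"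

text \<open>
  The topological dual and its norm. Functionals on \<open>V\<close> are represented by functions that vanish
  outside \<open>V\<close>, so that each functional has exactly one representative.
\<close>

definition dual_space :: "'a::real_vector set \<Rightarrow> ('a \<Rightarrow> real) \<Rightarrow> ('a \<Rightarrow> real) set"
  where "dual_space V N =
    {\<phi>. linear_map_on V \<phi> \<and> (\<exists>C. \<forall>f\<in>V. \<bar>\<phi> f\<bar> \<le> C * N f) \<and> (\<forall>f. f \<notin> V \<longrightarrow> \<phi> f = 0)}"

definition dual_norm :: "'a::real_vector set \<Rightarrow> ('a \<Rightarrow> real) \<Rightarrow> ('a \<Rightarrow> real) \<Rightarrow> real"
  where "dual_norm V N \<phi> = Sup {\<bar>\<phi> f\<bar> | f. f \<in> V \<and> N f \<le> 1}"


section \<open>Lipschitz free spaces\<close>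

text \<open>
  Functions on \<open>M\<close> are represented by functions that vanish outside \<open>M\<close>. The distinguished
  point is \<open>z\<close>. The element \<open>0\<close> inserted below changes the supremum only if \<open>M\<close> has at most
  one point, where the set of difference quotients is empty and \<^const>\<open>Sup\<close> on the reals
  is unspecified.
\<close>

definition Lip0 :: "'a::metric_space set \<Rightarrow> 'a \<Rightarrow> ('a \<Rightarrow> real) set"
  where "Lip0 M z = {f. (\<exists>C. C-lipschitz_on M f) \<and> f z = 0 \<and> (\<forall>x. x \<notin> M \<longrightarrow> f x = 0)}"

definition lip_norm :: "'a::metric_space set \<Rightarrow> ('a \<Rightarrow> real) \<Rightarrow> real"
  where "lip_norm M f =
    Sup (insert 0 {(f x - f y) / dist x y | x y. x \<in> M \<and> y \<in> M \<and> x \<noteq> y})"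

definition evaluation :: "'a::metric_space set \<Rightarrow> 'a \<Rightarrow> 'a \<Rightarrow> ('a \<Rightarrow> real) \<Rightarrow> real"
  where "evaluation M z x = (\<lambda>f. if f \<in> Lip0 M z then f x else 0)"

definition lip_free_norm :: "'a::metric_space set \<Rightarrow> 'a \<Rightarrow> (('a \<Rightarrow> real) \<Rightarrow> real) \<Rightarrow> real"
  where "lip_free_norm M z = dual_norm (Lip0 M z) (lip_norm M)"

definition lip_free :: "'a::metric_space set \<Rightarrow> 'a \<Rightarrow> (('a \<Rightarrow> real) \<Rightarrow> real) set"
  where "lip_free M z =
    {\<phi> \<in> dual_space (Lip0 M z) (lip_norm M).
      \<forall>\<epsilon>>0. \<exists>\<psi>\<in>span (evaluation M z ` M). lip_free_norm M z (\<phi> - \<psi>) < \<epsilon>}"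


section \<open>The Pelczynski space\<close>

definition bounded_approximation_property :: "'a::real_normed_vector set \<Rightarrow> bool"
  where "bounded_approximation_property X \<longleftrightarrow>
    (\<exists>L>0. \<forall>F \<epsilon>. finite F \<and> F \<subseteq> X \<and> \<epsilon> > 0 \<longrightarrow>
      (\<exists>T. linear_map_on X T \<and> T ` X \<subseteq> X \<and> (\<exists>B. finite B \<and> T ` X \<subseteq> span B) \<and>
        (\<forall>x\<in>X. norm (T x) \<le> L * norm x) \<and>
        (\<forall>x\<in>F. norm (x - T x) \<le> \<epsilon>)))"

definition schauder_basis :: "(nat \<Rightarrow> 'a::real_normed_vector) \<Rightarrow> bool"
  where "schauder_basis e \<longleftrightarrow> (\<forall>x. \<exists>!a. (\<lambda>n. a n *\<^sub>R e n) sums x)"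

definition complemented :: "'a::real_normed_vector set \<Rightarrow> bool"
  where "complemented Y \<longleftrightarrow> (\<exists>p. bounded_linear p \<and> p \<circ> p = p \<and> range p = Y)"

text \<open>
  Quantification over all separable Banach spaces is expressed as quantification over all
  separable closed linear subspaces of \<open>\<ell>\<^sub>\<infinity>\<close>, i.e. of \<open>nat \<Rightarrow>\<^sub>C real\<close> (every function on the discrete
  space \<^typ>\<open>nat\<close> is continuous, and the norm is the supremum norm): every separable Banach
  space is isometrically isomorphic to one of these, and each of them is a separable Banach space.
\<close>

definition pelczynski_space :: "'p::banach itself \<Rightarrow> bool"
  where "pelczynski_space _ \<longleftrightarrow>
    separable_space (euclidean :: 'p topology) \<and>
    (\<exists>e :: nat \<Rightarrow> 'p. schauder_basis e) \<and>
    (\<forall>X :: (nat \<Rightarrow>\<^sub>C real) set.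
      subspace X \<and> closed X \<and> separable_space (top_of_set X) \<and>
      bounded_approximation_property X \<longrightarrow>
      (\<exists>Y :: 'p set. complemented Y \<and> isomorphic_normed X norm Y norm))"

end

theory Submission
  imports Defs "HOL-Probability.Infinite_Product_Measure"
begin

text \<open>
  Rescale the Schauder basis of \<open>P\<close> to vectors \<open>x j\<close> with summable norms and let \<open>K\<close> be the cube of
  all sums \<open>\<Sum>j. t j *\<^sub>R x j\<close> with \<open>t j \<in> {0..1}\<close>, which carries the law of independent uniform
  coordinates.

  \<open>P\<close> is complemented in the free space of \<open>K\<close>, by the lifting of Godefroy and Kalton: sending \<open>x k\<close>
  to the mean of \<open>\<delta>(p + x k) - \<delta>(p)\<close> over the face \<open>t k = 0\<close> is bounded, since on a Lipschitz function
  it is the derivative at \<open>0\<close> of the averages of its translates; the barycentre map is a left inverse.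

  The free space of \<open>K\<close> has the bounded approximation property: compose the basis projections, which
  map \<open>K\<close> into itself, with averaging over small boxes and then round to a finite net. Averages over
  boxes of a function with small supremum are Lipschitz with a small constant, so a sufficiently
  fine rounding adds little to the norm.

  Hence the $c_0$-sum of copies of the free space is complemented in \<open>P\<close> by universality, and
  Pelczynski's decomposition argument applies.
\<close>

subsection \<open>Norming functionals\<close>

text \<open>Two obstacles shape the proof. Universality of \<open>'p\<close> concerns only subspaces
  of \<open>linf\<close>, so the free space is copied isometrically to a subspace \<open>Y\<close>
  of \<open>linf\<close> and from then on touched only through the pairing \<open>pr y f\<close>
  with Lipschitz functions; linear identities and limits on \<open>Y\<close> are checked on point
  evaluations, whose span is dense. Secondly, interpolating a Lipschitz function from a finite net
  has a uniformly small error but no control of Lipschitz constants. Averaging turns a supremum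
  bound \<open>B\<close> into the Lipschitz constant \<open>B * smear_const n h\<close>; this factor
  may be huge, but it depends only on \<open>n\<close> and \<open>h\<close>, so the net can be
  chosen afterwards. The same one-coordinate estimate, \<open>translate_average\<close>, serves here
  as a crude bound and in the lifting as a first order expansion. The $c_0$-sum is used because it
  stays separable, keeps the approximation property with the same constant, and absorbs one more
  copy of any retract of \<open>Y\<close>.\<close>

definition sublinear :: "('a::real_vector \<Rightarrow> real) \<Rightarrow> bool"
  where "sublinear q \<longleftrightarrow> (\<forall>x y. q (x + y) \<le> q x + q y) \<and> (\<forall>c>0. \<forall>x. q (c *\<^sub>R x) \<le> c * q x)"

text \<open>Only an inequality for positive factors is demanded of a sublinear functional; applied
  to \<open>c\<close> and to \<open>1 / c\<close> it yields equality.\<close>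

lemma sublinearD:
  assumes "sublinear q"
  shows sublinear_add: "q (x + y) \<le> q x + q y"
    and sublinear_scaleR: "c > 0 \<Longrightarrow> q (c *\<^sub>R x) = c * q x"
    and sublinear_zero: "q 0 = 0"
    and sublinear_minus: "- q (- x) \<le> q x"
proof -
  have a: "q (x + y) \<le> q x + q y" and s: "c > 0 \<Longrightarrow> q (c *\<^sub>R x) \<le> c * q x" for c x y
    using assms by (auto simp: sublinear_def)
  show "q (x + y) \<le> q x + q y" by (rule a)
  show "q (c *\<^sub>R x) = c * q x" if "c > 0"
  proof (rule antisym)
    have "c * q x = c * q ((1 / c) *\<^sub>R (c *\<^sub>R x))" using that by simp
    also have "\<dots> \<le> c * ((1 / c) * q (c *\<^sub>R x))"
      using that by (intro mult_left_mono s) auto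
    finally show "c * q x \<le> q (c *\<^sub>R x)" using that by simp
  qed (rule s[OF that])
  show "q 0 = 0" using s[of 2 0] s[of "1/2" 0] by simp
  then show "- q (- x) \<le> q x" using a[of x "- x"] by simp
qed

text \<open>The lowering step of the Hahn-Banach theorem: comparing \<open>q\<close> with its own
  growth along the ray through \<open>y\<close> keeps sublinearity and makes the value at
  \<open>- y\<close> at most \<open>- q y\<close>. A functional that cannot be lowered must
  therefore be odd.\<close>

lemma sublinear_shrink:
  assumes q: "sublinear q"
  obtains r where "sublinear r" "\<And>x. r x \<le> q x" "r (- y) \<le> - q y"
proof -
  note add = sublinear_add[OF q] and sc = sublinear_scaleR[OF q] and z = sublinear_zero[OF q]
  define A where "A x = (\<lambda>t. q (x + t *\<^sub>R y) - t * q y) ` {0..}" for x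
  define r where "r x = Inf (A x)" for x
  have sc0: "t \<ge> 0 \<Longrightarrow> q (t *\<^sub>R y) = t * q y" for t
    using sc[of t y] z by (cases "t = 0") auto
  have "q (x + t *\<^sub>R y) - t * q y \<ge> - q (- x)" if "t \<ge> 0" for x t
    using add[of "x + t *\<^sub>R y" "- x"] sc0[OF that] by simp
  then have bdd: "bdd_below (A x)" for x
    unfolding A_def by (intro bdd_belowI2[of _ "- q (- x)"]) auto
  have ne: "A x \<noteq> {}" for x by (auto simp: A_def)
  have le: "r x \<le> q (x + t *\<^sub>R y) - t * q y" if "t \<ge> 0" for x t
    unfolding r_def using that by (intro cInf_lower bdd) (auto simp: A_def)
  have "r (x + x') \<le> r x + r x'" for x x'
  proof -
    have "r (x + x') - (q (x + t *\<^sub>R y) - t * q y) \<le> q (x' + t' *\<^sub>R y) - t' * q y"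
      if "t \<ge> 0" "t' \<ge> 0" for t t'
      using le[of "t + t'" "x + x'"] add[of "x + t *\<^sub>R y" "x' + t' *\<^sub>R y"] that
      by (simp add: algebra_simps)
    then have "r (x + x') - (q (x + t *\<^sub>R y) - t * q y) \<le> r x'" if "t \<ge> 0" for t
      unfolding r_def[of x'] using that ne by (intro cInf_greatest) (auto simp: A_def)
    then have "r (x + x') - r x' \<le> q (x + t *\<^sub>R y) - t * q y" if "t \<ge> 0" for t
      using that by (simp add: algebra_simps)
    then have "r (x + x') - r x' \<le> r x"
      unfolding r_def[of x] using ne by (intro cInf_greatest) (auto simp: A_def)
    then show ?thesis by simp
  qed
  moreover have "r (c *\<^sub>R x) \<le> c * r x" if "c > 0" for c x
  proof -
    have "r (c *\<^sub>R x) \<le> c * (q (x + t *\<^sub>R y) - t * q y)" if "t \<ge> 0" for t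
      using le[of "c * t" "c *\<^sub>R x"] sc[OF \<open>c > 0\<close>, of "x + t *\<^sub>R y"] that \<open>c > 0\<close>
      by (simp add: algebra_simps)
    then have "r (c *\<^sub>R x) / c \<le> q (x + t *\<^sub>R y) - t * q y" if "t \<ge> 0" for t
      using that \<open>c > 0\<close> by (simp add: pos_divide_le_eq mult.commute)
    then have "r (c *\<^sub>R x) / c \<le> r x"
      unfolding r_def[of x] using ne by (intro cInf_greatest) (auto simp: A_def)
    then show ?thesis using that by (simp add: field_simps)
  qed
  ultimately have "sublinear r" by (auto simp: sublinear_def)
  moreover have "r x \<le> q x" for x using le[of 0 x] by simp
  moreover have "r (- y) \<le> - q y" using le[of 1 "- y"] z by simp
  ultimately show ?thesis by (rule that)
qed

text \<open>Zorn's lemma gives a minimal sublinear functional, and a minimal one is linear.\<close>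

lemma norming_functional:
  fixes w :: "'a::real_normed_vector"
  obtains \<phi> where "bounded_linear \<phi>" "\<And>x. \<bar>\<phi> x\<bar> \<le> norm x" "\<phi> w = norm w"
proof -
  have "sublinear (norm :: 'a \<Rightarrow> real)"
    by (auto simp: sublinear_def norm_triangle_ineq)
  \<comment> \<open>The norm is lowered at \<open>w\<close> before Zorn's lemma is applied: every
    linear functional below \<open>p\<close> is then at most \<open>- norm w\<close> at
    \<open>- w\<close>, so it attains the norm at \<open>w\<close>.\<close>
  then obtain p :: "'a \<Rightarrow> real"
    where p: "sublinear p" "\<And>x. p x \<le> norm x" "p (- w) \<le> - norm w"
    by (rule sublinear_shrink[where y = w]) blast
  define S where "S = {q :: 'a \<Rightarrow> real. sublinear q \<and> q \<le> p}"
  have "\<exists>m\<in>S. \<forall>a\<in>S. m \<ge> a \<longrightarrow> a = m"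
  proof (rule predicate_Zorn)
    show "partial_order_on S (relation_of (\<lambda>a b. b \<le> a) S)"
      by (rule partial_order_on_relation_ofI) auto
    fix C assume C: "C \<in> Chains (relation_of (\<lambda>a b. b \<le> a) S)"
    have CS: "C \<subseteq> S" and tot: "\<And>a b. a \<in> C \<Longrightarrow> b \<in> C \<Longrightarrow> a \<le> b \<or> b \<le> a"
      using C by (auto simp: Chains_def relation_of_def)
    show "\<exists>u\<in>S. \<forall>a\<in>C. u \<le> a"
    proof (cases "C = {}")
      case True
      then show ?thesis using p(1) by (auto simp: S_def)
    next
      case False
      define u where "u x = (INF q\<in>C. q x)" for x
      have "- p (- x) \<le> q x" if "q \<in> C" for q x
      proof -
        have "sublinear q" "q (- x) \<le> p (- x)" using that CS by (auto simp: S_def le_fun_def)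
        with sublinear_minus[of q x] show ?thesis by simp
      qed
      then have bdd: "bdd_below ((\<lambda>q. q x) ` C)" for x
        by (intro bdd_belowI2[of _ "- p (- x)"])
      have le: "u x \<le> q x" if "q \<in> C" for q x
        unfolding u_def using that by (intro cINF_lower bdd)
      have "u (x + x') \<le> u x + u x'" for x x'
      proof -
        have "u (x + x') - q' x' \<le> q x" if qq: "q \<in> C" "q' \<in> C" for q q'
        proof -
          \<comment> \<open>In a chain the smaller of the two functionals is a common lower bound,
            and its subadditivity passes to the infimum.\<close>
          obtain s where s: "s \<in> C" "s \<le> q" "s \<le> q'" using tot[OF qq] qq by auto
          have "sublinear s" using s CS by (auto simp: S_def)
          then have "u (x + x') \<le> s x + s x'"
            using le[OF s(1), of "x + x'"] sublinear_add[of s x x'] by simp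
          also have "\<dots> \<le> q x + q' x'" using s by (intro add_mono) (auto simp: le_fun_def)
          finally show ?thesis by simp
        qed
        then have "u (x + x') - q' x' \<le> u x" if "q' \<in> C" for q'
          unfolding u_def[of x] using that False by (intro cINF_greatest) auto
        then have "u (x + x') - u x \<le> q' x'" if "q' \<in> C" for q'
          using that by (simp add: algebra_simps)
        then have "u (x + x') - u x \<le> u x'"
          unfolding u_def[of x'] using False by (intro cINF_greatest) auto
        then show ?thesis by simp
      qed
      moreover have "u (c *\<^sub>R x) \<le> c * u x" if "c > 0" for c x
      proof -
        have "u (c *\<^sub>R x) / c \<le> q x" if "q \<in> C" for q
        proof -
          have "sublinear q" using that CS by (auto simp: S_def)
          then show ?thesis
            using le[OF that, of "c *\<^sub>R x"] sublinear_scaleR[of q c x] \<open>c > 0\<close>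
            by (simp add: field_simps)
        qed
        then have "u (c *\<^sub>R x) / c \<le> u x"
          unfolding u_def[of x] using False by (intro cINF_greatest) auto
        then show ?thesis using that by (simp add: field_simps)
      qed
      moreover have "u \<le> p"
      proof -
        obtain q where "q \<in> C" using False by blast
        then show ?thesis using le[of q] CS by (force simp: S_def le_fun_def intro: order_trans)
      qed
      ultimately have "u \<in> S" by (auto simp: S_def sublinear_def)
      then show ?thesis using le by (auto simp: le_fun_def)
    qed
  qed
  then obtain q where q: "sublinear q" "q \<le> p" and min: "\<And>r. sublinear r \<Longrightarrow> r \<le> q \<Longrightarrow> r = q"
    unfolding S_def by (metis (no_types, lifting) mem_Collect_eq order_trans)
  have neg: "q (- y) = - q y" for y
  proof -
    obtain r where r: "sublinear r" "\<And>x. r x \<le> q x" "r (- y) \<le> - q y"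
      by (rule sublinear_shrink[OF q(1), where y = y]) blast
    then have "r = q" by (intro min) (auto simp: le_fun_def)
    with r(3) sublinear_minus[OF q(1), of y] show ?thesis by simp
  qed
  have add: "q (x + y) = q x + q y" for x y
    using sublinear_add[OF q(1), of x y] sublinear_add[OF q(1), of "x + y" "- y"] neg[of y] by simp
  have sc: "q (c *\<^sub>R x) = c * q x" for c x
  proof (cases c "0::real" rule: linorder_cases)
    case less
    then have "q ((- c) *\<^sub>R x) = - c * q x" by (intro sublinear_scaleR[OF q(1)]) simp
    then show ?thesis using neg[of "c *\<^sub>R x"] by simp
  qed (use sublinear_zero[OF q(1)] sublinear_scaleR[OF q(1)] in auto)
  have le: "q x \<le> norm x" for x using q(2) p(2)[of x] by (force simp: le_fun_def intro: order_trans)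
  have ab: "\<bar>q x\<bar> \<le> norm x" for x using le[of x] le[of "- x"] neg[of x] by auto
  have "q (- w) \<le> - norm w" using q(2) p(3) by (force simp: le_fun_def intro: order_trans)
  with le[of w] neg[of w] have "q w = norm w" by simp
  moreover have "bounded_linear q"
    by (rule bounded_linear_intro[of _ 1]) (use add sc ab in auto)
  ultimately show ?thesis using ab that by blast
qed

subsection \<open>The projections of a Schauder basis\<close>

definition basis_coeff :: "(nat \<Rightarrow> 'a::real_normed_vector) \<Rightarrow> 'a \<Rightarrow> nat \<Rightarrow> real"
  where "basis_coeff e x = (THE a. (\<lambda>n. a n *\<^sub>R e n) sums x)"

definition basis_proj :: "(nat \<Rightarrow> 'a::real_normed_vector) \<Rightarrow> nat \<Rightarrow> 'a \<Rightarrow> 'a"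
  where "basis_proj e n x = (\<Sum>k<n. basis_coeff e x k *\<^sub>R e k)"

context
  fixes e :: "nat \<Rightarrow> 'a::real_normed_vector"
  assumes e: "schauder_basis e"
begin

lemma basis_coeff_sums: "(\<lambda>n. basis_coeff e x n *\<^sub>R e n) sums x"
  unfolding basis_coeff_def
  by (rule theI'[where P = "\<lambda>a. (\<lambda>n. a n *\<^sub>R e n) sums x"])
     (use e in \<open>simp add: schauder_basis_def\<close>)

lemma basis_coeff_eqI: "(\<lambda>n. a n *\<^sub>R e n) sums x \<Longrightarrow> basis_coeff e x = a"
  unfolding basis_coeff_def
  by (rule the1_equality[where P = "\<lambda>a. (\<lambda>n. a n *\<^sub>R e n) sums x"])
     (use e in \<open>simp_all add: schauder_basis_def\<close>)

lemma basis_coeff_add: "basis_coeff e (x + y) n = basis_coeff e x n + basis_coeff e y n"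
  using basis_coeff_eqI[OF sums_add[OF basis_coeff_sums[of x] basis_coeff_sums[of y],
      folded scaleR_add_left]] by simp

lemma basis_coeff_scaleR: "basis_coeff e (c *\<^sub>R x) n = c * basis_coeff e x n"
  using basis_coeff_eqI[OF sums_scaleR_right[OF basis_coeff_sums[of x], of c, unfolded scaleR_scaleR]]
  by simp

lemma basis_coeff_basis: "basis_coeff e (e k) n = (if n = k then 1 else 0)"
proof -
  have "(\<lambda>n. (if n = k then 1 else 0) *\<^sub>R e n) sums e k"
    by (rule sums_cong[THEN iffD1, OF _ sums_single[of k e]]) simp
  then show ?thesis by (drule_tac basis_coeff_eqI) simp
qed

lemma basis_nonzero: "e k \<noteq> 0"
proof
  assume "e k = 0"
  moreover have "basis_coeff e 0 k = 0" using basis_coeff_scaleR[of 0 0 k] by simp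
  ultimately show False using basis_coeff_basis[of k k] by simp
qed

lemma basis_proj_linear: "linear (basis_proj e n)"
  by (rule linearI)
     (simp_all add: basis_proj_def basis_coeff_add basis_coeff_scaleR scaleR_add_left
        sum.distrib scaleR_sum_right)

lemma basis_proj_tendsto: "(\<lambda>n. basis_proj e n x) \<longlonglongrightarrow> x"
  using basis_coeff_sums[of x] by (simp add: basis_proj_def sums_def)

lemma basis_proj_bound_pointwise: "\<exists>C. \<forall>n. norm (basis_proj e n x) \<le> C"
  using convergent_imp_Bseq[OF convergentI[OF basis_proj_tendsto[of x]]] by (auto simp: Bseq_def)

end

text \<open>Continuity of the partial sum projections is not part of the definition of a Schauder
  basis, so uniform boundedness cannot be invoked directly. Baire's theorem gives a ball in the
  closure of some \<open>B N\<close>; successive approximation, as in the open mapping theorem,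
  removes the closure; uniqueness of expansions identifies the result.\<close>

lemma basis_constant:
  fixes e :: "nat \<Rightarrow> 'a::banach"
  assumes e: "schauder_basis e"
  obtains M where "M \<ge> 1" "\<And>n x. norm (basis_proj e n x) \<le> M * norm x"
proof -
  let ?S = "basis_proj e"
  interpret S: linear "?S n" for n by (rule basis_proj_linear[OF e])
  define B where "B N = {x. \<forall>n. norm (?S n x) \<le> real N}" for N :: nat
  have "\<exists>N. euclidean interior_of (closure (B N)) \<noteq> {}"
  proof (rule ccontr)
    assume "\<not> ?thesis"
    then have "euclidean interior_of \<Union>(range (\<lambda>N. closure (B N))) = {}"
      by (intro Baire_category_alt disjI1 completely_metrizable_space_euclidean) auto
    moreover have "x \<in> \<Union>(range (\<lambda>N. closure (B N)))" for x
    proof -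
      obtain C where C: "norm (?S n x) \<le> C" for n
        using basis_proj_bound_pointwise[OF e, of x] by blast
      have "norm (?S n x) \<le> real (nat \<lceil>C\<rceil>)" for n
        using C[of n] by linarith
      then show ?thesis unfolding B_def by (auto intro!: exI[of _ "nat \<lceil>C\<rceil>"] subsetD[OF closure_subset])
    qed
    ultimately have "euclidean interior_of (UNIV :: 'a set) = {}" by (metis UNIV_eq_I)
    then show False using interior_of_topspace[of "euclidean :: 'a topology"] by simp
  qed
  then obtain N x0 r where r: "r > 0" "ball x0 r \<subseteq> closure (B N)"
    by (auto simp: mem_interior)
  \<comment> \<open>\<open>B N\<close> is convex and symmetric, so half the difference of
    approximants of \<open>x0 + y\<close> and \<open>x0 - y\<close> moves the ball from
    \<open>x0\<close> to the origin.\<close>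
  have approx0: "\<exists>b\<in>B N. norm (y - b) < \<epsilon>" if y: "norm y < r" and \<epsilon>: "\<epsilon> > 0" for y \<epsilon>
  proof -
    have "x0 + y \<in> closure (B N)" "x0 - y \<in> closure (B N)"
      using y r by (auto simp: subset_iff dist_norm)
    then obtain b b' where b: "b \<in> B N" "dist b (x0 + y) < \<epsilon>" "b' \<in> B N" "dist b' (x0 - y) < \<epsilon>"
      using \<epsilon> by (meson closure_approachable)
    let ?b = "(1/2) *\<^sub>R (b - b')"
    have "norm (?S n ?b) \<le> real N" for n
    proof -
      have "norm (?S n ?b) = norm (?S n b - ?S n b') / 2" by (simp add: S.scaleR S.diff)
      also have "\<dots> \<le> (norm (?S n b) + norm (?S n b')) / 2" by (simp add: norm_triangle_ineq4)
      also have "\<dots> \<le> real N" using b add_mono[of "norm (?S n b)" "real N" "norm (?S n b')" "real N"] by (simp add: B_def)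
      finally show ?thesis .
    qed
    moreover have "norm (y - ?b) < \<epsilon>"
    proof -
      have "y - ?b = (1/2) *\<^sub>R (((x0 + y) - b) - ((x0 - y) - b'))"
        by (simp add: algebra_simps flip: scaleR_add_left)
      then have "norm (y - ?b) = norm ((1/2) *\<^sub>R (((x0 + y) - b) - ((x0 - y) - b')))"
        by (rule arg_cong)
      also have "\<dots> = norm (((x0 + y) - b) - ((x0 - y) - b')) / 2"
        unfolding norm_scaleR by simp
      also have "\<dots> \<le> (norm ((x0 + y) - b) + norm ((x0 - y) - b')) / 2"
        by (intro divide_right_mono norm_triangle_ineq4) simp
      finally have "norm (y - ?b) \<le> (norm ((x0 + y) - b) + norm ((x0 - y) - b')) / 2" .
      then show ?thesis using b by (simp add: dist_norm norm_minus_commute)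
    qed
    ultimately show ?thesis by (auto simp: B_def)
  qed
  define C where "C = 2 * real N / r"
  have C0: "C \<ge> 0" using r by (simp add: C_def)
  have approx: "\<exists>b. norm (y - b) < \<epsilon> \<and> (\<forall>n. norm (?S n b) \<le> C * norm y)" if \<epsilon>: "\<epsilon> > 0" for y \<epsilon>
  proof (cases "y = 0")
    case True
    then show ?thesis using \<epsilon> by (intro exI[of _ 0]) (simp add: S.zero)
  next
    case False
    \<comment> \<open>The factor 2 puts \<open>y /\<^sub>R c\<close> at norm \<open>r / 2\<close>,
      strictly inside the ball.\<close>
    define c where "c = 2 * norm y / r"
    have c: "c > 0" using False r by (simp add: c_def)
    have "norm (y /\<^sub>R c) < r" using False r c by (simp add: c_def field_simps)
    then obtain b where b: "b \<in> B N" "norm (y /\<^sub>R c - b) < \<epsilon> / c" using approx0 \<epsilon> c by (meson divide_pos_pos)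
    have "norm (y - c *\<^sub>R b) = c * norm (y /\<^sub>R c - b)"
    proof -
      have "y - c *\<^sub>R b = c *\<^sub>R (y /\<^sub>R c - b)" using c by (simp add: algebra_simps)
      then show ?thesis using c by simp
    qed
    then have "norm (y - c *\<^sub>R b) < \<epsilon>" using b c by (simp add: field_simps)
    moreover have "norm (?S n (c *\<^sub>R b)) \<le> C * norm y" for n
    proof -
      have "norm (?S n (c *\<^sub>R b)) = c * norm (?S n b)" using c by (simp add: S.scaleR)
      also have "\<dots> \<le> c * real N" using b c by (simp add: B_def)
      finally show ?thesis by (simp add: C_def c_def field_simps)
    qed
    ultimately show ?thesis by blast
  qed
  have bound: "norm (?S m x) \<le> 2 * C * norm x" if x: "x \<noteq> 0" for m x
  proof -
    define f where "f k y = (SOME b. norm (y - b) < (1/2) ^ Suc k * norm x \<and> (\<forall>n. norm (?S n b) \<le> C * norm y))"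
      for k :: nat and y
    have f: "norm (y - f k y) < (1/2) ^ Suc k * norm x" "norm (?S n (f k y)) \<le> C * norm y" for k y n
    proof -
      have "norm (y - f k y) < (1/2) ^ Suc k * norm x \<and> (\<forall>n. norm (?S n (f k y)) \<le> C * norm y)"
        unfolding f_def by (rule someI_ex[OF approx]) (use x in simp)
      then show "norm (y - f k y) < (1/2) ^ Suc k * norm x" "norm (?S n (f k y)) \<le> C * norm y" by auto
    qed
    \<comment> \<open>\<open>r k\<close> is the remainder after \<open>k\<close> approximations and
      \<open>b k\<close> the next approximant. Remainders are bounded geometrically, so the
      \<open>b k\<close> sum to \<open>x\<close>, with bounds on \<open>?S n (b k)\<close> uniform
      in \<open>n\<close>.\<close>
    define r where "r = rec_nat x (\<lambda>k y. y - f k y)"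
    define b where "b k = f k (r k)" for k
    have r0: "r 0 = x" and rS: "r (Suc k) = r k - b k" for k by (simp_all add: r_def b_def)
    have rn: "norm (r k) \<le> (1/2) ^ k * norm x" for k
      by (cases k) (use f(1) in \<open>auto simp: r0 rS b_def intro: less_imp_le\<close>)
    have Sb: "norm (?S n (b k)) \<le> C * norm x * (1/2) ^ k" for n k
    proof -
      have "norm (?S n (b k)) \<le> C * norm (r k)" using f(2) by (simp add: b_def)
      also have "\<dots> \<le> C * ((1/2) ^ k * norm x)" using rn C0 by (intro mult_left_mono)
      finally show ?thesis by (simp add: mult_ac)
    qed
    have geo: "summable (\<lambda>k. C * norm x * (1/2) ^ k)" by (intro summable_mult summable_geometric) simp
    have b_sums: "b sums x"
    proof -
      have "(\<Sum>k<n. b k) = x - r n" for n by (induction n) (simp_all add: r0 rS)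
      moreover have "r \<longlonglongrightarrow> 0"
      proof (rule tendsto_norm_zero_cancel, rule tendsto_sandwich[OF _ _ tendsto_const])
        show "(\<lambda>k. (1/2) ^ k * norm x) \<longlonglongrightarrow> 0"
          by (intro tendsto_mult_left_zero LIMSEQ_power_zero) simp
      qed (use rn in auto)
      ultimately show ?thesis by (auto simp: sums_def intro!: tendsto_eq_intros)
    qed
    have sumS: "summable (\<lambda>k. ?S n (b k))" for n
      by (rule summable_comparison_test'[OF geo]) (rule Sb)
    have bn: "norm (b k) \<le> C * norm x * (1/2) ^ k" for k
      by (rule tendsto_upperbound[OF tendsto_norm[OF basis_proj_tendsto[OF e]]]) (use Sb in auto)
    have Sbb: "norm (?S n (b k) - b k) \<le> 2 * (C * norm x * (1/2) ^ k)" for n k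
      using norm_triangle_ineq4[of "?S n (b k)" "b k"] Sb[of n k] bn[of k] by simp
    have geo2: "summable (\<lambda>k. 2 * (C * norm x * (1/2) ^ k))" by (intro summable_mult geo)
    have sums_abs: "summable (\<lambda>k. norm (?S n (b k) - b k))" for n
      by (rule summable_comparison_test'[OF geo2]) (use Sbb in simp)
    \<comment> \<open>Tannery's theorem exchanges the limit in \<open>n\<close> with the sum over
      \<open>k\<close>: each term tends to 0 under a summable bound independent of
      \<open>n\<close>.\<close>
    have "(\<lambda>n. \<Sum>k. norm (?S n (b k) - b k)) \<longlonglongrightarrow> (\<Sum>k. 0)"
    proof (rule tannerys_theorem[THEN conjunct2, THEN conjunct2])
      show "\<forall>\<^sub>F (k, n) in at_top \<times>\<^sub>F sequentially. norm (norm (?S n (b k) - b k)) \<le> 2 * (C * norm x * (1/2) ^ k)"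
        using Sbb by (intro always_eventually) auto
      show "(\<lambda>n. norm (?S n (b k) - b k)) \<longlonglongrightarrow> 0" for k
        using tendsto_norm[OF tendsto_diff[OF basis_proj_tendsto[OF e, of "b k"] tendsto_const[of "b k"]]] by simp
    qed (use geo2 in auto)
    then have lim0: "(\<lambda>n. \<Sum>k. norm (?S n (b k) - b k)) \<longlonglongrightarrow> 0" by simp
    have "norm ((\<Sum>k. ?S n (b k)) - x) \<le> (\<Sum>k. norm (?S n (b k) - b k))" for n
    proof -
      have "(\<Sum>k. ?S n (b k)) - x = (\<Sum>k. ?S n (b k) - b k)"
        using suminf_diff[OF sumS[of n], of b] b_sums by (simp add: sums_iff)
      then show ?thesis using summable_norm[OF sums_abs[of n]] by simp
    qed
    then have "(\<lambda>n. (\<Sum>k. ?S n (b k)) - x) \<longlonglongrightarrow> 0"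
      by (intro Lim_null_comparison[OF _ lim0] always_eventually) auto
    then have lim: "(\<lambda>n. \<Sum>k. ?S n (b k)) \<longlonglongrightarrow> x" by (simp add: LIM_zero_iff)
    define a where "a m = (\<Sum>k. basis_coeff e (b k) m)" for m
    \<comment> \<open>Consecutive sums of projections differ by a multiple \<open>a m\<close> of
      \<open>e m\<close>. Hence \<open>a\<close> is an expansion of \<open>x\<close>, so it is the
      expansion, and \<open>?S m x\<close> inherits the geometric bound.\<close>
    have "(\<Sum>k. ?S (Suc m) (b k)) - (\<Sum>k. ?S m (b k)) = a m *\<^sub>R e m" for m
    proof -
      have "(\<Sum>k. ?S (Suc m) (b k)) - (\<Sum>k. ?S m (b k)) = (\<Sum>k. basis_coeff e (b k) m *\<^sub>R e m)"
        using suminf_diff[OF sumS[of "Suc m"] sumS[of m]] by (simp add: basis_proj_def)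
      also have "\<dots> = a m *\<^sub>R e m"
      proof -
        have "norm (basis_coeff e (b k) m) \<le> (2 / norm (e m)) * (C * norm x * (1/2) ^ k)" for k
        proof -
          have "basis_coeff e (b k) m *\<^sub>R e m = ?S (Suc m) (b k) - ?S m (b k)" by (simp add: basis_proj_def)
          then have "\<bar>basis_coeff e (b k) m\<bar> * norm (e m) = norm (?S (Suc m) (b k) - ?S m (b k))"
            by (metis norm_scaleR)
          also have "\<dots> \<le> norm (?S (Suc m) (b k)) + norm (?S m (b k))" by (rule norm_triangle_ineq4)
          also have "\<dots> \<le> 2 * (C * norm x * (1/2) ^ k)" using Sb[of "Suc m" k] Sb[of m k] by simp
          finally show ?thesis using basis_nonzero[OF e, of m] by (simp add: field_simps)
        qed
        then have "summable (\<lambda>k. basis_coeff e (b k) m)"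
          by (intro summable_comparison_test'[OF summable_mult[OF geo]])
        then show ?thesis unfolding a_def by (simp add: suminf_scaleR_left)
      qed
      finally show ?thesis .
    qed
    then have eq: "(\<Sum>k<m. a k *\<^sub>R e k) = (\<Sum>k. ?S m (b k))" for m
      by (induction m) (auto simp: basis_proj_def algebra_simps)
    have "(\<lambda>n. a n *\<^sub>R e n) sums x" using lim by (simp add: sums_def eq)
    then have "?S m x = (\<Sum>k. ?S m (b k))"
      using eq[of m] basis_coeff_eqI[OF e, of a x] by (simp add: basis_proj_def)
    also have "norm \<dots> \<le> (\<Sum>k. C * norm x * (1/2) ^ k)"
      using geo Sb by (intro norm_suminf_le) auto
    also have "\<dots> = 2 * C * norm x" by (subst suminf_mult) (simp_all add: suminf_geometric)
    finally show ?thesis .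
  qed
  have "norm (?S m x) \<le> max 1 (2 * C) * norm x" for m x
  proof (cases "x = 0")
    case False
    have "2 * C * norm x \<le> max 1 (2 * C) * norm x" by (intro mult_right_mono) auto
    with bound[OF False, of m] show ?thesis by linarith
  qed (simp add: S.zero)
  then show ?thesis using that[of "max 1 (2 * C)"] by simp
qed

subsection \<open>Isomorphisms and retracts of subspaces\<close>

lemma linear_map_onD:
  assumes "linear_map_on V T" "subspace V"
  shows linear_map_on_add: "x \<in> V \<Longrightarrow> y \<in> V \<Longrightarrow> T (x + y) = T x + T y"
    and linear_map_on_scaleR: "x \<in> V \<Longrightarrow> T (c *\<^sub>R x) = c *\<^sub>R T x"
    and linear_map_on_diff: "x \<in> V \<Longrightarrow> y \<in> V \<Longrightarrow> T (x - y) = T x - T y"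
    and linear_map_on_zero: "T 0 = 0"
proof -
  show add: "T (x + y) = T x + T y" if "x \<in> V" "y \<in> V" for x y
    using assms that by (simp add: linear_map_on_def)
  show sc: "T (c *\<^sub>R x) = c *\<^sub>R T x" if "x \<in> V" for c x
    using assms that by (simp add: linear_map_on_def)
  show "T 0 = 0" using sc[of 0 0] subspace_0[OF assms(2)] by simp
  show "T (x - y) = T x - T y" if "x \<in> V" "y \<in> V"
    using add[of x "(-1) *\<^sub>R y"] sc[of y "-1"] that subspace_scale[OF assms(2), of y "-1"] by simp
qed

lemma linear_map_onI:
  assumes "\<And>x y. x \<in> V \<Longrightarrow> y \<in> V \<Longrightarrow> T (x + y) = T x + T y"
    and "\<And>c x. x \<in> V \<Longrightarrow> T (c *\<^sub>R x) = c *\<^sub>R T x"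
  shows "linear_map_on V T"
  using assms by (simp add: linear_map_on_def)

lemma linear_map_on_compose:
  "linear_map_on V T \<Longrightarrow> linear_map_on W S \<Longrightarrow> T ` V \<subseteq> W \<Longrightarrow> linear_map_on V (\<lambda>x. S (T x))"
  by (simp add: linear_map_on_def image_subset_iff)

lemma linear_map_on_sum:
  assumes "linear_map_on V T" "subspace V" "\<And>i. i \<in> I \<Longrightarrow> f i \<in> V"
  shows "T (\<Sum>i\<in>I. f i) = (\<Sum>i\<in>I. T (f i))"
proof (cases "finite I")
  case True
  then show ?thesis using assms(3)
    by (induction I)
       (simp_all add: linear_map_on_zero[OF assms(1,2)] linear_map_on_add[OF assms(1,2)]
          subspace_sum[OF assms(2)])
qed (simp add: linear_map_on_zero[OF assms(1,2)])

lemma isomorphic_normedI: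
  assumes "linear_map_on V T" "T ` V \<subseteq> W" "S ` W \<subseteq> V"
    and "\<And>x. x \<in> V \<Longrightarrow> S (T x) = x" "\<And>y. y \<in> W \<Longrightarrow> T (S y) = y"
    and "\<And>x. x \<in> V \<Longrightarrow> N' (T x) \<le> C * N x" "\<And>y. y \<in> W \<Longrightarrow> N (S y) \<le> D * N' y"
  shows "isomorphic_normed V N W N'"
proof -
  have bij: "bij_betw T V W"
    by (rule bij_betw_byWitness[where f' = S]) (use assms(2-5) in auto)
  have "inv_into V T y = S y" if "y \<in> W" for y
    using that assms(3,5) bij by (intro inv_into_f_eq) (auto simp: bij_betw_def)
  then show ?thesis
    unfolding isomorphic_normed_def using assms(1,6,7) bij by metis
qed

lemma isomorphic_normedE:
  assumes "isomorphic_normed V N W N'" "subspace V"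
  obtains T S C D where "linear_map_on V T" "linear_map_on W S" "T ` V \<subseteq> W" "S ` W \<subseteq> V"
    and "\<And>x. x \<in> V \<Longrightarrow> S (T x) = x" "\<And>y. y \<in> W \<Longrightarrow> T (S y) = y"
    and "\<And>x. x \<in> V \<Longrightarrow> N' (T x) \<le> C * N x" "\<And>y. y \<in> W \<Longrightarrow> N (S y) \<le> D * N' y"
proof -
  obtain T C D where T: "linear_map_on V T" "bij_betw T V W"
    and C: "\<And>x. x \<in> V \<Longrightarrow> N' (T x) \<le> C * N x"
    and D: "\<And>y. y \<in> W \<Longrightarrow> N (inv_into V T y) \<le> D * N' y"
    using assms(1) unfolding isomorphic_normed_def by metis
  let ?S = "inv_into V T"
  have W: "W = T ` V" and inj: "inj_on T V" using T(2) by (auto simp: bij_betw_def)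
  have lin: "linear_map_on W ?S"
  proof (rule linear_map_onI)
    fix y y' assume "y \<in> W" "y' \<in> W"
    then obtain x x' where "x \<in> V" "x' \<in> V" "y = T x" "y' = T x'" by (auto simp: W)
    then show "?S (y + y') = ?S y + ?S y'"
      using inj assms(2) by (simp add: subspace_add flip: linear_map_on_add[OF T(1) assms(2)])
  next
    fix c y assume "y \<in> W"
    then obtain x where "x \<in> V" "y = T x" by (auto simp: W)
    then show "?S (c *\<^sub>R y) = c *\<^sub>R ?S y"
      using inj assms(2) by (simp add: subspace_scale flip: linear_map_on_scaleR[OF T(1) assms(2)])
  qed
  show ?thesis
    by (rule that[OF T(1) lin _ _ _ _ C D])
       (use T(2) inj in \<open>auto simp: W inv_into_into f_inv_into_f\<close>)
qed

text \<open>The constants in \<open>isomorphic_normed\<close> may be negative, which the absolute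
  value absorbs.\<close>

lemma bound_compose:
  fixes a b c C D :: real
  assumes "b \<le> C * a" "c \<le> D * b" "0 \<le> b"
  shows "c \<le> (\<bar>D\<bar> * C) * a"
proof -
  have "c \<le> \<bar>D\<bar> * b" using assms(2,3) mult_right_mono[of D "\<bar>D\<bar>" b] by linarith
  also have "\<dots> \<le> \<bar>D\<bar> * (C * a)" using assms(1) by (intro mult_left_mono) auto
  finally show ?thesis by (simp add: mult_ac)
qed

lemma isomorphic_normed_trans:
  assumes "isomorphic_normed U N V N'" "isomorphic_normed V N' W N''" "subspace U" "subspace V"
    and nn: "\<And>y. y \<in> V \<Longrightarrow> 0 \<le> N' y"
  shows "isomorphic_normed U N W N''"
proof -
  obtain T S C D where T: "linear_map_on U T" "linear_map_on V S" "T ` U \<subseteq> V" "S ` V \<subseteq> U"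
    "\<And>x. x \<in> U \<Longrightarrow> S (T x) = x" "\<And>y. y \<in> V \<Longrightarrow> T (S y) = y"
    "\<And>x. x \<in> U \<Longrightarrow> N' (T x) \<le> C * N x" "\<And>y. y \<in> V \<Longrightarrow> N (S y) \<le> D * N' y"
    using isomorphic_normedE[OF assms(1,3)] by metis
  obtain T' S' C' D' where T': "linear_map_on V T'" "linear_map_on W S'" "T' ` V \<subseteq> W" "S' ` W \<subseteq> V"
    "\<And>x. x \<in> V \<Longrightarrow> S' (T' x) = x" "\<And>y. y \<in> W \<Longrightarrow> T' (S' y) = y"
    "\<And>x. x \<in> V \<Longrightarrow> N'' (T' x) \<le> C' * N' x" "\<And>y. y \<in> W \<Longrightarrow> N' (S' y) \<le> D' * N'' y"
    using isomorphic_normedE[OF assms(2,4)] by metis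
  have TV: "T x \<in> V" if "x \<in> U" for x using T(3) that by auto
  have SV: "S' y \<in> V" if "y \<in> W" for y using T'(4) that by auto
  show ?thesis
  proof (rule isomorphic_normedI)
    show "linear_map_on U (\<lambda>x. T' (T x))" by (rule linear_map_on_compose) fact+
    show "N'' (T' (T x)) \<le> (\<bar>C'\<bar> * C) * N x" if "x \<in> U" for x
      by (rule bound_compose[OF T(7)[OF that] T'(7)[OF TV[OF that]] nn[OF TV[OF that]]])
    show "N (S (S' y)) \<le> (\<bar>D\<bar> * D') * N'' y" if "y \<in> W" for y
      by (rule bound_compose[OF T'(8)[OF that] T(8)[OF SV[OF that]] nn[OF SV[OF that]]])
    show "(\<lambda>x. T' (T x)) ` U \<subseteq> W" "(\<lambda>y. S (S' y)) ` W \<subseteq> U" using T(4) T'(3) TV SV by (auto simp: image_subset_iff)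
    show "S (S' (T' (T x))) = x" if "x \<in> U" for x using that T(3) T(5) T'(5) by (simp add: image_subset_iff)
    show "T' (T (S (S' y))) = y" if "y \<in> W" for y using that T'(4) T(6) T'(6) by (simp add: image_subset_iff)
  qed
qed

lemma isomorphic_normed_sym:
  assumes "isomorphic_normed U N V N'" "subspace U"
  shows "isomorphic_normed V N' U N"
proof -
  obtain T S C D where T: "linear_map_on U T" "linear_map_on V S" "T ` U \<subseteq> V" "S ` V \<subseteq> U"
    "\<And>x. x \<in> U \<Longrightarrow> S (T x) = x" "\<And>y. y \<in> V \<Longrightarrow> T (S y) = y"
    "\<And>x. x \<in> U \<Longrightarrow> N' (T x) \<le> C * N x" "\<And>y. y \<in> V \<Longrightarrow> N (S y) \<le> D * N' y"
    using isomorphic_normedE[OF assms] by metis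
  show ?thesis
    by (rule isomorphic_normedI[where T = S and S = T and C = D and D = C]) (fact T)+
qed

section \<open>Isomorphic subspaces of normed types and their products\<close>

abbreviation iso_subspaces :: "'a::real_normed_vector set \<Rightarrow> 'b::real_normed_vector set \<Rightarrow> bool"
    (infix \<open>\<simeq>\<close> 50)
  where "V \<simeq> W \<equiv> isomorphic_normed V norm W norm"

lemma iso_trans [trans]: "U \<simeq> V \<Longrightarrow> V \<simeq> W \<Longrightarrow> subspace U \<Longrightarrow> subspace V \<Longrightarrow> U \<simeq> W"
  using isomorphic_normed_trans[of U norm V norm W norm] by simp

lemma iso_refl: "V \<simeq> V"
  by (rule isomorphic_normedI[where T = id and S = id and C = 1 and D = 1])
     (auto simp: linear_map_on_def)

lemma iso_Times:
  assumes "V \<simeq> V'" "W \<simeq> W'" "subspace V" "subspace W"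
  shows "V \<times> W \<simeq> V' \<times> W'"
proof -
  obtain T S C D where T: "linear_map_on V T" "linear_map_on V' S" "T ` V \<subseteq> V'" "S ` V' \<subseteq> V"
    "\<And>x. x \<in> V \<Longrightarrow> S (T x) = x" "\<And>y. y \<in> V' \<Longrightarrow> T (S y) = y"
    "\<And>x. x \<in> V \<Longrightarrow> norm (T x) \<le> C * norm x" "\<And>y. y \<in> V' \<Longrightarrow> norm (S y) \<le> D * norm y"
    using isomorphic_normedE[OF assms(1,3)] by metis
  obtain T' S' C' D' where T': "linear_map_on W T'" "linear_map_on W' S'" "T' ` W \<subseteq> W'" "S' ` W' \<subseteq> W"
    "\<And>x. x \<in> W \<Longrightarrow> S' (T' x) = x" "\<And>y. y \<in> W' \<Longrightarrow> T' (S' y) = y"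
    "\<And>x. x \<in> W \<Longrightarrow> norm (T' x) \<le> C' * norm x" "\<And>y. y \<in> W' \<Longrightarrow> norm (S' y) \<le> D' * norm y"
    using isomorphic_normedE[OF assms(2,4)] by metis
  have le: "norm (x', y') \<le> (\<bar>C1\<bar> + \<bar>C2\<bar>) * norm (x, y)"
    if "norm x' \<le> C1 * norm x" "norm y' \<le> C2 * norm y"
    for x :: "'x::real_normed_vector" and y :: "'y::real_normed_vector"
      and x' :: "'u::real_normed_vector" and y' :: "'v::real_normed_vector" and C1 C2
  proof -
    have "norm (x', y') \<le> norm x' + norm y'" by (rule norm_Pair_le)
    also have "norm x' \<le> \<bar>C1\<bar> * norm (x, y)"
      using that(1) norm_fst_le[of x y] by (smt (verit) mult_left_mono mult_right_mono norm_ge_zero)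
    also have "norm y' \<le> \<bar>C2\<bar> * norm (x, y)"
      using that(2) norm_snd_le[of y x] by (smt (verit) mult_left_mono mult_right_mono norm_ge_zero)
    finally show ?thesis by (simp add: algebra_simps)
  qed
  show ?thesis
  proof (rule isomorphic_normedI)
    show "linear_map_on (V \<times> W) (map_prod T T')"
      using T(1) T'(1) by (auto simp: linear_map_on_def)
    show "map_prod T T' ` (V \<times> W) \<subseteq> V' \<times> W'" "map_prod S S' ` (V' \<times> W') \<subseteq> V \<times> W"
      using T(3,4) T'(3,4) by auto
    show "map_prod S S' (map_prod T T' x) = x" if "x \<in> V \<times> W" for x using that T(5) T'(5) by auto
    show "map_prod T T' (map_prod S S' x) = x" if "x \<in> V' \<times> W'" for x using that T(6) T'(6) by auto
    show "norm (map_prod T T' x) \<le> (\<bar>C\<bar> + \<bar>C'\<bar>) * norm x" if "x \<in> V \<times> W" for x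
      using that T(7) T'(7) by (auto intro!: le)
    show "norm (map_prod S S' x) \<le> (\<bar>D\<bar> + \<bar>D'\<bar>) * norm x" if "x \<in> V' \<times> W'" for x
      using that T(8) T'(8) by (auto intro!: le)
  qed
qed

lemma iso_Times_commute: "V \<times> W \<simeq> W \<times> V"
  by (rule isomorphic_normedI[where T = prod.swap and S = prod.swap and C = 1 and D = 1])
     (auto simp: linear_map_on_def norm_Pair add.commute)

lemma iso_Times_assoc: "(U \<times> V) \<times> W \<simeq> U \<times> (V \<times> W)"
  by (rule isomorphic_normedI[where T = "\<lambda>((x, y), z). (x, (y, z))" and S = "\<lambda>(x, (y, z)). ((x, y), z)"
        and C = 1 and D = 1])
     (auto simp: linear_map_on_def norm_Pair add.assoc)

text \<open>Up to isomorphism, \<open>A\<close> is a complemented subspace of \<open>V\<close>. A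
  section with a bounded left inverse expresses this for spaces in different types, and for
  \<open>V\<close> that are not a whole type.\<close>

definition retract :: "'a::real_normed_vector set \<Rightarrow> 'b::real_normed_vector set \<Rightarrow> bool"
  where "retract A V \<longleftrightarrow> (\<exists>i r C D. linear_map_on A i \<and> linear_map_on V r \<and> i ` A \<subseteq> V \<and> r ` V \<subseteq> A \<and>
    (\<forall>a\<in>A. r (i a) = a) \<and> (\<forall>a\<in>A. norm (i a) \<le> C * norm a) \<and> (\<forall>v\<in>V. norm (r v) \<le> D * norm v))"

lemma retractI:
  assumes "linear_map_on A i" "linear_map_on V r" "i ` A \<subseteq> V" "r ` V \<subseteq> A"
    and "\<And>a. a \<in> A \<Longrightarrow> r (i a) = a"
    and "\<And>a. a \<in> A \<Longrightarrow> norm (i a) \<le> C * norm a" "\<And>v. v \<in> V \<Longrightarrow> norm (r v) \<le> D * norm v"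
  shows "retract A V"
  unfolding retract_def using assms by blast

lemma retractE:
  assumes "retract A V"
  obtains i r C where "linear_map_on A i" "linear_map_on V r" "i ` A \<subseteq> V" "r ` V \<subseteq> A"
    and "\<And>a. a \<in> A \<Longrightarrow> r (i a) = a" "C \<ge> 0"
    and "\<And>a. a \<in> A \<Longrightarrow> norm (i a) \<le> C * norm a" "\<And>v. v \<in> V \<Longrightarrow> norm (r v) \<le> C * norm v"
proof -
  obtain i r C D where *: "linear_map_on A i \<and> linear_map_on V r \<and> i ` A \<subseteq> V \<and> r ` V \<subseteq> A \<and>
    (\<forall>a\<in>A. r (i a) = a) \<and> (\<forall>a\<in>A. norm (i a) \<le> C * norm a) \<and> (\<forall>v\<in>V. norm (r v) \<le> D * norm v)"
    using assms unfolding retract_def by (elim exE)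
  have le: "C * t \<le> (\<bar>C\<bar> + \<bar>D\<bar>) * t" "D * t \<le> (\<bar>C\<bar> + \<bar>D\<bar>) * t" if "t \<ge> 0" for t
    using that by (auto intro!: mult_right_mono)
  show ?thesis
  proof (rule that[of i r "\<bar>C\<bar> + \<bar>D\<bar>"])
    show "norm (i a) \<le> (\<bar>C\<bar> + \<bar>D\<bar>) * norm a" if "a \<in> A" for a
      using * that order_trans[OF _ le(1)[of "norm a"]] by simp
    show "norm (r v) \<le> (\<bar>C\<bar> + \<bar>D\<bar>) * norm v" if "v \<in> V" for v
      using * that order_trans[OF _ le(2)[of "norm v"]] by simp
  qed (use * in auto)
qed

lemma retract_refl: "retract A A"
  by (rule retractI[where i = id and r = id and C = 1 and D = 1]) (auto simp: linear_map_on_def)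

text \<open>The complement is the kernel of the retraction: \<open>v\<close> splits into
  \<open>i (r v)\<close> and a remainder that \<open>r\<close> kills.\<close>

lemma retract_complement:
  assumes "retract A V" "subspace A" "subspace V"
  obtains W where "subspace W" "V \<simeq> A \<times> W" "W \<subseteq> V"
proof -
  obtain i r C where i: "linear_map_on A i" "linear_map_on V r" "i ` A \<subseteq> V" "r ` V \<subseteq> A"
    "\<And>a. a \<in> A \<Longrightarrow> r (i a) = a" "C \<ge> 0"
    "\<And>a. a \<in> A \<Longrightarrow> norm (i a) \<le> C * norm a" "\<And>v. v \<in> V \<Longrightarrow> norm (r v) \<le> C * norm v"
    using retractE[OF assms(1)] by metis
  note r = linear_map_onD[OF i(2) assms(3)] and i' = linear_map_onD[OF i(1) assms(2)]
  define W where "W = {v \<in> V. r v = 0}"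
  have W: "subspace W"
    unfolding subspace_def W_def
    using assms(3) r by (auto simp: subspace_0 subspace_add subspace_scale)
  have iV: "i a \<in> V" if "a \<in> A" for a using i(3) that by auto
  have rA: "r v \<in> A" if "v \<in> V" for v using i(4) that by auto
  have bi: "norm (i (r v)) \<le> C * (C * norm v)" if "v \<in> V" for v
  proof -
    have "norm (i (r v)) \<le> C * norm (r v)" using i(7) rA[OF that] by auto
    also have "\<dots> \<le> C * (C * norm v)" using i(6) i(8)[OF that] by (intro mult_left_mono) auto
    finally show ?thesis .
  qed
  have "V \<simeq> A \<times> W"
  proof (rule isomorphic_normedI)
    let ?T = "\<lambda>v. (r v, v - i (r v))" and ?S = "\<lambda>(a, w). i a + w"
    show "linear_map_on V ?T"
      by (rule linear_map_onI) (simp_all add: r i' rA algebra_simps)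
    show "?T ` V \<subseteq> A \<times> W" "?S ` (A \<times> W) \<subseteq> V"
      using assms(3) by (auto simp: W_def rA iV r i(5) subspace_add subspace_diff)
    show "?S (?T x) = x" for x by simp
    show "?T (?S y) = y" if "y \<in> A \<times> W" for y using that by (auto simp: W_def r iV i(5))
    show "norm (?T v) \<le> (C + 1 + C * C) * norm v" if "v \<in> V" for v
    proof -
      have "norm (?T v) \<le> norm (r v) + norm (v - i (r v))" by (rule norm_Pair_le)
      also have "norm (v - i (r v)) \<le> norm v + norm (i (r v))" by (rule norm_triangle_ineq4)
      finally show ?thesis using i(8)[OF that] bi[OF that] by (simp add: algebra_simps)
    qed
    show "norm (?S y) \<le> (C + 1) * norm y" if "y \<in> A \<times> W" for y
    proof -
      obtain a w where y: "y = (a, w)" "a \<in> A" using \<open>y \<in> A \<times> W\<close> by (cases y) auto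
      have "norm (i a + w) \<le> norm (i a) + norm w" by (rule norm_triangle_ineq)
      also have "norm (i a) \<le> C * norm (a, w)"
        using i(7)[OF y(2)] mult_left_mono[OF norm_fst_le[of a w] i(6)] by linarith
      also have "norm w \<le> norm (a, w)" by (rule norm_snd_le)
      finally show ?thesis by (simp add: y algebra_simps)
    qed
  qed
  then show ?thesis using W that by (auto simp: W_def)
qed

subsection \<open>The $c_0$-sum of a subspace of $\ell_\infty$\<close>

type_synonym linf = "nat \<Rightarrow>\<^sub>C real"

lemma bcontfun_nat: "(\<And>i. \<bar>f i\<bar> \<le> C) \<Longrightarrow> f \<in> bcontfun" for f :: "nat \<Rightarrow> real"
  by (rule bcontfun_normI[where b = C]) auto

lemma apply_Bcontfun_nat: "(\<And>i. \<bar>f i\<bar> \<le> C) \<Longrightarrow> apply_bcontfun (Bcontfun f) = f" for f :: "nat \<Rightarrow> real"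
  by (rule Bcontfun_inverse) (rule bcontfun_nat)

text \<open>A sequence in \<open>linf\<close> is stored in a single element through the pairing of
  naturals, so that infinite sums of spaces stay inside \<open>linf\<close>, where universality
  applies. The inverse \<open>join\<close> is meaningful only on bounded sequences.\<close>

definition slice :: "linf \<Rightarrow> nat \<Rightarrow> linf"
  where "slice z k = Bcontfun (\<lambda>i. z (prod_encode (k, i)))"

definition join :: "(nat \<Rightarrow> linf) \<Rightarrow> linf"
  where "join y = Bcontfun (\<lambda>m. y (fst (prod_decode m)) (snd (prod_decode m)))"

lemma apply_slice [simp]: "apply_bcontfun (slice z k) i = z (prod_encode (k, i))"
  unfolding slice_def using norm_bounded[of z] by (subst apply_Bcontfun_nat[of _ "norm z"]) auto

lemma slice_add [simp]: "slice (x + y) k = slice x k + slice y k"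
  and slice_diff [simp]: "slice (x - y) k = slice x k - slice y k"
  and slice_scaleR [simp]: "slice (c *\<^sub>R x) k = c *\<^sub>R slice x k"
  and slice_zero [simp]: "slice 0 k = 0"
  by (rule bcontfun_eqI, simp)+

lemma slice_sum: "slice (sum f I) k = (\<Sum>i\<in>I. slice (f i) k)"
  by (induction I rule: infinite_finite_induct) auto

lemma norm_slice_le: "norm (slice z k) \<le> norm z"
  by (rule norm_bound) (use norm_bounded[of z] in auto)

lemma norm_le_slices:
  assumes "\<And>k. norm (slice z k) \<le> C"
  shows "norm z \<le> C"
proof (rule norm_bound)
  fix m
  have "apply_bcontfun z m = slice z (fst (prod_decode m)) (snd (prod_decode m))" by simp
  then show "norm (apply_bcontfun z m) \<le> C"
    using norm_bounded[of "slice z (fst (prod_decode m))"] assms order_trans by metis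
qed

lemma slices_eqI:
  assumes "\<And>k. slice z k = slice w k"
  shows "z = w"
proof -
  have "norm (z - w) \<le> 0" by (rule norm_le_slices) (simp add: assms)
  then show ?thesis by simp
qed

lemma slice_join:
  assumes "\<And>k. norm (y k) \<le> C"
  shows "slice (join y) k = y k"
proof (rule bcontfun_eqI)
  have b: "\<bar>y k i\<bar> \<le> C" for k i
    using norm_bounded[of "y k" i] assms[of k] by simp
  show "apply_bcontfun (slice (join y) k) i = y k i" for i
    unfolding join_def apply_slice by (subst apply_Bcontfun_nat[of _ C]) (auto simp: b)
qed

lemma slices_eq_iff: "z = w \<longleftrightarrow> (\<forall>k. slice z k = slice w k)"
  by (auto intro: slices_eqI)

text \<open>The supremum norm of \<open>linf\<close> is the norm of the sum. Slices must tend to 0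
  because for nonzero \<open>Y\<close> the space of all bounded sequences would not be
  separable.\<close>

definition c0_sum :: "linf set \<Rightarrow> linf set"
  where "c0_sum Y = {z. (\<forall>k. slice z k \<in> Y) \<and> (\<lambda>k. slice z k) \<longlonglongrightarrow> 0}"

lemma subspace_c0_sum: "subspace Y \<Longrightarrow> subspace (c0_sum Y)"
proof -
  have "slice (x + y) = (\<lambda>k. slice x k + slice y k)" "slice (c *\<^sub>R x) = (\<lambda>k. c *\<^sub>R slice x k)"
    "slice 0 = (\<lambda>k. 0)" for x y c
    by auto
  then show "subspace Y \<Longrightarrow> subspace (c0_sum Y)"
    unfolding subspace_def c0_sum_def
    by (auto intro: tendsto_add_zero bounded_linear.tendsto_zero[OF bounded_linear_scaleR_right])
qed

lemma tendsto_slice: "(f \<longlongrightarrow> z) F \<Longrightarrow> ((\<lambda>n. slice (f n) k) \<longlongrightarrow> slice z k) F"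
proof -
  assume "(f \<longlongrightarrow> z) F"
  then have "((\<lambda>n. norm (f n - z)) \<longlongrightarrow> 0) F" by (simp add: tendsto_norm_zero LIM_zero)
  then have "((\<lambda>n. slice (f n) k - slice z k) \<longlongrightarrow> 0) F"
    by (rule Lim_null_comparison[rotated])
       (simp add: norm_slice_le[of "_ - z", simplified] always_eventually)
  then show ?thesis by (simp add: LIM_zero_iff)
qed

lemma closed_c0_sum:
  assumes "closed Y"
  shows "closed (c0_sum Y)"
  unfolding closed_sequential_limits
proof safe
  fix f z assume f: "\<forall>n. f n \<in> c0_sum Y" and lim: "f \<longlonglongrightarrow> z"
  have "slice z k \<in> Y" for k
    using f by (intro closed_sequentially[OF assms _ tendsto_slice[OF lim]]) (auto simp: c0_sum_def)
  moreover have "(\<lambda>k. slice z k) \<longlonglongrightarrow> 0"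
  proof (rule LIMSEQ_I)
    fix r :: real assume "0 < r"
    then obtain n where n: "norm (f n - z) < r / 2"
      using LIMSEQ_D[OF lim, of "r / 2"] by auto
    have "(\<lambda>k. slice (f n) k) \<longlonglongrightarrow> 0" using f by (simp add: c0_sum_def)
    then obtain N where N: "\<And>k. k \<ge> N \<Longrightarrow> norm (slice (f n) k) < r / 2"
      using LIMSEQ_D[of _ 0 "r / 2"] \<open>0 < r\<close> by (metis diff_zero half_gt_zero)
    have "norm (slice z k - 0) < r" if "k \<ge> N" for k
    proof -
      have "norm (slice z k) \<le> norm (slice (f n) k) + norm (slice (f n - z) k)"
        using norm_triangle_ineq4[of "slice (f n) k" "slice (f n - z) k"] by simp
      then have "norm (slice z k) < r / 2 + r / 2"
        using N[OF that] n norm_slice_le[of "f n - z" k] by linarith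
      then show ?thesis by simp
    qed
    then show "\<exists>no. \<forall>k\<ge>no. norm (slice z k - 0) < r" by blast
  qed
  ultimately show "z \<in> c0_sum Y" by (simp add: c0_sum_def)
qed

lemma join_in_c0_sum:
  assumes "\<And>k. y k \<in> Y" "y \<longlonglongrightarrow> 0"
  shows "join y \<in> c0_sum Y" "slice (join y) k = y k"
proof -
  obtain C where "\<And>k. norm (y k) \<le> C"
    using convergent_imp_Bseq[OF convergentI[OF assms(2)]] by (auto simp: Bseq_def)
  then have "slice (join y) = y" by (intro ext slice_join)
  then show "join y \<in> c0_sum Y" "slice (join y) k = y k" using assms by (auto simp: c0_sum_def)
qed

text \<open>Shifting the component in \<open>A\<close> of each coordinate by one makes room for another copy of \<open>A\<close>.\<close>

lemma c0_sum_absorbs: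
  assumes "retract A Y" "subspace A" "subspace Y"
  shows "c0_sum Y \<simeq> A \<times> c0_sum Y"
proof -
  obtain i r C where i: "linear_map_on A i" "linear_map_on Y r" "i ` A \<subseteq> Y" "r ` Y \<subseteq> A"
    "\<And>a. a \<in> A \<Longrightarrow> r (i a) = a" "C \<ge> 0"
    "\<And>a. a \<in> A \<Longrightarrow> norm (i a) \<le> C * norm a" "\<And>v. v \<in> Y \<Longrightarrow> norm (r v) \<le> C * norm v"
    using retractE[OF assms(1)] by metis
  note r = linear_map_onD[OF i(2) assms(3)] and i' = linear_map_onD[OF i(1) assms(2)]
  have iY: "i a \<in> Y" if "a \<in> A" for a using i(3) that by auto
  have rA: "r v \<in> A" if "v \<in> Y" for v using i(4) that by auto
  \<comment> \<open>\<open>q\<close> is the bounded projection of \<open>Y\<close> onto the copy of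
    \<open>A\<close> inside it.\<close>
  define q where "q v = i (r v)" for v
  have qY: "q v \<in> Y" if "v \<in> Y" for v using that by (simp add: q_def iY rA)
  have rq: "r (q v) = r v" if "v \<in> Y" for v using that by (simp add: q_def rA i(5))
  have qq: "q (q v) = q v" if "v \<in> Y" for v using rq[OF that] by (simp add: q_def)
  have qi: "q (i a) = i a" if "a \<in> A" for a using that by (simp add: q_def i(5))
  have q: "q (x + y) = q x + q y" "q (x - y) = q x - q y" if "x \<in> Y" "y \<in> Y" for x y
    using that by (simp_all add: q_def r i' rA)
  have qs: "q (c *\<^sub>R x) = c *\<^sub>R q x" if "x \<in> Y" for x c
    using that by (simp add: q_def r i' rA)
  have q0: "q 0 = 0" by (simp add: q_def r i')
  define K where "K = C * C"
  have K0: "K \<ge> 0" using i(6) by (simp add: K_def)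
  have qb: "norm (q v) \<le> K * norm v" if "v \<in> Y" for v
  proof -
    have "norm (q v) \<le> C * norm (r v)" unfolding q_def using i(7) rA[OF that] by auto
    also have "\<dots> \<le> C * (C * norm v)" using i(6) i(8)[OF that] by (intro mult_left_mono) auto
    finally show ?thesis by (simp add: K_def)
  qed
  have qlim: "(\<lambda>k. q (y k)) \<longlonglongrightarrow> 0" if "y \<longlonglongrightarrow> 0" "\<And>k. y k \<in> Y" for y
  proof (rule Lim_null_comparison)
    show "\<forall>\<^sub>F k in sequentially. norm (q (y k)) \<le> K * norm (y k)" using qb that(2) by simp
    show "(\<lambda>k. K * norm (y k)) \<longlonglongrightarrow> 0" using that(1) by (intro tendsto_mult_right_zero tendsto_norm_zero)
  qed
  \<comment> \<open>\<open>f\<close> moves the \<open>A\<close>-parts one place down and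
    \<open>g a\<close> moves them one place up. The part of slice 0 that \<open>f\<close> drops is
    recorded by \<open>r (slice z 0)\<close>, and \<open>g\<close> restores it as
    \<open>i a\<close>.\<close>
  define f where "f z k = slice z k - q (slice z k) + q (slice z (Suc k))" for z k
  define g where "g a w k = (case k of 0 \<Rightarrow> i a + (slice w 0 - q (slice w 0))
      | Suc n \<Rightarrow> q (slice w n) + (slice w (Suc n) - q (slice w (Suc n))))" for a w k
  have sY: "slice z k \<in> Y" and slim: "(\<lambda>k. slice z k) \<longlonglongrightarrow> 0" if "z \<in> c0_sum Y" for z k
    using that by (auto simp: c0_sum_def)
  have fY: "f z k \<in> Y" and flim: "f z \<longlonglongrightarrow> 0" if "z \<in> c0_sum Y" for z k
  proof -
    note s = sY[OF that] and l = slim[OF that]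
    show "f z k \<in> Y" unfolding f_def using s qY by (intro subspace_add subspace_diff assms(3)) auto
    have "f z \<longlonglongrightarrow> 0 - 0 + 0"
      unfolding f_def[abs_def] using s l LIMSEQ_Suc[OF l] by (intro tendsto_intros qlim) auto
    then show "f z \<longlonglongrightarrow> 0" by simp
  qed
  have gY: "g a w k \<in> Y" and glim: "g a w \<longlonglongrightarrow> 0" if "a \<in> A" "w \<in> c0_sum Y" for a w k
  proof -
    note s = sY[OF that(2)] and l = slim[OF that(2)]
    show "g a w k \<in> Y" unfolding g_def using s qY iY that(1)
      by (cases k) (auto intro!: subspace_add subspace_diff assms(3))
    have "(\<lambda>n. q (slice w n) + (slice w (Suc n) - q (slice w (Suc n)))) \<longlonglongrightarrow> 0 + (0 - 0)"
      using s l LIMSEQ_Suc[OF l] by (intro tendsto_intros qlim) auto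
    then have "(\<lambda>n. g a w (Suc n)) \<longlonglongrightarrow> 0" by (simp add: g_def)
    then show "g a w \<longlonglongrightarrow> 0" by (simp add: filterlim_sequentially_Suc)
  qed
  have jf: "join (f z) \<in> c0_sum Y" "slice (join (f z)) k = f z k" if "z \<in> c0_sum Y" for z k
    using join_in_c0_sum[of "f z"] fY[OF that] flim[OF that] by auto
  have jg: "join (g a w) \<in> c0_sum Y" "slice (join (g a w)) k = g a w k"
    if "a \<in> A" "w \<in> c0_sum Y" for a w k
    using join_in_c0_sum[of "g a w"] gY[OF that] glim[OF that] by auto
  show ?thesis
  proof (rule isomorphic_normedI)
    let ?T = "\<lambda>z. (r (slice z 0), join (f z))" and ?S = "\<lambda>(a, w). join (g a w)"
    note Z = subspace_c0_sum[OF assms(3)]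
    show "linear_map_on (c0_sum Y) ?T"
    proof (rule linear_map_onI)
      fix x y assume xy: "x \<in> c0_sum Y" "y \<in> c0_sum Y"
      then have "x + y \<in> c0_sum Y" using Z by (simp add: subspace_add)
      then have "join (f (x + y)) = join (f x) + join (f y)"
        using xy sY[OF xy(1)] sY[OF xy(2)] by (subst slices_eq_iff) (simp add: jf f_def q(1))
      then show "?T (x + y) = ?T x + ?T y" using xy by (simp add: r sY)
    next
      fix c x assume x: "x \<in> c0_sum Y"
      then have "c *\<^sub>R x \<in> c0_sum Y" using Z by (simp add: subspace_scale)
      then have "join (f (c *\<^sub>R x)) = c *\<^sub>R join (f x)"
        using x sY[OF x] by (subst slices_eq_iff) (simp add: jf f_def qs scaleR_add_right scaleR_diff_right)
      then show "?T (c *\<^sub>R x) = c *\<^sub>R ?T x" using x by (simp add: r sY)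
    qed
    show "?T ` c0_sum Y \<subseteq> A \<times> c0_sum Y" "?S ` (A \<times> c0_sum Y) \<subseteq> c0_sum Y"
      using jf(1) jg(1) rA sY by auto
    show "?S (?T z) = z" if z: "z \<in> c0_sum Y" for z
    proof -
      note [simp] = jf[OF z] sY[OF z] rA
      have "slice (join (g (r (slice z 0)) (join (f z)))) k = slice z k" for k
        by (simp add: jg; cases k)
           (simp_all add: g_def, simp_all add: f_def q q0 qq qY subspace_add subspace_diff assms(3) q_def[symmetric])
      then show ?thesis by (subst slices_eq_iff) simp
    qed
    show "?T (?S x) = x" if x: "x \<in> A \<times> c0_sum Y" for x
    proof -
      obtain a w where aw: "x = (a, w)" "a \<in> A" "w \<in> c0_sum Y" using x by auto
      note [simp] = aw(2) jg[OF aw(2,3)] sY[OF aw(3)] iY qY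
      have "r (slice (join (g a w)) 0) = a"
        by (simp add: g_def r rq subspace_add subspace_diff assms(3) i(5))
      moreover have "slice (join (f (join (g a w)))) k = slice w k" for k
        by (simp add: jf; cases k)
           (simp_all add: f_def g_def q qq qi subspace_add subspace_diff assms(3))
      ultimately show ?thesis unfolding aw(1) by (auto intro: slices_eqI)
    qed
    show "norm (?T z) \<le> (C + (1 + K + K)) * norm z" if z: "z \<in> c0_sum Y" for z
    proof -
      have b: "norm (slice z k) \<le> norm z" "norm (q (slice z k)) \<le> K * norm z" for k
        using norm_slice_le[of z k] order_trans[OF qb[OF sY[OF z]] mult_left_mono[OF norm_slice_le K0]]
        by auto
      have "norm (f z k) \<le> norm z + K * norm z + K * norm z" for k
        unfolding f_def using b(1)[of k] b(2)[of k] b(2)[of "Suc k"]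
        by (smt (verit) norm_triangle_ineq norm_triangle_ineq4)
      then have "norm (slice (join (f z)) k) \<le> norm z + K * norm z + K * norm z" for k
        by (simp add: jf[OF z])
      then have "norm (join (f z)) \<le> norm z + K * norm z + K * norm z"
        by (rule norm_le_slices)
      moreover have "norm (r (slice z 0)) \<le> C * norm z"
        using order_trans[OF i(8)[OF sY[OF z]] mult_left_mono[OF norm_slice_le i(6)]] .
      ultimately have "norm (r (slice z 0)) + norm (join (f z)) \<le> (C + (1 + K + K)) * norm z"
        by (simp add: algebra_simps)
      then show ?thesis using norm_Pair_le order_trans by blast
    qed
    show "norm (?S x) \<le> (C + (1 + K + K)) * norm x" if x: "x \<in> A \<times> c0_sum Y" for x
    proof -
      obtain a w where aw: "x = (a, w)" "a \<in> A" "w \<in> c0_sum Y" using x by auto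
      have nw: "norm w \<le> norm x" and na: "norm a \<le> norm x"
        unfolding aw by (rule norm_snd_le, rule norm_fst_le)
      have b1: "norm (slice w k) \<le> norm x" for k using norm_slice_le[of w k] nw by linarith
      have b2: "norm (q (slice w k)) \<le> K * norm x" for k
        using order_trans[OF qb[OF sY[OF aw(3)]] mult_left_mono[OF b1 K0]] .
      have b3: "norm (i a) \<le> C * norm x" using order_trans[OF i(7)[OF aw(2)] mult_left_mono[OF na i(6)]] .
      have pos: "0 \<le> K * norm x" "0 \<le> C * norm x" using K0 i(6) by auto
      have "norm (g a w k) \<le> C * norm x + (norm x + K * norm x + K * norm x)" for k
      proof (cases k)
        case 0
        show ?thesis using b1[of 0] b2[of 0] b3 pos
          norm_triangle_ineq[of "i a" "slice w 0 - q (slice w 0)"] norm_triangle_ineq4[of "slice w 0" "q (slice w 0)"]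
          by (simp add: g_def 0)
      next
        case (Suc n)
        show ?thesis using b1[of "Suc n"] b2[of n] b2[of "Suc n"] pos
          norm_triangle_ineq[of "q (slice w n)" "slice w (Suc n) - q (slice w (Suc n))"]
          norm_triangle_ineq4[of "slice w (Suc n)" "q (slice w (Suc n))"]
          by (simp add: g_def Suc)
      qed
      then have "norm (slice (join (g a w)) k) \<le> C * norm x + (norm x + K * norm x + K * norm x)" for k
        by (simp add: jg[OF aw(2,3)])
      then have "norm (join (g a w)) \<le> C * norm x + (norm x + K * norm x + K * norm x)"
        by (rule norm_le_slices)
      then show ?thesis by (simp add: aw(1) algebra_simps)
    qed
  qed
qed

section \<open>Separability and the approximation property of the sum\<close>

lemma separable_subsetE:
  assumes "separable_space (top_of_set Y)"
  obtains D where "countable D" "D \<subseteq> Y" "\<And>y \<epsilon>. y \<in> Y \<Longrightarrow> \<epsilon> > 0 \<Longrightarrow> \<exists>d\<in>D. dist d y < \<epsilon>"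
proof -
  obtain D where D: "countable D" "D \<subseteq> Y" "top_of_set Y closure_of D = Y"
    using assms unfolding separable_space_def by auto
  then have "Y \<subseteq> closure (Y \<inter> D)" by (auto simp: closure_of_subtopology)
  then have "Y \<subseteq> closure D" using closure_mono[of "Y \<inter> D" D] by auto
  then show ?thesis using that[OF D(1,2)] by (meson closure_approachable subsetD)
qed

lemma separable_subsetI:
  assumes "countable D" "D \<subseteq> Y" "\<And>y \<epsilon>. y \<in> Y \<Longrightarrow> \<epsilon> > 0 \<Longrightarrow> \<exists>d\<in>D. dist d y < \<epsilon>"
  shows "separable_space (top_of_set Y)"
proof -
  have "Y \<subseteq> closure D" using assms(3) by (auto simp: closure_approachable)
  then have "top_of_set Y closure_of D = Y"
    using assms(2) by (auto simp: closure_of_subtopology Int_absorb1)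
  then show ?thesis unfolding separable_space_def using assms by auto
qed

text \<open>Finite lists from a countable dense subset of \<open>Y\<close>, padded with zeros,
  suffice because all but finitely many slices of an element are small.\<close>

lemma separable_c0_sum:
  assumes "separable_space (top_of_set Y)" "subspace Y"
  shows "separable_space (top_of_set (c0_sum Y))"
proof -
  obtain D where D: "countable D" "D \<subseteq> Y" "\<And>y \<epsilon>. y \<in> Y \<Longrightarrow> \<epsilon> > 0 \<Longrightarrow> \<exists>d\<in>D. dist d y < \<epsilon>"
    using separable_subsetE[OF assms(1)] by metis
  define J where "J ds = join (\<lambda>k. if k < length ds then ds ! k else 0)" for ds
  have J: "J ds \<in> c0_sum Y" "slice (J ds) k = (if k < length ds then ds ! k else 0)"
    if "ds \<in> lists D" for ds k
  proof -
    let ?y = "\<lambda>k. if k < length ds then ds ! k else 0"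
    have Y: "?y k \<in> Y" for k
      using that D(2) nth_mem[of k ds] subspace_0[OF assms(2)] by (auto simp: subset_iff)
    have lim: "?y \<longlonglongrightarrow> 0"
      by (rule tendsto_eventually) (auto simp: eventually_sequentially intro!: exI[of _ "length ds"])
    show "J ds \<in> c0_sum Y" "slice (J ds) k = ?y k"
      unfolding J_def by (rule join_in_c0_sum[OF Y lim])+
  qed
  show ?thesis
  proof (rule separable_subsetI)
    show "countable (J ` lists D)" using D(1) by simp
    show "J ` lists D \<subseteq> c0_sum Y" using J(1) by auto
    fix z \<epsilon> :: _ assume z: "z \<in> c0_sum Y" and \<epsilon>: "(\<epsilon>::real) > 0"
    obtain N where N: "\<And>k. k \<ge> N \<Longrightarrow> norm (slice z k) < \<epsilon> / 2"
      using z LIMSEQ_D[of "slice z" 0 "\<epsilon> / 2"] \<epsilon> by (auto simp: c0_sum_def)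
    have "\<forall>k. \<exists>d\<in>D. dist d (slice z k) < \<epsilon> / 2"
      using D(3)[of "slice z _" "\<epsilon> / 2"] z \<epsilon> by (simp add: c0_sum_def)
    then obtain d where d: "\<And>k. d k \<in> D" "\<And>k. dist (d k) (slice z k) < \<epsilon> / 2" by metis
    let ?ds = "map d [0..<N]"
    have ds: "?ds \<in> lists D" using d(1) by auto
    have "norm (slice (J ?ds - z) k) \<le> \<epsilon> / 2" for k
      using N[of k] d(2)[of k] by (auto simp: J(2)[OF ds] dist_norm intro: less_imp_le)
    then have "norm (J ?ds - z) \<le> \<epsilon> / 2" by (rule norm_le_slices)
    then show "\<exists>d\<in>J ` lists D. dist d z < \<epsilon>" using ds \<epsilon> by (auto simp: dist_norm intro!: bexI[of _ "?ds"])
  qed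
qed

text \<open>One approximating operator of \<open>Y\<close> acts on the first \<open>n\<close> slices
  and the others are dropped: finitely many slices keep the rank finite, and the supremum norm
  preserves the constant \<open>L\<close>. Beyond \<open>n\<close> all slices of the finitely many
  given elements are small.\<close>

lemma BAP_c0_sum:
  assumes "bounded_approximation_property Y" "subspace Y"
  shows "bounded_approximation_property (c0_sum Y)"
proof -
  obtain L where L: "L > 0" and A: "\<forall>F \<epsilon>. finite F \<and> F \<subseteq> Y \<and> \<epsilon> > 0 \<longrightarrow>
      (\<exists>T. linear_map_on Y T \<and> T ` Y \<subseteq> Y \<and> (\<exists>B. finite B \<and> T ` Y \<subseteq> span B) \<and>
        (\<forall>x\<in>Y. norm (T x) \<le> L * norm x) \<and> (\<forall>x\<in>F. norm (x - T x) \<le> \<epsilon>))"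
    using assms(1) unfolding bounded_approximation_property_def by (elim exE conjE)
  have "\<exists>T. linear_map_on (c0_sum Y) T \<and> T ` c0_sum Y \<subseteq> c0_sum Y \<and>
      (\<exists>B. finite B \<and> T ` c0_sum Y \<subseteq> span B) \<and>
      (\<forall>x\<in>c0_sum Y. norm (T x) \<le> L * norm x) \<and> (\<forall>x\<in>F. norm (x - T x) \<le> \<epsilon>)"
    if F: "finite F" "F \<subseteq> c0_sum Y" and \<epsilon>: "\<epsilon> > 0" for F \<epsilon>
  proof -
    have "\<exists>N. \<forall>k\<ge>N. norm (slice z k) < \<epsilon>" if "z \<in> F" for z
      using LIMSEQ_D[of "slice z" 0 \<epsilon>] \<epsilon> that F(2) by (auto simp: c0_sum_def)
    then obtain N where N: "\<And>z k. z \<in> F \<Longrightarrow> k \<ge> N z \<Longrightarrow> norm (slice z k) < \<epsilon>" by metis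
    define n where "n = Max (insert 0 (N ` F))"
    have n: "N z \<le> n" if "z \<in> F" for z unfolding n_def using F(1) that by (intro Max_ge) auto
    define G where "G = (\<lambda>(z, k). slice z k) ` (F \<times> {..<n})"
    have "finite G" "G \<subseteq> Y" unfolding G_def using F by (auto simp: c0_sum_def)
    then obtain T B where T: "linear_map_on Y T" "T ` Y \<subseteq> Y" "finite B" "T ` Y \<subseteq> span B"
      "\<And>x. x \<in> Y \<Longrightarrow> norm (T x) \<le> L * norm x" "\<And>x. x \<in> G \<Longrightarrow> norm (x - T x) \<le> \<epsilon>"
      using A[rule_format, of G \<epsilon>] \<epsilon> by auto
    note T' = linear_map_onD[OF T(1) assms(2)]
    define y where "y z k = (if k < n then T (slice z k) else 0)" for z k
    define U where "U z = join (y z)" for z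
    have sY: "slice z k \<in> Y" if "z \<in> c0_sum Y" for z k using that by (auto simp: c0_sum_def)
    have U: "U z \<in> c0_sum Y" "slice (U z) k = y z k" if "z \<in> c0_sum Y" for z k
    proof -
      have "y z k \<in> Y" for k
        using T(2) sY[OF that] subspace_0[OF assms(2)] by (auto simp: y_def)
      moreover have "y z \<longlonglongrightarrow> 0"
        by (rule tendsto_eventually) (auto simp: y_def eventually_sequentially intro!: exI[of _ n])
      ultimately show "U z \<in> c0_sum Y" "slice (U z) k = y z k"
        unfolding U_def using join_in_c0_sum[of "y z"] by auto
    qed
    note Z = subspace_c0_sum[OF assms(2)]
    \<comment> \<open>\<open>single k b\<close> has \<open>b\<close> as slice \<open>k\<close> and
      zeros elsewhere; the images of \<open>B\<close> under the first \<open>n\<close> of these maps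
      span a space containing the range of \<open>U\<close>.\<close>
    define single where "single k b = join (\<lambda>j. if j = k then b else 0)" for k :: nat and b
    have single: "slice (single k b) j = (if j = k then b else 0)" for k b j
      unfolding single_def by (rule slice_join[of _ "norm b"]) auto
    have single_lin: "linear (single k)" for k
      by (rule linearI) (subst slices_eq_iff, simp add: single)+
    show ?thesis
    proof (intro exI[of _ U] conjI ballI)
      show "linear_map_on (c0_sum Y) U"
      proof (rule linear_map_onI)
        show "U (a + b) = U a + U b" if "a \<in> c0_sum Y" "b \<in> c0_sum Y" for a b
          using that Z by (subst slices_eq_iff) (simp add: U subspace_add y_def T' sY)
        show "U (c *\<^sub>R a) = c *\<^sub>R U a" if "a \<in> c0_sum Y" for c a
          using that Z by (subst slices_eq_iff) (simp add: U subspace_scale y_def T' sY)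
      qed
      show "U ` c0_sum Y \<subseteq> c0_sum Y" using U(1) by auto
      show "\<exists>B'. finite B' \<and> U ` c0_sum Y \<subseteq> span B'"
      proof (intro exI conjI)
        let ?B = "(\<lambda>(k, b). single k b) ` ({..<n} \<times> B)"
        show "finite ?B" using T(3) by simp
        show "U ` c0_sum Y \<subseteq> span ?B"
        proof clarify
          fix z assume z: "z \<in> c0_sum Y"
          have eq: "U z = (\<Sum>k<n. single k (T (slice z k)))"
          proof (rule slices_eqI)
            show "slice (U z) j = slice (\<Sum>k<n. single k (T (slice z k))) j" for j
              using U(2)[OF z] by (simp add: slice_sum single y_def)
          qed
          have mem: "single k (T (slice z k)) \<in> span ?B" if "k < n" for k
          proof -
            have "single k (T (slice z k)) \<in> single k ` span B" using T(4) sY[OF z] by auto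
            also have "\<dots> = span (single k ` B)" by (rule linear_span_image[OF single_lin, symmetric])
            also have "\<dots> \<subseteq> span ?B" using that by (intro span_mono) auto
            finally show ?thesis .
          qed
          show "U z \<in> span ?B" unfolding eq by (intro span_sum mem) simp
        qed
      qed
      show "norm (U z) \<le> L * norm z" if z: "z \<in> c0_sum Y" for z
      proof (rule norm_le_slices)
        show "norm (slice (U z) k) \<le> L * norm z" for k
          using order_trans[OF T(5)[OF sY[OF z]] mult_left_mono[OF norm_slice_le less_imp_le[OF L]]] L
          by (simp add: U(2)[OF z] y_def)
      qed
      show "norm (z - U z) \<le> \<epsilon>" if z: "z \<in> F" for z
      proof (rule norm_le_slices)
        have "z \<in> c0_sum Y" using z F by auto
        then show "norm (slice (z - U z) k) \<le> \<epsilon>" for k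
          using T(6)[of "slice z k"] z G_def N[OF z, of k] n[OF z] by (force simp: U(2) y_def)
      qed
    qed
  qed
  then show ?thesis using L unfolding bounded_approximation_property_def by auto
qed

subsection \<open>Averages over the Hilbert cube\<close>

text \<open>By an antiderivative the integral is that of \<open>\<phi>\<close> from 1 to
  \<open>1 + a\<close> minus that from 0 to \<open>a\<close>, where \<open>\<phi>\<close> is nearly
  \<open>\<alpha>\<close> and nearly \<open>\<beta>\<close>. The rest of \<open>{0..1}\<close>
  cancels, so only the two ends matter.\<close>

lemma integral_shift_bound:
  fixes \<phi> :: "real \<Rightarrow> real"
  assumes cont: "continuous_on UNIV \<phi>"
    and 1: "\<And>\<tau>. \<bar>\<tau> - 1\<bar> \<le> \<bar>a\<bar> \<Longrightarrow> \<bar>\<phi> \<tau> - \<alpha>\<bar> \<le> \<delta>"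
    and 0: "\<And>\<tau>. \<bar>\<tau>\<bar> \<le> \<bar>a\<bar> \<Longrightarrow> \<bar>\<phi> \<tau> - \<beta>\<bar> \<le> \<delta>"
  shows "\<bar>integral {0..1} (\<lambda>\<tau>. \<phi> (\<tau> + a) - \<phi> \<tau>) - a * (\<alpha> - \<beta>)\<bar> \<le> 2 * \<bar>a\<bar> * \<delta>"
proof -
  \<comment> \<open>Large enough that \<open>\<tau>\<close> and \<open>\<tau> + a\<close> lie
    strictly inside the interval for all \<open>\<tau>\<close> in \<open>{0..1}\<close>; derivatives
    within the interval are then two-sided.\<close>
  define R where "R = \<bar>a\<bar> + 2"
  obtain \<Phi> where \<Phi>: "\<And>x. x \<in> {-R..R} \<Longrightarrow> (\<Phi> has_vector_derivative \<phi> x) (at x within {-R..R})"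
    using antiderivative_continuous[of "-R" R \<phi>] continuous_on_subset[OF cont] by blast
  have deriv: "(\<Phi> has_real_derivative \<phi> x) (at x)" if "\<bar>x\<bar> < R" for x
  proof -
    have "x \<in> interior {-R..R}" using that by auto
    then have "at x within {-R..R} = at x" by (rule at_within_interior)
    then show ?thesis using \<Phi>[of x] that by (simp add: has_real_derivative_iff_has_vector_derivative abs_le_iff abs_less_iff)
  qed
  have step: "\<bar>\<Phi> (c + a) - \<Phi> c - a * \<psi>\<bar> \<le> \<bar>a\<bar> * \<delta>"
    if c: "c = 0 \<or> c = 1" and \<psi>: "\<And>\<tau>. \<bar>\<tau> - c\<bar> \<le> \<bar>a\<bar> \<Longrightarrow> \<bar>\<phi> \<tau> - \<psi>\<bar> \<le> \<delta>" for c \<psi>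
  proof -
    \<comment> \<open>The mean value inequality for \<open>\<Phi>\<close> minus its expected linear
      part; a closed segment covers both signs of \<open>a\<close>.\<close>
    have "norm ((\<Phi> (c + a) - \<psi> * (c + a)) - (\<Phi> c - \<psi> * c)) \<le> \<delta> * norm ((c + a) - c)"
    proof (rule field_differentiable_bound[where S = "closed_segment c (c + a)"])
      fix z assume "z \<in> closed_segment c (c + a)"
      then have z: "\<bar>z - c\<bar> \<le> \<bar>a\<bar>" by (auto simp: closed_segment_eq_real_ivl split: if_splits)
      then have "\<bar>z\<bar> < R" using c by (auto simp: R_def)
      then have "((\<lambda>z. \<Phi> z - \<psi> * z) has_real_derivative (\<phi> z - \<psi> * 1)) (at z)"
        by (intro DERIV_diff deriv DERIV_cmult DERIV_ident)
      then show "((\<lambda>z. \<Phi> z - \<psi> * z) has_field_derivative (\<phi> z - \<psi>)) (at z within closed_segment c (c + a))"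
        by (simp add: has_field_derivative_at_within)
      show "norm (\<phi> z - \<psi>) \<le> \<delta>" using \<psi>[OF z] by simp
    qed auto
    then show ?thesis by (simp add: algebra_simps)
  qed
  have "((\<lambda>\<tau>. \<phi> (\<tau> + a) - \<phi> \<tau>) has_integral
      (\<Phi> (1 + a) - \<Phi> 1) - (\<Phi> (0 + a) - \<Phi> 0)) {0..1}"
  proof (rule fundamental_theorem_of_calculus)
    fix x :: real assume x: "x \<in> {0..1}"
    have "\<bar>x + a\<bar> < R" "\<bar>x\<bar> < R" using x by (auto simp: R_def)
    then have "((\<lambda>\<tau>. \<Phi> (\<tau> + a) - \<Phi> \<tau>) has_real_derivative \<phi> (x + a) - \<phi> x) (at x)"
      by (intro DERIV_diff deriv) (simp add: deriv flip: DERIV_shift)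
    then show "((\<lambda>\<tau>. \<Phi> (\<tau> + a) - \<Phi> \<tau>) has_vector_derivative \<phi> (x + a) - \<phi> x) (at x within {0..1})"
      by (auto simp: has_real_derivative_iff_has_vector_derivative intro: has_vector_derivative_at_within)
  qed simp
  then have "integral {0..1} (\<lambda>\<tau>. \<phi> (\<tau> + a) - \<phi> \<tau>) = (\<Phi> (1 + a) - \<Phi> 1) - (\<Phi> (0 + a) - \<Phi> 0)"
    by (rule integral_unique)
  moreover have "\<bar>\<Phi> (1 + a) - \<Phi> 1 - a * \<alpha>\<bar> \<le> \<bar>a\<bar> * \<delta>" by (rule step) (use 1 in auto)
  moreover have "\<bar>\<Phi> (0 + a) - \<Phi> 0 - a * \<beta>\<bar> \<le> \<bar>a\<bar> * \<delta>" by (rule step) (use 0 in auto)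
  ultimately show ?thesis by (simp add: algebra_simps abs_le_iff)
qed

section \<open>Independent uniform coordinates\<close>

definition unif01 :: "real measure"
  where "unif01 = density lborel (indicator {0..1})"

definition cube :: "(nat \<Rightarrow> real) measure"
  where "cube = Pi\<^sub>M UNIV (\<lambda>_. unif01)"

lemma sets_unif01 [measurable_cong]: "sets unif01 = sets borel"
  by (simp add: unif01_def)

lemma prob_space_unif01: "prob_space unif01"
  by (rule prob_spaceI) (simp add: unif01_def emeasure_density)

lemma sets_cube: "sets cube = sets borel"
proof -
  have "sets cube = sets (Pi\<^sub>M UNIV (\<lambda>_::nat. borel :: real measure))"
    unfolding cube_def by (intro sets_PiM_cong sets_unif01 refl)
  then show ?thesis by (simp add: sets_PiM_equal_borel)
qed

interpretation cube: prob_space cube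
  unfolding cube_def by (intro prob_space_PiM prob_space_unif01)

interpretation unif01: prob_space unif01 by (rule prob_space_unif01)

interpretation unif01_cube: pair_prob_space unif01 cube ..

lemma integral_unif01:
  assumes "continuous_on UNIV (\<phi> :: real \<Rightarrow> real)"
  shows "(\<integral>s. \<phi> s \<partial>unif01) = integral {0..1} \<phi>"
proof -
  have [measurable]: "\<phi> \<in> borel_measurable borel"
    using assms by (rule borel_measurable_continuous_onI)
  have "(\<integral>s. \<phi> s \<partial>unif01) = (\<integral>s. indicator {0..1} s *\<^sub>R \<phi> s \<partial>lborel)"
    unfolding unif01_def
    by (subst integral_density[where g = "indicator {0..1}", unfolded ennreal_indicator])
       auto
  also have "\<dots> = (LINT s:{0..1}|lborel. \<phi> s)" by (simp add: set_lebesgue_integral_def)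
  also have "\<dots> = integral {0..1} \<phi>"
    by (intro set_borel_integral_eq_integral borel_integrable_atLeastAtMost' continuous_on_subset[OF assms]) auto
  finally show ?thesis .
qed

lemma measurable_cube_continuous:
  "continuous_on UNIV G \<Longrightarrow> G \<in> borel_measurable cube" for G :: "(nat \<Rightarrow> real) \<Rightarrow> real"
  using borel_measurable_continuous_onI measurable_cong_sets[OF sets_cube refl] by blast

lemma integrable_cube:
  fixes G :: "(nat \<Rightarrow> real) \<Rightarrow> real"
  assumes "continuous_on UNIV G" "\<And>t. \<bar>G t\<bar> \<le> B"
  shows "integrable cube G"
  by (rule cube.integrable_const_bound[where B = B])
     (use assms measurable_cube_continuous in auto)

lemma cube_integral_abs_le:
  fixes G :: "(nat \<Rightarrow> real) \<Rightarrow> real"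
  assumes "integrable cube G" "\<And>t. \<bar>G t\<bar> \<le> B"
  shows "\<bar>\<integral>t. G t \<partial>cube\<bar> \<le> B"
proof -
  have "\<bar>\<integral>t. G t \<partial>cube\<bar> \<le> (\<integral>t. \<bar>G t\<bar> \<partial>cube)" by (rule integral_abs_bound)
  also have "\<dots> \<le> B"
    using assms by (intro cube.integral_le_const) auto
  finally show ?thesis .
qed

text \<open>Drawing coordinate \<open>k\<close> afresh does not change the law of independent
  coordinates (\<open>distr_pair_PiM_eq_PiM\<close>), and Fubini's theorem puts the new coordinate
  into an inner integral.\<close>

lemma cube_resample:
  fixes G :: "(nat \<Rightarrow> real) \<Rightarrow> real"
  assumes cont: "continuous_on UNIV G" and bd: "\<And>t. \<bar>G t\<bar> \<le> B"
  shows "(\<integral>t. G t \<partial>cube) = (\<integral>t. integral {0..1} (\<lambda>s. G (t(k := s))) \<partial>cube)"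
    and "integrable cube (\<lambda>t. integral {0..1} (\<lambda>s. G (t(k := s))))"
proof -
  let ?f = "\<lambda>(s, t). t(k := s) :: nat \<Rightarrow> real"
  have upd: "continuous_on UNIV (\<lambda>s. t(k := s))" for t :: "nat \<Rightarrow> real"
  proof (rule continuous_on_coordinatewise_then_product)
    show "continuous_on UNIV (\<lambda>s. (t(k := s)) i)" for i by (cases "i = k") auto
  qed
  have meas [measurable]: "?f \<in> unif01 \<Otimes>\<^sub>M cube \<rightarrow>\<^sub>M cube"
  proof -
    have "?f \<in> borel_measurable (unif01 \<Otimes>\<^sub>M cube)"
    proof (rule measurable_coordinatewise_then_product)
      fix i
      have [measurable]: "(\<lambda>t. t i) \<in> borel_measurable cube"
        by (rule measurable_cube_continuous) simp
      show "(\<lambda>x. ?f x i) \<in> borel_measurable (unif01 \<Otimes>\<^sub>M cube)"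
        by (cases "i = k") (simp_all add: split_beta)
    qed
    then show ?thesis using measurable_cong_sets[OF refl sets_cube] by blast
  qed
  have [measurable]: "G \<in> borel_measurable cube" by (rule measurable_cube_continuous[OF cont])
  have dist: "distr (unif01 \<Otimes>\<^sub>M cube) cube ?f = cube"
    using distr_pair_PiM_eq_PiM[of UNIV "\<lambda>_. unif01" k] prob_space_unif01
    by (simp add: cube_def)
  have int: "integrable (unif01 \<Otimes>\<^sub>M cube) (\<lambda>(s, t). G (t(k := s)))"
    by (rule unif01_cube.integrable_const_bound[where B = B]) (use bd in \<open>auto simp: split_beta\<close>)
  have inner: "(\<integral>s. G (t(k := s)) \<partial>unif01) = integral {0..1} (\<lambda>s. G (t(k := s)))" for t
    by (intro integral_unif01 continuous_on_compose2[OF cont upd]) auto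
  have "(\<integral>t. G t \<partial>cube) = (\<integral>t. G t \<partial>distr (unif01 \<Otimes>\<^sub>M cube) cube ?f)" by (simp only: dist)
  also have "\<dots> = (\<integral>p. G (?f p) \<partial>(unif01 \<Otimes>\<^sub>M cube))" by (rule integral_distr) measurable
  also have "\<dots> = (\<integral>(s, t). G (t(k := s)) \<partial>(unif01 \<Otimes>\<^sub>M cube))"
    by (intro Bochner_Integration.integral_cong) auto
  also have "\<dots> = (\<integral>t. \<integral>s. G (t(k := s)) \<partial>unif01 \<partial>cube)"
    using unif01_cube.integral_snd[OF int] by simp
  finally show "(\<integral>t. G t \<partial>cube) = (\<integral>t. integral {0..1} (\<lambda>s. G (t(k := s))) \<partial>cube)"
    by (simp only: inner)
  show "integrable cube (\<lambda>t. integral {0..1} (\<lambda>s. G (t(k := s))))"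
    using unif01_cube.integrable_snd[OF int] by (simp only: inner)
qed

text \<open>Truncation to \<open>{0..1}\<close> makes the parametrisation of the cube total and
  continuous on all real sequences, so no domain conditions appear in the integrals.\<close>

definition clip :: "real \<Rightarrow> real"
  where "clip s = max 0 (min 1 s)"

lemma clip_bounds: "0 \<le> clip s" "clip s \<le> 1" "\<bar>clip s\<bar> \<le> 1"
  by (auto simp: clip_def)

lemma clip_id: "s \<in> {0..1} \<Longrightarrow> clip s = s"
  by (auto simp: clip_def)

lemma continuous_clip [continuous_intros]: "continuous_on A f \<Longrightarrow> continuous_on A (\<lambda>x. clip (f x))"
  unfolding clip_def by (intro continuous_intros)

section \<open>The compact convex cube and averages of translates over it\<close>

locale hilbert_cube =
  fixes x :: "nat \<Rightarrow> 'a::banach"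
  assumes summable_x: "summable (\<lambda>j. norm (x j))"
begin

definition point :: "(nat \<Rightarrow> real) \<Rightarrow> 'a"
  where "point t = (\<Sum>j. clip (t j) *\<^sub>R x j)"

definition K :: "'a set"
  where "K = range point"

lemma norm_clip_scaleR: "norm (clip s *\<^sub>R x j) \<le> norm (x j)"
  using mult_right_mono[OF clip_bounds(3), of "norm (x j)" s] by simp

lemma summable_point: "summable (\<lambda>j. clip (t j) *\<^sub>R x j)"
  by (rule summable_comparison_test'[OF summable_x]) (rule norm_clip_scaleR)

lemma continuous_point: "continuous_on A point"
proof -
  have ul: "uniform_limit UNIV (\<lambda>n t. \<Sum>j<n. clip (t j) *\<^sub>R x j) (\<lambda>t. \<Sum>j. clip (t j) *\<^sub>R x j) sequentially"
    by (rule Weierstrass_m_test[OF _ summable_x]) (rule norm_clip_scaleR)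
  have "continuous_on UNIV (\<lambda>t. \<Sum>j<n. clip (t j) *\<^sub>R x j)" for n
    by (intro continuous_intros) simp
  then have "\<forall>\<^sub>F n in sequentially. continuous_on UNIV (\<lambda>t. \<Sum>j<n. clip (t j) *\<^sub>R x j)" by simp
  from uniform_limit_theorem[OF this ul]
  have "continuous_on UNIV (\<lambda>t. \<Sum>j. clip (t j) *\<^sub>R x j)" by simp
  then have "continuous_on UNIV point" by (simp add: point_def[abs_def])
  then show ?thesis by (rule continuous_on_subset) simp
qed

lemma point_eq_sum:
  assumes "\<And>j. t j \<in> {0..1}"
  shows "point t = (\<Sum>j. t j *\<^sub>R x j)"
  unfolding point_def using clip_id[OF assms] by simp

lemma point_upd: "point (t(k := s)) = point (t(k := 0)) + clip s *\<^sub>R x k"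
proof -
  have "(\<lambda>j. if j = k then clip s *\<^sub>R x k else 0) sums (clip s *\<^sub>R x k)" by (rule sums_single)
  then have "(\<lambda>j. clip ((t(k := 0)) j) *\<^sub>R x j + (if j = k then clip s *\<^sub>R x k else 0)) sums
      (point (t(k := 0)) + clip s *\<^sub>R x k)"
    unfolding point_def by (intro sums_add summable_sums summable_point)
  moreover have "clip ((t(k := 0)) j) *\<^sub>R x j + (if j = k then clip s *\<^sub>R x k else 0) = clip ((t(k := s)) j) *\<^sub>R x j"
    for j by (simp add: clip_def)
  ultimately show ?thesis unfolding point_def by (simp add: sums_iff)
qed

lemma compact_K: "compact K"
proof -
  have "K = point ` (PiE UNIV (\<lambda>_. {0..1}))"
  proof -
    have "point t = point (\<lambda>j. clip (t j))" for t
      by (simp add: point_def clip_id clip_bounds)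
    moreover have "(\<lambda>j. clip (t j)) \<in> PiE UNIV (\<lambda>_. {0..1})" for t :: "nat \<Rightarrow> real"
      using clip_bounds by auto
    ultimately show ?thesis unfolding K_def by blast
  qed
  moreover have "compact (PiE UNIV (\<lambda>_::nat. {0..1::real}))"
    using compactin_PiE[of "\<lambda>_::nat. euclidean :: real topology" UNIV "\<lambda>_. {0..1}"]
    by (simp add: euclidean_product_topology)
  ultimately show ?thesis by (simp add: compact_continuous_image continuous_point)
qed

lemma point_in_K [simp]: "point t \<in> K"
  by (simp add: K_def)

lemma convex_K: "convex K"
proof (rule convexI)
  fix p q and u v :: real
  assume "p \<in> K" "q \<in> K" and uv: "0 \<le> u" "0 \<le> v" "u + v = 1"
  then obtain s t where st: "p = point s" "q = point t" by (auto simp: K_def)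
  have "u * clip (s j) + v * clip (t j) \<in> {0..1}" for j
    using uv clip_bounds convex_bound_le[of "clip (s j)" 1 "clip (t j)" u v] by auto
  then have "point (\<lambda>j. u * clip (s j) + v * clip (t j)) = (\<Sum>j. (u * clip (s j) + v * clip (t j)) *\<^sub>R x j)"
    by (rule point_eq_sum)
  moreover have "(\<lambda>j. (u * clip (s j) + v * clip (t j)) *\<^sub>R x j) sums (u *\<^sub>R p + v *\<^sub>R q)"
    unfolding st point_def
    using sums_add[OF sums_scaleR_right[OF summable_sums[OF summable_point], of u s]
        sums_scaleR_right[OF summable_sums[OF summable_point], of v t]]
    by (simp add: scaleR_add_left)
  then have "(\<Sum>j. (u * clip (s j) + v * clip (t j)) *\<^sub>R x j) = u *\<^sub>R p + v *\<^sub>R q"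
    by (rule sums_unique[symmetric])
  ultimately have "point (\<lambda>j. u * clip (s j) + v * clip (t j)) = u *\<^sub>R p + v *\<^sub>R q" by simp
  then show "u *\<^sub>R p + v *\<^sub>R q \<in> K" using point_in_K by metis
qed

lemma zero_in_K: "0 \<in> K"
  using point_in_K[of "\<lambda>_. 0"] by (simp add: point_def clip_def)

lemma bounded_on_translates:
  fixes f :: "'a \<Rightarrow> real"
  assumes "continuous_on UNIV f"
  obtains B where "\<And>t. \<bar>f (w + c *\<^sub>R point t)\<bar> \<le> B"
proof -
  have "compact ((\<lambda>p. f (w + c *\<^sub>R p)) ` K)"
    by (intro compact_continuous_image compact_K continuous_on_compose2[OF assms] continuous_intros) auto
  then have "bounded ((\<lambda>p. f (w + c *\<^sub>R p)) ` K)" by (rule compact_imp_bounded)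
  then show ?thesis using that by (auto simp: bounded_iff K_def)
qed

lemma continuous_upd: "continuous_on A (\<lambda>t. t(k := s))" for s :: real and k :: nat
proof (rule continuous_on_coordinatewise_then_product)
  show "continuous_on A (\<lambda>t. (t(k := s)) i)" for i
    by (cases "i = k") (auto intro: continuous_on_product_then_coordinatewise)
qed

lemma integrable_point:
  fixes f :: "'a \<Rightarrow> real"
  assumes f: "continuous_on UNIV f" and \<sigma>: "continuous_on UNIV \<sigma>"
  shows "integrable cube (\<lambda>t. f (w + c *\<^sub>R point (\<sigma> t)))"
proof -
  obtain B where "\<And>t. \<bar>f (w + c *\<^sub>R point t)\<bar> \<le> B"
    using bounded_on_translates[OF f] by metis
  then show ?thesis
    by (intro integrable_cube[where B = B] continuous_on_compose2[OF f] continuous_intros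
        continuous_on_compose2[OF continuous_point \<sigma>]) auto
qed

text \<open>
  The effect of translating in the direction \<open>x k\<close>: only the coordinate \<open>t k\<close>, which is uniformly
  distributed, is involved, so the difference is governed by the values of \<open>f\<close> near the two faces
  \<open>t k = 0\<close> and \<open>t k = 1\<close>.
\<close>

lemma translate_average:
  fixes f :: "'a \<Rightarrow> real"
  assumes cont: "continuous_on UNIV f"
    and \<alpha>: "integrable cube \<alpha>" and \<beta>: "integrable cube \<beta>"
    and 1: "\<And>t \<tau>. \<bar>\<tau> - 1\<bar> \<le> \<bar>a\<bar> \<Longrightarrow> \<bar>f (w + c *\<^sub>R (point (t(k := 0)) + \<tau> *\<^sub>R x k)) - \<alpha> t\<bar> \<le> \<delta>"
    and 0: "\<And>t \<tau>. \<bar>\<tau>\<bar> \<le> \<bar>a\<bar> \<Longrightarrow> \<bar>f (w + c *\<^sub>R (point (t(k := 0)) + \<tau> *\<^sub>R x k)) - \<beta> t\<bar> \<le> \<delta>"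
  shows "\<bar>(\<integral>t. f (w + c *\<^sub>R (point t + a *\<^sub>R x k)) \<partial>cube) - (\<integral>t. f (w + c *\<^sub>R point t) \<partial>cube)
      - a * (\<integral>t. \<alpha> t - \<beta> t \<partial>cube)\<bar> \<le> 2 * \<bar>a\<bar> * \<delta>"
proof -
  \<comment> \<open>The variable \<open>\<tau>\<close> is not clipped: a translate of the cube
    leaves \<open>K\<close>, which is why \<open>f\<close> is a function on the whole space.\<close>
  define \<phi> where "\<phi> t \<tau> = f (w + c *\<^sub>R (point (t(k := 0)) + \<tau> *\<^sub>R x k))" for t \<tau>
  define G where "G b t = f (w + c *\<^sub>R (point t + b *\<^sub>R x k))" for b t
  have contG: "continuous_on UNIV (G b)" for b
    unfolding G_def by (intro continuous_on_compose2[OF cont] continuous_intros continuous_point) auto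
  have GB: "\<exists>B. \<forall>t. \<bar>G b t\<bar> \<le> B" for b
  proof -
    obtain B where "\<And>t. \<bar>f ((w + c *\<^sub>R (b *\<^sub>R x k)) + c *\<^sub>R point t)\<bar> \<le> B"
      using bounded_on_translates[OF cont] by metis
    then show ?thesis by (auto simp: G_def algebra_simps intro!: exI[of _ B])
  qed
  have cont\<phi>: "continuous_on UNIV (\<phi> t)" for t
    unfolding \<phi>_def by (intro continuous_on_compose2[OF cont] continuous_intros) auto
  have G\<phi>: "integral {0..1} (\<lambda>s. G b (t(k := s))) = integral {0..1} (\<lambda>s. \<phi> t (s + b))" for b t
  proof (rule integral_cong)
    fix s :: real assume "s \<in> {0..1}"
    then show "G b (t(k := s)) = \<phi> t (s + b)"
      using point_upd[of t k s] by (simp add: G_def \<phi>_def clip_id algebra_simps)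
  qed
  have I: "(\<integral>t. G b t \<partial>cube) = (\<integral>t. integral {0..1} (\<lambda>s. \<phi> t (s + b)) \<partial>cube)"
    "integrable cube (\<lambda>t. integral {0..1} (\<lambda>s. \<phi> t (s + b)))" for b
  proof -
    obtain B where B: "\<And>t. \<bar>G b t\<bar> \<le> B" using GB by metis
    show "(\<integral>t. G b t \<partial>cube) = (\<integral>t. integral {0..1} (\<lambda>s. \<phi> t (s + b)) \<partial>cube)"
      "integrable cube (\<lambda>t. integral {0..1} (\<lambda>s. \<phi> t (s + b)))"
      using cube_resample[OF contG B, where k = k] by (simp_all add: G\<phi>)
  qed
  \<comment> \<open>The error along a single line in direction \<open>x k\<close>; it is bounded
    uniformly in \<open>t\<close> and then averaged.\<close>
  define E where "E t = integral {0..1} (\<lambda>s. \<phi> t (s + a)) - integral {0..1} (\<lambda>s. \<phi> t (s + 0)) - a * (\<alpha> t - \<beta> t)" for t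
  have E: "\<bar>E t\<bar> \<le> 2 * \<bar>a\<bar> * \<delta>" for t
  proof -
    have "integral {0..1} (\<lambda>s. \<phi> t (s + a) - \<phi> t s) = integral {0..1} (\<lambda>s. \<phi> t (s + a)) - integral {0..1} (\<lambda>s. \<phi> t (s + 0))"
      by (subst integral_diff)
         (auto intro!: integrable_continuous_interval continuous_on_compose2[OF cont\<phi>] continuous_intros)
    then show ?thesis
      using integral_shift_bound[OF cont\<phi>[of t], of a "\<alpha> t" \<delta> "\<beta> t"] 1[of _ t] 0[of _ t]
      by (simp add: E_def \<phi>_def)
  qed
  have intE: "integrable cube E" unfolding E_def using I(2)[of a] I(2)[of 0] \<alpha> \<beta> by simp
  have "(\<integral>t. G a t \<partial>cube) - (\<integral>t. G 0 t \<partial>cube) - a * (\<integral>t. \<alpha> t - \<beta> t \<partial>cube) = (\<integral>t. E t \<partial>cube)"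
    unfolding E_def I(1) using I(2)[of a] I(2)[of 0] \<alpha> \<beta> by simp
  also have "\<bar>\<dots>\<bar> \<le> 2 * \<bar>a\<bar> * \<delta>"
    by (rule cube_integral_abs_le[OF intE E])
  finally show ?thesis by (simp add: G_def)
qed

end

subsection \<open>The free space of a compact set as a subspace of $\ell_\infty$\<close>

lemma compact_dense_sequence:
  fixes K :: "'a::metric_space set"
  assumes "compact K" "K \<noteq> {}"
  obtains d :: "nat \<Rightarrow> 'a" where "\<And>i. d i \<in> K" "\<And>x \<epsilon>. x \<in> K \<Longrightarrow> \<epsilon> > 0 \<Longrightarrow> \<exists>i. dist x (d i) < \<epsilon>"
proof -
  have "\<exists>A. finite A \<and> A \<subseteq> K \<and> K \<subseteq> (\<Union>a\<in>A. ball a (1 / Suc n))" for n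
  proof -
    have "K \<subseteq> (\<Union>a\<in>K. ball a (1 / Suc n))" by force
    then obtain A where "A \<subseteq> K" "finite A" "K \<subseteq> (\<Union>a\<in>A. ball a (1 / Suc n))"
      using compactE_image[OF assms(1), of K "\<lambda>a. ball a (1 / Suc n)"] by auto
    then show ?thesis by (intro exI[of _ A] conjI)
  qed
  then obtain A where "\<forall>n. finite (A n) \<and> A n \<subseteq> K \<and> K \<subseteq> (\<Union>a\<in>A n. ball a (1 / Suc n))"
    by (rule choice[THEN exE, OF allI])
  then have A: "\<And>n. finite (A n)" "\<And>n. A n \<subseteq> K" "\<And>n. K \<subseteq> (\<Union>a\<in>A n. ball a (1 / Suc n))"
    by auto
  let ?D = "\<Union>n. A n"
  have D1: "countable ?D" using A(1) by (simp add: countable_finite)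
  have D2: "?D \<noteq> {}"
  proof -
    obtain x where "x \<in> K" using assms(2) by blast
    then obtain a where "a \<in> A 0" using A(3)[of 0] by (auto dest: subsetD)
    then show ?thesis by blast
  qed
  show ?thesis
  proof (rule that[of "from_nat_into ?D"])
    show "from_nat_into ?D i \<in> K" for i using from_nat_into[OF D2, of i] A(2) by blast
    fix x \<epsilon> :: _ assume x: "x \<in> K" and "(\<epsilon>::real) > 0"
    then obtain n where "1 / Suc n < \<epsilon>" using nat_approx_posE by blast
    moreover obtain a where "a \<in> A n" "x \<in> ball a (1 / Suc n)" using subsetD[OF A(3)[of n] x] by blast
    ultimately have a: "a \<in> A n" "dist x a < \<epsilon>" by (auto simp: dist_commute)
    obtain i where "from_nat_into ?D i = a" using a(1) from_nat_into_surj[OF D1, of a] by blast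
    then show "\<exists>i. dist x (from_nat_into ?D i) < \<epsilon>" using a by blast
  qed
qed

section \<open>Lipschitz functions, their dual and the free space inside it\<close>

context
  fixes K :: "'a::metric_space set" and z :: 'a
  assumes z: "z \<in> K"
begin

text \<open>The closed unit ball of \<open>Lip0 K z\<close>, described without the supremum in
  \<open>lip_norm\<close>; \<open>lip_ball_iff\<close> matches the two descriptions.\<close>

definition lip_ball :: "('a \<Rightarrow> real) set"
  where "lip_ball = {f \<in> Lip0 K z. 1-lipschitz_on K f}"

lemma lip_quotients_le:
  assumes C: "C-lipschitz_on K f"
    and s: "s \<in> insert 0 {(f x - f y) / dist x y |x y. x \<in> K \<and> y \<in> K \<and> x \<noteq> y}"
  shows "s \<le> C"
proof -
  have "(f x - f y) / dist x y \<le> C" if "x \<in> K" "y \<in> K" "x \<noteq> y" for x y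
    using lipschitz_onD[OF C that(1,2)] that(3) by (simp add: divide_le_eq dist_real_def)
  then show ?thesis using s lipschitz_on_nonneg[OF C] by auto
qed

lemma lip_norm_le: "C-lipschitz_on K f \<Longrightarrow> lip_norm K f \<le> C"
  unfolding lip_norm_def by (rule cSup_least) (auto simp del: insert_iff intro: lip_quotients_le)

lemma lip_norm_lipschitz:
  assumes "f \<in> Lip0 K z"
  shows "(lip_norm K f)-lipschitz_on K f"
proof -
  obtain C where C: "C-lipschitz_on K f" using assms by (auto simp: Lip0_def)
  note bdd = bdd_aboveI[OF lip_quotients_le[OF C]]
  have le: "f x - f y \<le> lip_norm K f * dist x y" if "x \<in> K" "y \<in> K" for x y
  proof (cases "x = y")
    case False
    then have "(f x - f y) / dist x y \<le> lip_norm K f"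
      unfolding lip_norm_def using that by (intro cSup_upper bdd) auto
    then show ?thesis using False by (simp add: divide_le_eq)
  qed simp
  have "0 \<le> lip_norm K f" unfolding lip_norm_def by (intro cSup_upper bdd) auto
  then show ?thesis
  proof (rule lipschitz_onI[rotated])
    show "dist (f x) (f y) \<le> lip_norm K f * dist x y" if "x \<in> K" "y \<in> K" for x y
      using le[OF that] le[OF that(2,1)] by (simp add: dist_real_def dist_commute abs_le_iff)
  qed
qed

lemma lip_norm_nonneg: "f \<in> Lip0 K z \<Longrightarrow> 0 \<le> lip_norm K f"
  using lip_norm_lipschitz lipschitz_on_nonneg by blast

lemma lip_ball_iff: "f \<in> lip_ball \<longleftrightarrow> f \<in> Lip0 K z \<and> lip_norm K f \<le> 1"
  using lip_norm_le[of 1 f] lip_norm_lipschitz[of f]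
  by (auto simp: lip_ball_def intro: lipschitz_on_mono)

lemma subspace_Lip0: "subspace (Lip0 K z)"
  unfolding subspace_def Lip0_def
proof safe
  fix f g :: "'a \<Rightarrow> real" and C D assume "C-lipschitz_on K f" "D-lipschitz_on K g"
  then have "(C + D)-lipschitz_on K (\<lambda>x. f x + g x)" by (rule lipschitz_on_add)
  then show "\<exists>C. C-lipschitz_on K (f + g)" by (auto simp: plus_fun_def)
next
  fix f :: "'a \<Rightarrow> real" and C c assume "C-lipschitz_on K f"
  then have "(\<bar>c\<bar> * C)-lipschitz_on K (\<lambda>x. c * f x)" by (rule lipschitz_on_cmult_real)
  then show "\<exists>C. C-lipschitz_on K (c *\<^sub>R f)" by (auto simp: scaleR_fun_def)
next
  show "\<exists>C. C-lipschitz_on K (0 :: 'a \<Rightarrow> real)"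
    using lipschitz_on_constant[of K 0] by (auto simp: zero_fun_def)
qed (auto simp: scaleR_fun_def)

abbreviation (input) "free \<equiv> lip_free K z"
abbreviation (input) "fnorm \<equiv> lip_free_norm K z"
abbreviation (input) "dual \<equiv> dual_space (Lip0 K z) (lip_norm K)"

lemma dualD:
  assumes "\<phi> \<in> dual"
  shows dual_linear: "linear_map_on (Lip0 K z) \<phi>" and dual_outside: "f \<notin> Lip0 K z \<Longrightarrow> \<phi> f = 0"
  using assms by (auto simp: dual_space_def)

lemma zero_in_lip_ball: "0 \<in> lip_ball"
  using subspace_0[OF subspace_Lip0] lipschitz_on_constant[of K "0::real"]
  by (auto simp: lip_ball_def zero_fun_def intro: lipschitz_on_mono)

lemma fnorm_le: "(\<And>f. f \<in> lip_ball \<Longrightarrow> \<bar>\<phi> f\<bar> \<le> C) \<Longrightarrow> fnorm \<phi> \<le> C"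
  unfolding lip_free_norm_def dual_norm_def
  using zero_in_lip_ball by (intro cSup_least) (auto simp: lip_ball_iff)

lemma fnorm_ball: "\<phi> \<in> dual \<Longrightarrow> f \<in> lip_ball \<Longrightarrow> \<bar>\<phi> f\<bar> \<le> fnorm \<phi>"
proof -
  assume \<phi>: "\<phi> \<in> dual" and f: "f \<in> lip_ball"
  obtain C where C: "\<And>f. f \<in> Lip0 K z \<Longrightarrow> \<bar>\<phi> f\<bar> \<le> C * lip_norm K f"
    using \<phi> by (auto simp: dual_space_def)
  have "\<bar>\<phi> g\<bar> \<le> \<bar>C\<bar>" if "g \<in> Lip0 K z" "lip_norm K g \<le> 1" for g
  proof -
    have "C * lip_norm K g \<le> \<bar>C\<bar> * 1"
      using lip_norm_nonneg[OF that(1)] that(2) by (intro mult_mono) auto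
    then show ?thesis using C[OF that(1)] by simp
  qed
  then have "bdd_above {\<bar>\<phi> g\<bar> |g. g \<in> Lip0 K z \<and> lip_norm K g \<le> 1}"
    by (intro bdd_aboveI[of _ "\<bar>C\<bar>"]) auto
  then show ?thesis
    unfolding lip_free_norm_def dual_norm_def using f by (intro cSup_upper) (auto simp: lip_ball_iff)
qed

lemma fnorm_nonneg: "\<phi> \<in> dual \<Longrightarrow> 0 \<le> fnorm \<phi>"
  using fnorm_ball[OF _ zero_in_lip_ball] abs_ge_zero order_trans by blast

lemma lipschitz_bound_of_ball_bound:
  assumes lin: "linear_map_on (Lip0 K z) \<phi>" and B: "\<And>g. g \<in> lip_ball \<Longrightarrow> \<bar>\<phi> g\<bar> \<le> B"
    and f: "f \<in> Lip0 K z" "C-lipschitz_on K f"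
  shows "\<bar>\<phi> f\<bar> \<le> C * B"
proof (rule field_le_epsilon)
  fix e :: real assume e: "e > 0"
  have B0: "B \<ge> 0" using B[OF zero_in_lip_ball] by linarith
  \<comment> \<open>\<open>C\<close> may be 0, so \<open>f\<close> is divided by a slightly larger
    number; the excess costs at most \<open>e\<close>.\<close>
  define D where "D = C + e / (B + 1)"
  have D: "D > C" "D > 0" using e B0 lipschitz_on_nonneg[OF f(2)] by (simp_all add: D_def add_nonneg_pos)
  have "(\<bar>1 / D\<bar> * C)-lipschitz_on K (\<lambda>x. (1 / D) * f x)" by (rule lipschitz_on_cmult_real[OF f(2)])
  moreover have "\<bar>1 / D\<bar> * C \<le> 1" using D by simp
  ultimately have "1-lipschitz_on K ((1 / D) *\<^sub>R f)"
    by (auto simp: scaleR_fun_def intro: lipschitz_on_mono)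
  then have "(1 / D) *\<^sub>R f \<in> lip_ball"
    using subspace_scale[OF subspace_Lip0 f(1)] by (simp add: lip_ball_def)
  from B[OF this] have "\<bar>\<phi> f\<bar> \<le> D * B"
    using D by (simp add: linear_map_on_scaleR[OF lin subspace_Lip0 f(1)] abs_mult divide_le_eq mult.commute)
  also have "\<dots> = C * B + e * (B / (B + 1))" by (simp add: D_def algebra_simps)
  also have "e * (B / (B + 1)) \<le> e * 1" using e B0 by (intro mult_left_mono) auto
  finally show "\<bar>\<phi> f\<bar> \<le> C * B + e" by simp
qed

lemma fnorm_lipschitz:
  "\<phi> \<in> dual \<Longrightarrow> f \<in> Lip0 K z \<Longrightarrow> C-lipschitz_on K f \<Longrightarrow> \<bar>\<phi> f\<bar> \<le> C * fnorm \<phi>"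
  by (rule lipschitz_bound_of_ball_bound[OF dual_linear fnorm_ball])

lemma dualI:
  assumes "linear_map_on (Lip0 K z) \<phi>" "\<And>f. f \<in> lip_ball \<Longrightarrow> \<bar>\<phi> f\<bar> \<le> C" "\<And>f. f \<notin> Lip0 K z \<Longrightarrow> \<phi> f = 0"
  shows "\<phi> \<in> dual"
proof -
  have "\<bar>\<phi> f\<bar> \<le> C * lip_norm K f" if "f \<in> Lip0 K z" for f
    using lipschitz_bound_of_ball_bound[OF assms(1,2) that lip_norm_lipschitz[OF that]]
    by (simp add: mult.commute)
  then show ?thesis using assms(1,3) by (auto simp: dual_space_def)
qed

lemma subspace_dual: "subspace dual"
proof (rule subspaceI)
  show "0 \<in> dual" by (rule dualI[where C = 0]) (auto simp: linear_map_on_def)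
next
  fix \<phi> \<psi> assume a: "\<phi> \<in> dual" "\<psi> \<in> dual"
  show "\<phi> + \<psi> \<in> dual"
  proof (rule dualI)
    show "linear_map_on (Lip0 K z) (\<phi> + \<psi>)"
      using dual_linear[OF a(1)] dual_linear[OF a(2)] by (simp add: linear_map_on_def algebra_simps)
    show "\<bar>(\<phi> + \<psi>) f\<bar> \<le> fnorm \<phi> + fnorm \<psi>" if "f \<in> lip_ball" for f
      using fnorm_ball[OF a(1) that] fnorm_ball[OF a(2) that] by simp
    show "(\<phi> + \<psi>) f = 0" if "f \<notin> Lip0 K z" for f
      using dual_outside[OF a(1) that] dual_outside[OF a(2) that] by simp
  qed
next
  fix c \<phi> assume a: "\<phi> \<in> dual"
  show "c *\<^sub>R \<phi> \<in> dual"
  proof (rule dualI)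
    show "linear_map_on (Lip0 K z) (c *\<^sub>R \<phi>)"
      using dual_linear[OF a] by (simp add: linear_map_on_def scaleR_fun_def algebra_simps)
    show "\<bar>(c *\<^sub>R \<phi>) f\<bar> \<le> \<bar>c\<bar> * fnorm \<phi>" if "f \<in> lip_ball" for f
      using fnorm_ball[OF a that] by (simp add: scaleR_fun_def abs_mult mult_left_mono)
    show "(c *\<^sub>R \<phi>) f = 0" if "f \<notin> Lip0 K z" for f
      using dual_outside[OF a that] by (simp add: scaleR_fun_def)
  qed
qed

lemma fnorm_add: "\<phi> \<in> dual \<Longrightarrow> \<psi> \<in> dual \<Longrightarrow> fnorm (\<phi> + \<psi>) \<le> fnorm \<phi> + fnorm \<psi>"
proof (rule fnorm_le)
  show "\<bar>(\<phi> + \<psi>) f\<bar> \<le> fnorm \<phi> + fnorm \<psi>" if "\<phi> \<in> dual" "\<psi> \<in> dual" "f \<in> lip_ball" for f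
    using fnorm_ball[OF that(1,3)] fnorm_ball[OF that(2,3)] by simp
qed

lemma fnorm_scaleR: "\<phi> \<in> dual \<Longrightarrow> fnorm (c *\<^sub>R \<phi>) \<le> \<bar>c\<bar> * fnorm \<phi>"
  by (rule fnorm_le) (auto simp: scaleR_fun_def abs_mult fnorm_ball mult_left_mono)

lemma evaluation_dual:
  assumes "x \<in> K"
  shows "evaluation K z x \<in> dual"
proof (rule dualI)
  show "linear_map_on (Lip0 K z) (evaluation K z x)"
    using subspace_add[OF subspace_Lip0] subspace_scale[OF subspace_Lip0]
    by (auto simp: linear_map_on_def evaluation_def scaleR_fun_def)
  show "\<bar>evaluation K z x f\<bar> \<le> dist x z" if "f \<in> lip_ball" for f
    using that lipschitz_onD[of 1 K f x z] assms z
    by (auto simp: evaluation_def lip_ball_def Lip0_def dist_real_def)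
qed (simp add: evaluation_def)

lemma span_evaluation_dual: "span (evaluation K z ` K) \<subseteq> dual"
  by (rule span_minimal) (auto simp: evaluation_dual subspace_dual)

lemma free_dual: "free \<subseteq> dual"
  by (auto simp: lip_free_def)

lemma free_approx: "\<phi> \<in> free \<Longrightarrow> \<epsilon> > 0 \<Longrightarrow> \<exists>\<psi>\<in>span (evaluation K z ` K). fnorm (\<phi> - \<psi>) < \<epsilon>"
  by (auto simp: lip_free_def)

lemma span_evaluation_free: "span (evaluation K z ` K) \<subseteq> free"
proof
  fix \<psi> assume \<psi>: "\<psi> \<in> span (evaluation K z ` K)"
  have "fnorm (\<psi> - \<psi>) \<le> 0" by (rule fnorm_le) simp
  then show "\<psi> \<in> free" using \<psi> span_evaluation_dual unfolding lip_free_def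
    by (auto intro!: bexI[of _ \<psi>] intro: le_less_trans)
qed

lemma subspace_free: "subspace free"
proof (rule subspaceI)
  show "0 \<in> free" using span_evaluation_free span_zero by blast
next
  fix \<phi> \<psi> assume a: "\<phi> \<in> free" "\<psi> \<in> free"
  have "\<exists>\<rho>\<in>span (evaluation K z ` K). fnorm (\<phi> + \<psi> - \<rho>) < \<epsilon>" if \<epsilon>: "\<epsilon> > 0" for \<epsilon>
  proof -
    obtain \<phi>' \<psi>' where b: "\<phi>' \<in> span (evaluation K z ` K)" "fnorm (\<phi> - \<phi>') < \<epsilon> / 2"
      "\<psi>' \<in> span (evaluation K z ` K)" "fnorm (\<psi> - \<psi>') < \<epsilon> / 2"
      using free_approx[OF a(1)] free_approx[OF a(2)] \<epsilon> by (meson half_gt_zero)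
    have "fnorm ((\<phi> - \<phi>') + (\<psi> - \<psi>')) \<le> fnorm (\<phi> - \<phi>') + fnorm (\<psi> - \<psi>')"
      using a b free_dual span_evaluation_dual subspace_diff[OF subspace_dual] by (intro fnorm_add) blast+
    moreover have "(\<phi> - \<phi>') + (\<psi> - \<psi>') = \<phi> + \<psi> - (\<phi>' + \<psi>')" by simp
    ultimately have "fnorm (\<phi> + \<psi> - (\<phi>' + \<psi>')) < \<epsilon>" using b by simp
    then show ?thesis using b by (blast intro: span_add)
  qed
  then show "\<phi> + \<psi> \<in> free"
    using a free_dual subspace_add[OF subspace_dual] by (auto simp: lip_free_def)
next
  fix c \<phi> assume a: "\<phi> \<in> free"
  have "\<exists>\<rho>\<in>span (evaluation K z ` K). fnorm (c *\<^sub>R \<phi> - \<rho>) < \<epsilon>" if \<epsilon>: "\<epsilon> > 0" for \<epsilon>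
  proof -
    have "\<epsilon> / (\<bar>c\<bar> + 1) > 0" using \<epsilon> by simp
    then obtain \<phi>' where b: "\<phi>' \<in> span (evaluation K z ` K)" "fnorm (\<phi> - \<phi>') < \<epsilon> / (\<bar>c\<bar> + 1)"
      using free_approx[OF a] by blast
    have d: "\<phi> - \<phi>' \<in> dual"
      using a b free_dual span_evaluation_dual subspace_diff[OF subspace_dual] by blast
    have "fnorm (c *\<^sub>R (\<phi> - \<phi>')) \<le> \<bar>c\<bar> * fnorm (\<phi> - \<phi>')" by (rule fnorm_scaleR[OF d])
    also have "\<dots> \<le> (\<bar>c\<bar> + 1) * fnorm (\<phi> - \<phi>')" using fnorm_nonneg[OF d] by (simp add: algebra_simps)
    also have "\<dots> < \<epsilon>" using b(2) by (simp add: field_simps)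
    finally show ?thesis using b(1) by (metis scaleR_diff_right span_scale)
  qed
  then show "c *\<^sub>R \<phi> \<in> free"
    using a free_dual subspace_scale[OF subspace_dual] by (auto simp: lip_free_def)
qed

text \<open>Completeness will make the copy of the free space in \<open>linf\<close> closed. The
  limit is taken pointwise on Lipschitz functions, the Cauchy condition makes it uniform on the unit
  ball, and a norm limit of elements approximable from the span is again approximable.\<close>

lemma free_complete:
  assumes \<phi>: "\<And>n. \<phi> n \<in> free"
    and cauchy: "\<And>\<epsilon>. \<epsilon> > 0 \<Longrightarrow> \<exists>N. \<forall>m\<ge>N. \<forall>n\<ge>N. fnorm (\<phi> m - \<phi> n) \<le> \<epsilon>"
  obtains \<psi> where "\<psi> \<in> free" "(\<lambda>n. fnorm (\<phi> n - \<psi>)) \<longlonglongrightarrow> 0"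
proof -
  have d: "\<phi> n \<in> dual" for n using \<phi> free_dual by blast
  have diff: "\<phi> m - \<phi> n \<in> dual" for m n by (rule subspace_diff[OF subspace_dual d d])
  have conv: "convergent (\<lambda>n. \<phi> n f)" for f
  proof (cases "f \<in> Lip0 K z")
    case True
    let ?L = "lip_norm K f"
    have L: "?L \<ge> 0" by (rule lip_norm_nonneg[OF True])
    have "Cauchy (\<lambda>n. \<phi> n f)"
    proof (rule metric_CauchyI)
      fix e :: real assume e: "e > 0"
      then obtain N where N: "\<And>m n. m \<ge> N \<Longrightarrow> n \<ge> N \<Longrightarrow> fnorm (\<phi> m - \<phi> n) \<le> e / (?L + 1) / 2"
        using cauchy[of "e / (?L + 1) / 2"] L by auto
      have "dist (\<phi> m f) (\<phi> n f) < e" if "m \<ge> N" "n \<ge> N" for m n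
      proof -
        have "\<bar>(\<phi> m - \<phi> n) f\<bar> \<le> ?L * fnorm (\<phi> m - \<phi> n)"
          by (rule fnorm_lipschitz[OF diff True lip_norm_lipschitz[OF True]])
        also have "\<dots> \<le> ?L * (e / (?L + 1) / 2)" using N[OF that] L by (intro mult_left_mono)
        also have "\<dots> = (?L / (?L + 1)) * (e / 2)" by simp
        also have "\<dots> \<le> 1 * (e / 2)" using L e by (intro mult_right_mono) auto
        finally show ?thesis using e by (simp add: dist_real_def)
      qed
      then show "\<exists>M. \<forall>m\<ge>M. \<forall>n\<ge>M. dist (\<phi> m f) (\<phi> n f) < e" by blast
    qed
    then show ?thesis by (simp add: Cauchy_convergent)
  next
    case False
    then show ?thesis using dual_outside[OF d] by (simp add: convergent_const)
  qed
  define \<psi> where "\<psi> f = lim (\<lambda>n. \<phi> n f)" for f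
  have lim: "(\<lambda>n. \<phi> n f) \<longlonglongrightarrow> \<psi> f" for f
    using conv[of f] by (simp add: \<psi>_def convergent_LIMSEQ_iff)
  have close: "\<bar>\<phi> n f - \<psi> f\<bar> \<le> \<epsilon>" if "f \<in> lip_ball" "n \<ge> N" "\<forall>m\<ge>N. \<forall>n\<ge>N. fnorm (\<phi> m - \<phi> n) \<le> \<epsilon>"
    for f n N \<epsilon>
  proof (rule tendsto_upperbound)
    show "(\<lambda>m. \<bar>\<phi> n f - \<phi> m f\<bar>) \<longlonglongrightarrow> \<bar>\<phi> n f - \<psi> f\<bar>" by (intro tendsto_intros lim)
    have "\<bar>\<phi> n f - \<phi> m f\<bar> \<le> \<epsilon>" if "m \<ge> N" for m
      using fnorm_ball[OF diff[of n m] \<open>f \<in> lip_ball\<close>] \<open>n \<ge> N\<close> that \<open>\<forall>m\<ge>N. \<forall>n\<ge>N. _\<close> by force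
    then show "\<forall>\<^sub>F m in sequentially. \<bar>\<phi> n f - \<phi> m f\<bar> \<le> \<epsilon>"
      by (auto simp: eventually_sequentially)
  qed simp
  have \<psi>: "\<psi> \<in> dual"
  proof -
    obtain N where N: "\<forall>m\<ge>N. \<forall>n\<ge>N. fnorm (\<phi> m - \<phi> n) \<le> 1" using cauchy[of 1] by auto
    show ?thesis
    proof (rule dualI)
      show "linear_map_on (Lip0 K z) \<psi>"
      proof (rule linear_map_onI)
        fix f g assume fg: "f \<in> Lip0 K z" "g \<in> Lip0 K z"
        have "(\<lambda>n. \<phi> n (f + g)) \<longlonglongrightarrow> \<psi> f + \<psi> g"
          using tendsto_add[OF lim[of f] lim[of g]]
          by (simp add: linear_map_on_add[OF dual_linear[OF d] subspace_Lip0 fg])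
        then show "\<psi> (f + g) = \<psi> f + \<psi> g" using LIMSEQ_unique lim by blast
      next
        fix c f assume f: "f \<in> Lip0 K z"
        have "(\<lambda>n. \<phi> n (c *\<^sub>R f)) \<longlonglongrightarrow> c *\<^sub>R \<psi> f"
          using tendsto_scaleR[OF tendsto_const lim[of f], of c]
          by (simp add: linear_map_on_scaleR[OF dual_linear[OF d] subspace_Lip0 f])
        then show "\<psi> (c *\<^sub>R f) = c *\<^sub>R \<psi> f" using LIMSEQ_unique lim by blast
      qed
      show "\<bar>\<psi> f\<bar> \<le> fnorm (\<phi> N) + 1" if "f \<in> lip_ball" for f
        using close[OF that order_refl N] fnorm_ball[OF d[of N] that] by linarith
      show "\<psi> f = 0" if "f \<notin> Lip0 K z" for f
        using LIMSEQ_unique[OF lim[of f], of 0] dual_outside[OF d that] by simp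
    qed
  qed
  have small: "\<exists>N. \<forall>n\<ge>N. fnorm (\<phi> n - \<psi>) \<le> \<epsilon>" if \<epsilon>: "\<epsilon> > 0" for \<epsilon>
  proof -
    obtain N where N: "\<forall>m\<ge>N. \<forall>n\<ge>N. fnorm (\<phi> m - \<phi> n) \<le> \<epsilon>" using cauchy[OF \<epsilon>] by auto
    have "fnorm (\<phi> n - \<psi>) \<le> \<epsilon>" if "n \<ge> N" for n
      by (rule fnorm_le) (use close[OF _ that N] in auto)
    then show ?thesis by blast
  qed
  have d\<psi>: "\<phi> n - \<psi> \<in> dual" "\<psi> - \<phi> n \<in> dual" for n
    using subspace_diff[OF subspace_dual] d \<psi> by auto
  have "(\<lambda>n. fnorm (\<phi> n - \<psi>)) \<longlonglongrightarrow> 0"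
  proof (rule LIMSEQ_I)
    fix r :: real assume "r > 0"
    then obtain N where "\<And>n. n \<ge> N \<Longrightarrow> fnorm (\<phi> n - \<psi>) \<le> r / 2" using small[of "r / 2"] by auto
    then show "\<exists>no. \<forall>n\<ge>no. norm (fnorm (\<phi> n - \<psi>) - 0) < r"
      using \<open>r > 0\<close> fnorm_nonneg[OF d\<psi>(1)] by (intro exI[of _ N]) (force intro: le_less_trans)
  qed
  moreover have "\<psi> \<in> free"
  proof -
    have "\<exists>\<rho>\<in>span (evaluation K z ` K). fnorm (\<psi> - \<rho>) < \<epsilon>" if \<epsilon>: "\<epsilon> > 0" for \<epsilon>
    proof -
      obtain n where n: "fnorm (\<phi> n - \<psi>) \<le> \<epsilon> / 3" using small[of "\<epsilon> / 3"] \<epsilon> by auto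
      obtain \<rho> where \<rho>: "\<rho> \<in> span (evaluation K z ` K)" "fnorm (\<phi> n - \<rho>) < \<epsilon> / 3"
        using free_approx[OF \<phi>[of n], of "\<epsilon> / 3"] \<epsilon> by auto
      have d2: "\<phi> n - \<rho> \<in> dual"
        using subspace_diff[OF subspace_dual d] \<rho>(1) span_evaluation_dual by blast
      have "fnorm (\<psi> - \<rho>) \<le> fnorm (\<phi> n - \<psi>) + fnorm (\<phi> n - \<rho>)"
      proof (rule fnorm_le)
        show "\<bar>(\<psi> - \<rho>) f\<bar> \<le> fnorm (\<phi> n - \<psi>) + fnorm (\<phi> n - \<rho>)" if "f \<in> lip_ball" for f
          using fnorm_ball[OF d\<psi>(1)[of n] that] fnorm_ball[OF d2 that] by simp
      qed
      then have "fnorm (\<psi> - \<rho>) < \<epsilon>" using n \<rho>(2) \<epsilon> by simp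
      then show ?thesis using \<rho>(1) by blast
    qed
    then show ?thesis using \<psi> by (auto simp: lip_free_def)
  qed
  ultimately show ?thesis using that by blast
qed

end

text \<open>Density is only pointwise, as the ball can be nonseparable in norm. Up to small errors a
  function in the ball is determined by rational approximations to its values at finitely many
  points of a dense sequence; for each of the countably many data that occur one function is
  chosen.\<close>

lemma lip_ball_dense_sequence:
  fixes K :: "'a::metric_space set"
  assumes K: "compact K" and z: "z \<in> K"
  obtains fs :: "nat \<Rightarrow> 'a \<Rightarrow> real" where "\<And>i. fs i \<in> lip_ball K z"
    and "\<And>f A \<epsilon>. f \<in> lip_ball K z \<Longrightarrow> finite A \<Longrightarrow> A \<subseteq> K \<Longrightarrow> \<epsilon> > 0 \<Longrightarrow>
      \<exists>i. \<forall>x\<in>A. \<bar>fs i x - f x\<bar> < \<epsilon>"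
proof -
  have "K \<noteq> {}" using z by auto
  with K obtain d :: "nat \<Rightarrow> 'a" where d: "\<And>i. d i \<in> K" "\<And>x \<epsilon>. x \<in> K \<Longrightarrow> \<epsilon> > 0 \<Longrightarrow> \<exists>i. dist x (d i) < \<epsilon>"
    by (rule compact_dense_sequence) blast
  define P where "P q n f \<longleftrightarrow> f \<in> lip_ball K z \<and> (\<forall>i<length q. \<bar>f (d i) - of_rat (q ! i)\<bar> < 1 / Suc n)"
    for q :: "rat list" and n :: nat and f
  \<comment> \<open>Data matched by no function get the value 0, which belongs to the ball as
    well.\<close>
  define g where "g = (\<lambda>(q, n). if \<exists>f. P q n f then SOME f. P q n f else 0)"
  have gP: "P q n (g (q, n))" if "P q n f" for q n f
    using someI[of "P q n" f] that by (auto simp: g_def)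
  have gB: "g p \<in> lip_ball K z" for p
  proof (cases p)
    case (Pair q n)
    show ?thesis
    proof (cases "\<exists>f. P q n f")
      case True
      then show ?thesis using gP by (auto simp: Pair P_def)
    next
      case False
      then have "g p = 0" by (auto simp: Pair g_def)
      then show ?thesis using zero_in_lip_ball[OF z] by simp
    qed
  qed
  show ?thesis
  proof (rule that[of "\<lambda>i. g (from_nat i)"])
    show "g (from_nat i) \<in> lip_ball K z" for i :: nat by (rule gB)
    fix f A and \<epsilon> :: real assume f: "f \<in> lip_ball K z" and A: "finite A" "A \<subseteq> K" and \<epsilon>: "\<epsilon> > 0"
    \<comment> \<open>Two rational errors and two Lipschitz errors, each at most an eighth of
      \<open>\<epsilon>\<close>, add up to less than \<open>\<epsilon>\<close>.\<close>
    obtain n where n: "1 / Suc n < \<epsilon> / 8" using nat_approx_posE[of "\<epsilon> / 8"] \<epsilon> by auto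
    have "\<forall>x\<in>A. \<exists>i. dist x (d i) < \<epsilon> / 8" using d(2)[of _ "\<epsilon> / 8"] A(2) \<epsilon> by (simp add: subset_iff)
    then obtain k where k: "\<And>x. x \<in> A \<Longrightarrow> dist x (d (k x)) < \<epsilon> / 8" by metis
    define m where "m = Suc (Max (insert 0 (k ` A)))"
    have m: "k x < m" if "x \<in> A" for x
      using A(1) that by (simp add: m_def less_Suc_eq_le)
    have "\<exists>r::rat. \<bar>f (d i) - of_rat r\<bar> < 1 / Suc n" for i
    proof -
      obtain r where "f (d i) < real_of_rat r" "real_of_rat r < f (d i) + 1 / Suc n"
        using of_rat_dense[of "f (d i)" "f (d i) + 1 / Suc n"] by auto
      then show ?thesis by (intro exI[of _ r]) auto
    qed
    then obtain r where r: "\<And>i. \<bar>f (d i) - of_rat (r i)\<bar> < 1 / Suc n" by metis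
    let ?q = "map r [0..<m]"
    have Pf: "P ?q n f" using f r by (simp add: P_def)
    have Pg: "P ?q n (g (?q, n))" by (rule gP[OF Pf])
    have "\<bar>g (?q, n) x - f x\<bar> < \<epsilon>" if x: "x \<in> A" for x
    proof -
      let ?d = "d (k x)"
      have "\<bar>g (?q, n) ?d - of_rat (r (k x))\<bar> < 1 / Suc n"
        using Pg m[OF x] by (simp add: P_def)
      moreover have "\<bar>f ?d - of_rat (r (k x))\<bar> < 1 / Suc n" by (rule r)
      moreover have "\<bar>h x - h ?d\<bar> \<le> \<epsilon> / 8" if "h \<in> lip_ball K z" for h
      proof -
        have "dist (h x) (h ?d) \<le> 1 * dist x ?d"
          using that A(2) x d(1) by (intro lipschitz_onD[where X = K]) (auto simp: lip_ball_def[OF z])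
        then show ?thesis using k[OF x] by (simp add: dist_real_def)
      qed
      note this[OF f] this[OF gB[of "(?q, n)"]]
      ultimately show ?thesis using n by linarith
    qed
    then show "\<exists>i. \<forall>x\<in>A. \<bar>g (from_nat i) x - f x\<bar> < \<epsilon>"
      by (intro exI[of _ "to_nat (?q, n)"]) simp
  qed
qed

text \<open>The free space does not see constants, so an arbitrary Lipschitz function can be paired
  with it after its value at \<open>z\<close> is subtracted; vanishing off \<open>K\<close> selects
  the representative in \<open>Lip0\<close>.\<close>

definition normalise :: "'a set \<Rightarrow> 'a \<Rightarrow> ('a \<Rightarrow> real) \<Rightarrow> 'a \<Rightarrow> real"
  where "normalise K z f = (\<lambda>x. if x \<in> K then f x - f z else 0)"

lemma normalise_Lip0:
  fixes K :: "'a::metric_space set"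
  assumes "C-lipschitz_on K f" "z \<in> K"
  shows "normalise K z f \<in> Lip0 K z" "C-lipschitz_on K (normalise K z f)"
proof -
  show "C-lipschitz_on K (normalise K z f)"
    using assms(1) by (auto simp: lipschitz_on_def normalise_def dist_real_def)
  then show "normalise K z f \<in> Lip0 K z"
    using assms(2) by (auto simp: Lip0_def normalise_def)
qed

lemma normalise_Lip0_id: "f \<in> Lip0 K z \<Longrightarrow> normalise K z f = f"
  by (auto simp: normalise_def Lip0_def fun_eq_iff)

text \<open>
  Pointwise evaluation on a pointwise dense sequence of the unit ball of $\mathrm{Lip}_0$ embeds
  the free space isometrically into $\ell_\infty$, since its elements are limits of
  combinations of evaluations.
\<close>

lemma free_space_in_linf:
  fixes K :: "'a::metric_space set"
  assumes K: "compact K" and z: "z \<in> K"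
  obtains Y :: "linf set" and j :: "'a \<Rightarrow> linf" and pr :: "linf \<Rightarrow> ('a \<Rightarrow> real) \<Rightarrow> real"
  where "subspace Y" "closed Y" "isomorphic_normed Y norm (lip_free K z) (lip_free_norm K z)"
    and "\<And>x. x \<in> K \<Longrightarrow> j x \<in> Y"
    and "\<And>y \<epsilon>. y \<in> Y \<Longrightarrow> \<epsilon> > 0 \<Longrightarrow> \<exists>w\<in>span (j ` K). norm (y - w) < \<epsilon>"
    and "\<And>f C. C-lipschitz_on K f \<Longrightarrow> linear_map_on Y (\<lambda>y. pr y f)"
    and "\<And>f C y. C-lipschitz_on K f \<Longrightarrow> y \<in> Y \<Longrightarrow> \<bar>pr y f\<bar> \<le> C * norm y"
    and "\<And>f C x. C-lipschitz_on K f \<Longrightarrow> x \<in> K \<Longrightarrow> pr (j x) f = f x - f z"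
    and "\<And>y C. y \<in> Y \<Longrightarrow> (\<And>f. 1-lipschitz_on K f \<Longrightarrow> \<bar>pr y f\<bar> \<le> C) \<Longrightarrow> norm y \<le> C"
proof -
  note lbd = lip_ball_def[OF z] and fdual = subsetD[OF free_dual[OF z]]
    and fsub = subspace_free[OF z] and dsub = subspace_dual[OF z]
  let ?F = "lip_free K z" and ?n = "lip_free_norm K z"
  obtain fs :: "nat \<Rightarrow> 'a \<Rightarrow> real" where fs: "\<And>i. fs i \<in> lip_ball K z"
    and dense: "\<And>f A \<epsilon>. f \<in> lip_ball K z \<Longrightarrow> finite A \<Longrightarrow> A \<subseteq> K \<Longrightarrow> \<epsilon> > 0 \<Longrightarrow>
      \<exists>i. \<forall>x\<in>A. \<bar>fs i x - f x\<bar> < \<epsilon>"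
    by (rule lip_ball_dense_sequence[OF K z]) blast
  define J :: "(('a \<Rightarrow> real) \<Rightarrow> real) \<Rightarrow> linf" where "J \<phi> = Bcontfun (\<lambda>i. \<phi> (fs i))" for \<phi>
  have J: "apply_bcontfun (J \<phi>) i = \<phi> (fs i)" if "\<phi> \<in> ?F" for \<phi> i
    unfolding J_def by (subst apply_Bcontfun_nat[OF fnorm_ball[OF z fdual[OF that] fs]]) simp
  \<comment> \<open>Combinations of evaluations are continuous for pointwise convergence on the
    ball. This lets a pointwise dense sequence compute their norm and, by approximation, the norm of
    every element of the free space.\<close>
  have cont: "\<exists>A \<delta>. finite A \<and> A \<subseteq> K \<and> \<delta> > 0 \<and>
      (\<forall>g\<in>lip_ball K z. (\<forall>x\<in>A. \<bar>g x - f x\<bar> < \<delta>) \<longrightarrow> \<bar>\<psi> g - \<psi> f\<bar> < \<epsilon>)"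
    if "\<psi> \<in> span (evaluation K z ` K)" "f \<in> lip_ball K z" "\<epsilon> > 0" for \<psi> f \<epsilon>
    using that(1) that(3)
  proof (induction arbitrary: \<epsilon> rule: span_induct_alt)
    case base
    then show ?case by (intro exI[of _ "{}"] exI[of _ 1]) simp
  next
    case (step c v \<psi>)
    then obtain p where p: "p \<in> K" "v = evaluation K z p" by auto
    obtain A \<delta> where A: "finite A" "A \<subseteq> K" "\<delta> > 0"
      "\<And>g. g \<in> lip_ball K z \<Longrightarrow> (\<forall>x\<in>A. \<bar>g x - f x\<bar> < \<delta>) \<Longrightarrow> \<bar>\<psi> g - \<psi> f\<bar> < \<epsilon> / 2"
      using step.IH[of "\<epsilon> / 2"] step.prems by auto
    have c: "\<epsilon> / 2 / (\<bar>c\<bar> + 1) > 0" using step.prems by simp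
    have "\<bar>(c *\<^sub>R v + \<psi>) g - (c *\<^sub>R v + \<psi>) f\<bar> < \<epsilon>"
      if g: "g \<in> lip_ball K z" "\<forall>x\<in>insert p A. \<bar>g x - f x\<bar> < min \<delta> (\<epsilon> / 2 / (\<bar>c\<bar> + 1))" for g
    proof -
      have v: "v h = h p" if "h \<in> lip_ball K z" for h
        using that by (simp add: p(2) evaluation_def lbd)
      have "\<bar>c\<bar> * \<bar>g p - f p\<bar> \<le> (\<bar>c\<bar> + 1) * \<bar>g p - f p\<bar>" by (simp add: algebra_simps)
      also have "\<dots> < (\<bar>c\<bar> + 1) * (\<epsilon> / 2 / (\<bar>c\<bar> + 1))"
        using g(2) by (intro mult_strict_left_mono) auto
      also have "\<dots> = \<epsilon> / 2" 
      proof -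
        have "\<bar>c\<bar> + 1 \<noteq> 0" by linarith
        from nonzero_mult_div_cancel_left[OF this, of "\<epsilon> / 2"] show ?thesis by (simp only: times_divide_eq_right)
      qed
      finally have "\<bar>c * (g p - f p)\<bar> < \<epsilon> / 2" by (simp add: abs_mult)
      moreover have "\<bar>\<psi> g - \<psi> f\<bar> < \<epsilon> / 2" using g by (intro A(4)) auto
      moreover have "(c *\<^sub>R v + \<psi>) g - (c *\<^sub>R v + \<psi>) f = c * (g p - f p) + (\<psi> g - \<psi> f)"
        using v[OF g(1)] v[OF \<open>f \<in> lip_ball K z\<close>] by (simp add: scaleR_fun_def algebra_simps)
      ultimately show ?thesis by linarith
    qed
    then show ?case
      using A p(1) c by (intro exI[of _ "insert p A"] exI[of _ "min \<delta> (\<epsilon> / 2 / (\<bar>c\<bar> + 1))"]) auto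
  qed
  have normJ: "norm (J \<phi>) = ?n \<phi>" if \<phi>: "\<phi> \<in> ?F" for \<phi>
  proof (rule antisym)
    show "norm (J \<phi>) \<le> ?n \<phi>"
      by (rule norm_bound) (simp add: J[OF \<phi>] fnorm_ball[OF z fdual[OF \<phi>] fs])
    show "?n \<phi> \<le> norm (J \<phi>)"
    proof (rule fnorm_le[OF z], rule field_le_epsilon)
      fix f and e :: real assume f: "f \<in> lip_ball K z" and e: "e > 0"
      obtain \<psi> where \<psi>: "\<psi> \<in> span (evaluation K z ` K)" "?n (\<phi> - \<psi>) < e / 3"
        using free_approx[OF z \<phi>, of "e / 3"] e by auto
      obtain A \<delta> where A: "finite A" "A \<subseteq> K" "\<delta> > 0"
        "\<And>g. g \<in> lip_ball K z \<Longrightarrow> (\<forall>x\<in>A. \<bar>g x - f x\<bar> < \<delta>) \<Longrightarrow> \<bar>\<psi> g - \<psi> f\<bar> < e / 3"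
        using cont[OF \<psi>(1) f, of "e / 3"] e by auto
      obtain i where "\<forall>x\<in>A. \<bar>fs i x - f x\<bar> < \<delta>" using dense[OF f A(1,2,3)] by auto
      then have "\<bar>\<psi> (fs i) - \<psi> f\<bar> < e / 3" by (rule A(4)[OF fs])
      moreover have d: "\<phi> - \<psi> \<in> dual_space (Lip0 K z) (lip_norm K)"
        using subspace_diff[OF dsub fdual[OF \<phi>]] \<psi>(1) span_evaluation_dual[OF z] by blast
      have "\<bar>(\<phi> - \<psi>) f\<bar> < e / 3" "\<bar>(\<phi> - \<psi>) (fs i)\<bar> < e / 3"
        using fnorm_ball[OF z d f] fnorm_ball[OF z d fs[of i]] \<psi>(2) by auto
      moreover have "\<bar>\<phi> (fs i)\<bar> \<le> norm (J \<phi>)"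
        using norm_bounded[of "J \<phi>" i] by (simp add: J[OF \<phi>])
      ultimately show "\<bar>\<phi> f\<bar> \<le> norm (J \<phi>) + e" unfolding minus_apply by linarith
    qed
  qed
  have Jlin: "linear_map_on ?F J"
  proof (rule linear_map_onI)
    show "J (\<phi> + \<psi>) = J \<phi> + J \<psi>" if "\<phi> \<in> ?F" "\<psi> \<in> ?F" for \<phi> \<psi>
      by (rule bcontfun_eqI) (simp add: J that subspace_add[OF fsub])
    show "J (c *\<^sub>R \<phi>) = c *\<^sub>R J \<phi>" if "\<phi> \<in> ?F" for c \<phi>
      by (rule bcontfun_eqI) (simp add: J that subspace_scale[OF fsub], simp add: scaleR_fun_def)
  qed
  have injJ: "\<phi> = \<psi>" if "\<phi> \<in> ?F" "\<psi> \<in> ?F" "J \<phi> = J \<psi>" for \<phi> \<psi>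
  proof
    fix f
    have d: "\<phi> - \<psi> \<in> ?F" by (rule subspace_diff[OF fsub that(1,2)])
    have "?n (\<phi> - \<psi>) = 0"
      using normJ[OF d] that(3) by (simp add: linear_map_on_diff[OF Jlin fsub that(1,2)])
    then have "\<bar>(\<phi> - \<psi>) f\<bar> \<le> 0" if "f \<in> Lip0 K z"
      using fnorm_lipschitz[OF z fdual[OF d] that lip_norm_lipschitz[OF z that]] by simp
    then show "\<phi> f = \<psi> f"
      using dual_outside[OF z fdual[OF that(1)]] dual_outside[OF z fdual[OF that(2)]]
      by (cases "f \<in> Lip0 K z") auto
  qed
  define Y where "Y = J ` ?F"
  define I where "I = inv_into ?F J"
  have inj: "inj_on J ?F" using injJ by (auto simp: inj_on_def)
  have IJ: "I (J \<phi>) = \<phi>" if "\<phi> \<in> ?F" for \<phi> unfolding I_def by (rule inv_into_f_f[OF inj that])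
  have IF: "I y \<in> ?F" and JI: "J (I y) = y" if "y \<in> Y" for y
    using that by (auto simp: Y_def IJ)
  have Ysub: "subspace Y"
    unfolding subspace_def Y_def
  proof safe
    show "0 \<in> J ` ?F"
      using linear_map_on_zero[OF Jlin fsub] subspace_0[OF fsub] by (metis imageI)
    show "J \<phi> + J \<psi> \<in> J ` ?F" if "\<phi> \<in> ?F" "\<psi> \<in> ?F" for \<phi> \<psi>
      using subspace_add[OF fsub that] by (simp flip: linear_map_on_add[OF Jlin fsub that])
    show "c *\<^sub>R J \<phi> \<in> J ` ?F" if "\<phi> \<in> ?F" for c \<phi>
      using subspace_scale[OF fsub that] by (simp flip: linear_map_on_scaleR[OF Jlin fsub that])
  qed
  have Ilin: "linear_map_on Y I"
  proof (rule linear_map_onI)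
    show "I (x + y) = I x + I y" if "x \<in> Y" "y \<in> Y" for x y
      using IJ[OF subspace_add[OF fsub IF[OF that(1)] IF[OF that(2)]]]
      by (simp add: linear_map_on_add[OF Jlin fsub IF[OF that(1)] IF[OF that(2)]] JI that)
    show "I (c *\<^sub>R x) = c *\<^sub>R I x" if "x \<in> Y" for c x
      using IJ[OF subspace_scale[OF fsub IF[OF that], of c]]
      by (simp add: linear_map_on_scaleR[OF Jlin fsub IF[OF that]] JI that)
  qed
  have In: "?n (I y) = norm y" if "y \<in> Y" for y using normJ[OF IF[OF that]] JI[OF that] by simp
  have closed: "closed Y"
    unfolding closed_sequential_limits
  proof safe
    fix y l assume y: "\<forall>n. y n \<in> Y" and lim: "y \<longlonglongrightarrow> l"
    have ydiff: "?n (I (y m) - I (y n)) = norm (y m - y n)" for m n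
      using y In[OF subspace_diff[OF Ysub, of "y m" "y n"]] linear_map_on_diff[OF Ilin Ysub, of "y m" "y n"]
      by simp
    have "Cauchy y" using lim by (rule LIMSEQ_imp_Cauchy)
    then have "\<exists>N. \<forall>m\<ge>N. \<forall>n\<ge>N. ?n (I (y m) - I (y n)) \<le> \<epsilon>" if "\<epsilon> > 0" for \<epsilon>
      unfolding ydiff using that by (meson CauchyD less_imp_le)
    then obtain \<psi> where \<psi>: "\<psi> \<in> ?F" "(\<lambda>n. ?n (I (y n) - \<psi>)) \<longlonglongrightarrow> 0"
      using free_complete[OF z, of "\<lambda>n. I (y n)"] IF y by blast
    have "?n (I (y n) - \<psi>) = norm (y n - J \<psi>)" for n
      using y normJ[OF subspace_diff[OF fsub IF \<psi>(1)], of "y n"]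
        linear_map_on_diff[OF Jlin fsub IF \<psi>(1), of "y n"] JI[of "y n"] by simp
    then have "y \<longlonglongrightarrow> J \<psi>" using \<psi>(2) by (simp add: tendsto_norm_zero_iff LIM_zero_iff)
    then have "l = J \<psi>" using lim LIMSEQ_unique by blast
    then show "l \<in> Y" using \<psi>(1) by (simp add: Y_def)
  qed
  define j where "j x = J (evaluation K z x)" for x
  \<comment> \<open>The pairing accepts every Lipschitz function on \<open>K\<close>, whatever its
    values at \<open>z\<close> and outside \<open>K\<close>.\<close>
  define pr where "pr y f = I y (normalise K z f)" for y f
  have ev: "evaluation K z x \<in> ?F" if "x \<in> K" for x
    using span_evaluation_free[OF z] that span_base by blast
  show ?thesis
  proof (rule that[of Y j pr, OF Ysub closed])
    show "isomorphic_normed Y norm ?F ?n"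
      by (rule isomorphic_normedI[where T = I and S = J and C = 1 and D = 1])
         (use Ilin IF IJ JI In normJ in \<open>auto simp: Y_def\<close>)
    show "j x \<in> Y" if "x \<in> K" for x using ev[OF that] by (simp add: j_def Y_def)
    show "\<exists>w\<in>span (j ` K). norm (y - w) < \<epsilon>" if yY: "y \<in> Y" and e0: "\<epsilon> > 0" for y \<epsilon>
    proof -
      obtain \<psi> where \<psi>: "\<psi> \<in> span (evaluation K z ` K)" "?n (I y - \<psi>) < \<epsilon>"
        using free_approx[OF z IF[OF yY] e0] by blast
      have \<psi>F: "\<psi> \<in> ?F" using \<psi>(1) span_evaluation_free[OF z] by blast
      have "norm (y - J \<psi>) < \<epsilon>"
        using \<psi>(2) normJ[OF subspace_diff[OF fsub IF[OF yY] \<psi>F]]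
        by (simp add: linear_map_on_diff[OF Jlin fsub IF[OF yY] \<psi>F] JI[OF yY])
      moreover have "\<psi> \<in> ?F \<and> J \<psi> \<in> span (j ` K)"
        using \<psi>(1)
      proof (induction rule: span_induct_alt)
        case base
        show ?case using linear_map_on_zero[OF Jlin fsub] span_zero subspace_0[OF fsub] by metis
      next
        case (step c v w)
        then obtain x where x: "x \<in> K" "v = evaluation K z x" by auto
        have v: "v \<in> ?F" using ev x by simp
        have w: "w \<in> ?F" using step.IH by simp
        then have e: "J (c *\<^sub>R v + w) = c *\<^sub>R j x + J w"
          using v by (simp add: linear_map_on_add[OF Jlin fsub] subspace_scale[OF fsub]
              linear_map_on_scaleR[OF Jlin fsub] j_def x)
        have "c *\<^sub>R j x + J w \<in> span (j ` K)"
          using step.IH x(1) by (intro span_add[OF span_scale[OF span_base]]) auto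
        then show ?case
          unfolding e using subspace_add[OF fsub subspace_scale[OF fsub v] w] by blast
      qed
      ultimately show ?thesis by blast
    qed
    fix f :: "'a \<Rightarrow> real" and C assume f: "C-lipschitz_on K f"
    note nf = normalise_Lip0[OF f z]
    show "linear_map_on Y (\<lambda>y. pr y f)"
      using Ilin by (simp add: linear_map_on_def pr_def scaleR_fun_def)
    show "\<bar>pr y f\<bar> \<le> C * norm y" if "y \<in> Y" for y
      using fnorm_lipschitz[OF z fdual[OF IF[OF that]] nf] by (simp add: pr_def In that)
    show "pr (j x) f = f x - f z" if "x \<in> K" for x
    proof -
      have "pr (j x) f = evaluation K z x (normalise K z f)"
        using that by (simp add: pr_def j_def IJ ev)
      then show ?thesis using nf(1) that by (simp add: evaluation_def, simp add: normalise_def)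
    qed
  next
    fix y C assume y: "y \<in> Y" and le: "\<And>f. 1-lipschitz_on K f \<Longrightarrow> \<bar>pr y f\<bar> \<le> C"
    have "?n (I y) \<le> C"
    proof (rule fnorm_le[OF z])
      show "\<bar>I y f\<bar> \<le> C" if "f \<in> lip_ball K z" for f
        using le[of f] that normalise_Lip0_id[of f K z] by (simp add: lbd pr_def)
    qed
    then show "norm y \<le> C" by (simp add: In y)
  qed
qed

lemma linf_Cauchy_convergent:
  fixes f :: "nat \<Rightarrow> linf"
  assumes "Cauchy f"
  obtains l where "f \<longlonglongrightarrow> l"
proof -
  have "\<forall>e>0. \<exists>N. \<forall>m n i. N \<le> m \<and> N \<le> n \<and> True \<longrightarrow> dist (f m i) (f n i) < e"
    using assms dist_fun_lt_imp_dist_val_lt unfolding Cauchy_def by metis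
  then obtain g where "\<forall>e>0. \<exists>N. \<forall>n i. N \<le> n \<and> True \<longrightarrow> dist (f n i) (g i) < e"
    using uniformly_convergent_eq_cauchy[of "\<lambda>_. True" "\<lambda>n i. f n i"] by auto
  then have "uniform_limit UNIV (\<lambda>n i. f n i) g sequentially"
    unfolding uniform_limit_sequentially_iff by simp
  then show ?thesis by (rule uniform_limit_bcontfunE) (use that in auto)
qed

subsection \<open>Lipschitz extensions and partitions of unity\<close>

text \<open>McShane's formula: the infimum of the cones of slope \<open>C\<close> standing on the
  graph. The extension serves to evaluate \<open>f\<close> on translates of
  \<open>K\<close>.\<close>

lemma lipschitz_extension:
  fixes f :: "'a::metric_space \<Rightarrow> real"
  assumes f: "C-lipschitz_on K f" and K: "K \<noteq> {}"
  obtains g where "C-lipschitz_on UNIV g" "\<And>x. x \<in> K \<Longrightarrow> g x = f x"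
proof -
  have C: "C \<ge> 0" by (rule lipschitz_on_nonneg[OF f])
  define g where "g x = (INF y\<in>K. f y + C * dist x y)" for x
  obtain y0 where y0: "y0 \<in> K" using K by blast
  have fl: "f y - f y' \<le> C * dist y y'" if "y \<in> K" "y' \<in> K" for y y'
    using lipschitz_onD[OF f that] by (simp add: dist_real_def)
  have tri: "C * dist y y' \<le> C * dist x y + C * dist x y'" for x y y'
    using mult_left_mono[OF dist_triangle[of y y' x] C] by (simp add: algebra_simps dist_commute)
  have "f y0 - C * dist x y0 \<le> f y + C * dist x y" if "y \<in> K" for x y
    using fl[OF y0 that] tri[of y0 y x] by simp
  then have bdd: "bdd_below ((\<lambda>y. f y + C * dist x y) ` K)" for x
    by (intro bdd_belowI2[of _ "f y0 - C * dist x y0"])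
  have le: "g x \<le> f y + C * dist x y" if "y \<in> K" for x y
    unfolding g_def using that by (intro cINF_lower bdd)
  have step: "g x \<le> g x' + C * dist x x'" for x x'
  proof -
    have "g x - C * dist x x' \<le> f y + C * dist x' y" if "y \<in> K" for y
      using le[OF that, of x] mult_left_mono[OF dist_triangle[of x y x'] C] by (simp add: algebra_simps)
    then have "g x - C * dist x x' \<le> g x'"
      unfolding g_def[of x'] using K by (intro cINF_greatest)
    then show ?thesis by simp
  qed
  have "C-lipschitz_on UNIV g"
  proof (rule lipschitz_onI)
    show "dist (g x) (g x') \<le> C * dist x x'" for x x'
      using step[of x x'] step[of x' x] by (simp add: dist_real_def dist_commute abs_le_iff)
  qed (rule C)
  moreover have "g x = f x" if "x \<in> K" for x
  proof (rule antisym)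
    show "g x \<le> f x" using le[OF that, of x] by simp
    show "f x \<le> g x" unfolding g_def
      using K fl[OF that] by (intro cINF_greatest) (auto simp: algebra_simps)
  qed
  ultimately show ?thesis using that by blast
qed

lemma partition_of_unity:
  fixes K :: "'a::metric_space set"
  assumes K: "compact K" and \<delta>: "\<delta> > 0"
  obtains A and p :: "'a \<Rightarrow> 'a \<Rightarrow> real" where "finite A" "A \<subseteq> K" "\<And>a. continuous_on UNIV (p a)"
    "\<And>a u. 0 \<le> p a u" "\<And>u. (\<Sum>a\<in>A. p a u) \<le> 1" "\<And>u. u \<in> K \<Longrightarrow> (\<Sum>a\<in>A. p a u) = 1"
    "\<And>a u. p a u \<noteq> 0 \<Longrightarrow> dist u a < \<delta>"
proof -
  have "K \<subseteq> (\<Union>a\<in>K. ball a (\<delta> / 2))" using \<delta> by force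
  then obtain A where A: "A \<subseteq> K" "finite A" "K \<subseteq> (\<Union>a\<in>A. ball a (\<delta> / 2))"
    using compactE_image[OF K, of K "\<lambda>a. ball a (\<delta> / 2)"] by auto
  define \<psi> where "\<psi> a u = max 0 (\<delta> - dist u a)" for a u :: 'a
  define s where "s u = (\<Sum>a\<in>A. \<psi> a u)" for u
  \<comment> \<open>The maximum keeps the denominator away from 0 off \<open>K\<close>, so the
    functions are continuous everywhere. On \<open>K\<close> some centre is closer than
    \<open>\<delta> / 2\<close>, hence \<open>s u\<close> is at least \<open>\<delta> / 2\<close>
    and the sum is exactly 1.\<close>
  define p where "p a u = \<psi> a u / max (\<delta> / 2) (s u)" for a u
  have den: "max (\<delta> / 2) (s u) > 0" for u using \<delta> by simp
  have \<psi>0: "0 \<le> \<psi> a u" for a u by (simp add: \<psi>_def)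
  have sum: "(\<Sum>a\<in>A. p a u) = s u / max (\<delta> / 2) (s u)" for u
    by (simp add: p_def s_def sum_divide_distrib)
  show ?thesis
  proof (rule that[OF A(2,1), of p])
    show "continuous_on UNIV (p a)" for a
      unfolding p_def[abs_def] \<psi>_def s_def using \<delta>
      by (intro continuous_intros) (simp add: max_def)
    show "0 \<le> p a u" for a u unfolding p_def using \<psi>0 den by (intro divide_nonneg_pos)
    show "(\<Sum>a\<in>A. p a u) \<le> 1" for u unfolding sum using den[of u] by (simp add: divide_le_eq)
    show "(\<Sum>a\<in>A. p a u) = 1" if u: "u \<in> K" for u
    proof -
      obtain a where a: "a \<in> A" "dist a u < \<delta> / 2" using A(3) u by auto
      have "\<delta> - dist u a \<le> \<psi> a u" by (simp add: \<psi>_def)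
      then have "\<delta> / 2 \<le> \<psi> a u" using a(2) by (simp add: dist_commute)
      also have "\<dots> \<le> s u" unfolding s_def using a(1) A(2) \<psi>0 by (intro member_le_sum) auto
      finally show ?thesis unfolding sum using \<delta> by (simp add: max_def)
    qed
    show "dist u a < \<delta>" if "p a u \<noteq> 0" for a u
      using that by (auto simp: p_def \<psi>_def max_def split: if_splits)
  qed
qed

subsection \<open>The free space of a cube spanned by a basis\<close>

text \<open>The assumptions on \<open>Y\<close>, \<open>j\<close> and \<open>pr\<close> are those
  conclusions of \<open>free_space_in_linf\<close> that describe the pairing; elements of
  \<open>Y\<close> act on Lipschitz functions without any further reference to the dual of
  \<open>Lip0\<close>.\<close>

locale free_cube = hilbert_cube x for x :: "nat \<Rightarrow> 'a::banach" +
  fixes z :: 'a and Y :: "linf set" and j :: "'a \<Rightarrow> linf" and pr :: "linf \<Rightarrow> ('a \<Rightarrow> real) \<Rightarrow> real" and M :: real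
  assumes basis: "schauder_basis x"
    and M1: "M \<ge> 1"
    and proj_bound: "\<And>n v. norm (basis_proj x n v) \<le> M * norm v"
    and z: "z \<in> K"
    and Y: "subspace Y" and closed_Y: "closed Y"
    and j: "\<And>p. p \<in> K \<Longrightarrow> j p \<in> Y"
    and span_j: "\<And>y \<epsilon>. y \<in> Y \<Longrightarrow> \<epsilon> > 0 \<Longrightarrow> \<exists>w\<in>span (j ` K). norm (y - w) < \<epsilon>"
    and pr_linear: "\<And>f C. C-lipschitz_on K f \<Longrightarrow> linear_map_on Y (\<lambda>y. pr y f)"
    and pr_bound: "\<And>f C y. C-lipschitz_on K f \<Longrightarrow> y \<in> Y \<Longrightarrow> \<bar>pr y f\<bar> \<le> C * norm y"
    and pr_j: "\<And>f C p. C-lipschitz_on K f \<Longrightarrow> p \<in> K \<Longrightarrow> pr (j p) f = f p - f z"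
    and norm_le_pr: "\<And>y C. y \<in> Y \<Longrightarrow> (\<And>f. 1-lipschitz_on K f \<Longrightarrow> \<bar>pr y f\<bar> \<le> C) \<Longrightarrow> norm y \<le> C"
begin

lemma span_j_subset: "span (j ` K) \<subseteq> Y"
  by (rule span_minimal) (auto simp: j Y)

text \<open>The usual density argument for uniformly bounded linear maps. With a constant sequence
  it also proves that a bounded linear map vanishing at all \<open>j p\<close> is 0.\<close>

lemma null_on_span:
  fixes D :: "nat \<Rightarrow> linf \<Rightarrow> 'b::real_normed_vector"
  assumes lin: "\<And>n. linear_map_on Y (D n)" and bd: "\<And>n y. y \<in> Y \<Longrightarrow> norm (D n y) \<le> C * norm y"
    and lim: "\<And>p. p \<in> K \<Longrightarrow> (\<lambda>n. D n (j p)) \<longlonglongrightarrow> 0" and y: "y \<in> Y"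
  shows "(\<lambda>n. D n y) \<longlonglongrightarrow> 0"
proof (rule LIMSEQ_I)
  fix r :: real assume r: "r > 0"
  have "r / 2 / (\<bar>C\<bar> + 1) > 0" using r by simp
  then obtain w where w: "w \<in> span (j ` K)" "norm (y - w) < r / 2 / (\<bar>C\<bar> + 1)"
    using span_j[OF y] by blast
  have wY: "w \<in> Y" using w(1) span_j_subset by blast
  have "v \<in> Y \<and> (\<lambda>n. D n v) \<longlonglongrightarrow> 0" if "v \<in> span (j ` K)" for v
    using that
  proof (induction rule: span_induct_alt)
    case base
    show ?case using linear_map_on_zero[OF lin Y] subspace_0[OF Y] by simp
  next
    case (step c u v)
    then obtain p where p: "p \<in> K" "u = j p" by auto
    have u: "u \<in> Y" "(\<lambda>n. D n u) \<longlonglongrightarrow> 0" using p j lim by auto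
    have v: "v \<in> Y" "(\<lambda>n. D n v) \<longlonglongrightarrow> 0" using step.IH by auto
    have "(\<lambda>n. c *\<^sub>R D n u + D n v) \<longlonglongrightarrow> c *\<^sub>R 0 + 0" by (intro tendsto_intros u v)
    then show ?case
      using u(1) v(1) Y by (simp add: linear_map_on_add[OF lin Y] linear_map_on_scaleR[OF lin Y]
          subspace_add subspace_scale)
  qed
  then have "(\<lambda>n. D n w) \<longlonglongrightarrow> 0" using w(1) by blast
  then obtain N where N: "\<And>n. n \<ge> N \<Longrightarrow> norm (D n w - 0) < r / 2"
    using LIMSEQ_D[of _ 0 "r / 2"] r by (metis half_gt_zero)
  have "norm (D n y - 0) < r" if "n \<ge> N" for n
  proof -
    have d: "y - w \<in> Y" by (rule subspace_diff[OF Y y wY])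
    have "norm (D n (y - w)) \<le> C * norm (y - w)" by (rule bd[OF d])
    also have "\<dots> \<le> (\<bar>C\<bar> + 1) * norm (y - w)" by (intro mult_right_mono) auto
    also have "\<dots> = norm (y - w) * (\<bar>C\<bar> + 1)" by (rule mult.commute)
    also have "\<dots> < r / 2" using w(2) by (subst (asm) pos_less_divide_eq) auto
    finally have "norm (D n y - D n w) < r / 2" by (simp add: linear_map_on_diff[OF lin Y y wY])
    then show ?thesis using N[OF that] norm_triangle_ineq[of "D n y - D n w" "D n w"] by simp
  qed
  then show "\<exists>N. \<forall>n\<ge>N. norm (D n y - 0) < r" by blast
qed

text \<open>Linearity of the pairing in the function is not assumed: both sides are bounded and
  linear in \<open>y\<close> and agree at every \<open>j p\<close>, hence on \<open>Y\<close>.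
  Taking differences with the value at \<open>z\<close> allows \<open>g\<close> to deviate by a
  constant.\<close>

lemma pr_sum:
  assumes f: "\<And>i. i \<in> I \<Longrightarrow> (C i)-lipschitz_on K (f i)" and g: "B-lipschitz_on K g"
    and eq: "\<And>p. p \<in> K \<Longrightarrow> g p - g z = (\<Sum>i\<in>I. c i * (f i p - f i z))" and y: "y \<in> Y"
  shows "pr y g = (\<Sum>i\<in>I. c i * pr y (f i))"
proof -
  define D where "D y = pr y g - (\<Sum>i\<in>I. c i * pr y (f i))" for y
  have lin: "linear_map_on Y D"
    using pr_linear[OF g] pr_linear[OF f]
    by (simp add: linear_map_on_def D_def sum.distrib sum_distrib_left algebra_simps)
  have bd: "norm (D y) \<le> (B + (\<Sum>i\<in>I. \<bar>c i\<bar> * C i)) * norm y" if "y \<in> Y" for y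
  proof -
    have "\<bar>\<Sum>i\<in>I. c i * pr y (f i)\<bar> \<le> (\<Sum>i\<in>I. \<bar>c i\<bar> * C i * norm y)"
      by (rule order_trans[OF sum_abs])
         (auto simp: abs_mult mult.assoc intro!: sum_mono mult_left_mono pr_bound f that)
    also have "\<dots> = (\<Sum>i\<in>I. \<bar>c i\<bar> * C i) * norm y" by (rule sum_distrib_right[symmetric])
    finally show ?thesis using pr_bound[OF g that]
      by (simp add: D_def distrib_right)
  qed
  have zero: "D (j p) = 0" if "p \<in> K" for p
    using eq[OF that] that pr_j[OF g] pr_j[OF f] by (simp add: D_def)
  have "(\<lambda>n::nat. D y) \<longlonglongrightarrow> 0"
    by (rule null_on_span[OF lin bd _ y]) (simp_all add: zero)
  then show ?thesis by (simp add: D_def LIMSEQ_const_iff)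
qed

section \<open>Means of point evaluations\<close>

lemma K_bound: obtains R where "R \<ge> 0" "\<And>p. p \<in> K \<Longrightarrow> norm p \<le> R"
proof -
  obtain R where "\<forall>p\<in>K. norm p \<le> R" using compact_imp_bounded[OF compact_K] by (auto simp: bounded_iff)
  then show ?thesis using that[of "max 0 R"] by force
qed

lemma continuous_lipschitz_point:
  assumes "C-lipschitz_on K f" "continuous_on UNIV \<sigma>"
  shows "continuous_on UNIV (\<lambda>t. f (point (\<sigma> t)) :: real)"
  by (rule continuous_on_compose2[OF lipschitz_on_continuous_on[OF assms(1)]
        continuous_on_compose2[OF continuous_point[of UNIV] assms(2)]]) auto

lemma integrable_lipschitz_point:
  assumes "C-lipschitz_on K f" "continuous_on UNIV \<sigma>"
  shows "integrable cube (\<lambda>t. f (point (\<sigma> t)) :: real)"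
proof -
  have "compact (f ` K)"
    by (rule compact_continuous_image[OF lipschitz_on_continuous_on[OF assms(1)] compact_K])
  then obtain B where "\<And>p. p \<in> K \<Longrightarrow> \<bar>f p\<bar> \<le> B"
    using compact_imp_bounded[of "f ` K"] by (auto simp: bounded_iff)
  then show ?thesis
    by (intro integrable_cube[where B = B] continuous_lipschitz_point[OF assms]) auto
qed

text \<open>The mean of point evaluations under the law of \<open>point (\<sigma> t)\<close> is
  obtained inside \<open>Y\<close> as a norm limit of finite combinations. Their weights are means
  of a partition of unity; with mesh \<open>\<delta>\<close> the error against a
  \<open>C\<close>-Lipschitz function is at most \<open>C * \<delta>\<close>.\<close>

lemma average_element:
  assumes \<sigma>: "continuous_on UNIV \<sigma>"
  obtains y where "y \<in> Y"
    "\<And>f C. C-lipschitz_on K f \<Longrightarrow> pr y f = (\<integral>t. f (point (\<sigma> t)) \<partial>cube) - f z"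
proof -
  have approx: "\<exists>y\<in>Y. \<forall>f C. C-lipschitz_on K f \<longrightarrow>
      \<bar>pr y f - ((\<integral>t. f (point (\<sigma> t)) \<partial>cube) - f z)\<bar> \<le> C * \<delta>" if \<delta>: "\<delta> > 0" for \<delta>
  proof -
    obtain A and p :: "'a \<Rightarrow> 'a \<Rightarrow> real" where A: "finite A" "A \<subseteq> K" and p: "\<And>a. continuous_on UNIV (p a)"
      "\<And>a u. 0 \<le> p a u" "\<And>u. (\<Sum>a\<in>A. p a u) \<le> 1" "\<And>u. u \<in> K \<Longrightarrow> (\<Sum>a\<in>A. p a u) = 1"
      "\<And>a u. p a u \<noteq> 0 \<Longrightarrow> dist u a < \<delta>"
      using partition_of_unity[OF compact_K \<delta>] by blast
    define w where "w a = (\<integral>t. p a (point (\<sigma> t)) \<partial>cube)" for a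
    define y where "y = (\<Sum>a\<in>A. w a *\<^sub>R j a)"
    have jA: "j a \<in> Y" if "a \<in> A" for a using that A(2) j by blast
    have int: "integrable cube (\<lambda>t. p a (point (\<sigma> t)))" for a
      using integrable_point[OF p(1) \<sigma>, where w = 0 and c = 1] by simp
    have y: "y \<in> Y" unfolding y_def using jA by (intro subspace_sum subspace_scale Y)
    have "\<bar>pr y f - ((\<integral>t. f (point (\<sigma> t)) \<partial>cube) - f z)\<bar> \<le> C * \<delta>" if f: "C-lipschitz_on K f" for f C
    proof -
      have C: "C \<ge> 0" by (rule lipschitz_on_nonneg[OF f])
      note intf = integrable_lipschitz_point[OF f \<sigma>]
      have one: "(\<Sum>a\<in>A. w a) = 1"
        unfolding w_def
        by (simp add: int p(4) cube.prob_space flip: Bochner_Integration.integral_sum)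
      have "pr y f = (\<Sum>a\<in>A. w a * (f a - f z))"
        unfolding y_def using jA A(2)
        by (simp add: linear_map_on_sum[OF pr_linear[OF f] Y] linear_map_on_scaleR[OF pr_linear[OF f] Y]
            subspace_scale[OF Y] pr_j[OF f] subset_iff)
      also have "\<dots> = (\<Sum>a\<in>A. w a * f a) - f z"
        by (simp add: right_diff_distrib sum_subtractf one flip: sum_distrib_right)
      also have "(\<Sum>a\<in>A. w a * f a) = (\<integral>t. (\<Sum>a\<in>A. p a (point (\<sigma> t)) * f a) \<partial>cube)"
        unfolding w_def by (simp add: int Bochner_Integration.integral_sum)
      finally have eq: "pr y f - ((\<integral>t. f (point (\<sigma> t)) \<partial>cube) - f z) =
          (\<integral>t. (\<Sum>a\<in>A. p a (point (\<sigma> t)) * f a) - f (point (\<sigma> t)) \<partial>cube)"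
        using intf by (simp add: int)
      have "\<bar>(\<Sum>a\<in>A. p a u * f a) - f u\<bar> \<le> C * \<delta>" if u: "u \<in> K" for u
      proof -
        have "(\<Sum>a\<in>A. p a u * f a) - f u = (\<Sum>a\<in>A. p a u * (f a - f u))"
          using p(4)[OF u] by (simp add: right_diff_distrib sum_subtractf flip: sum_distrib_right)
        also have "\<bar>\<dots>\<bar> \<le> (\<Sum>a\<in>A. p a u * (C * \<delta>))"
        proof (rule order_trans[OF sum_abs], rule sum_mono)
          fix a assume a: "a \<in> A"
          show "\<bar>p a u * (f a - f u)\<bar> \<le> p a u * (C * \<delta>)"
          proof (cases "p a u = 0")
            case False
            have "\<bar>f a - f u\<bar> \<le> C * dist a u"
              using lipschitz_onD[OF f, of a u] a A(2) u by (auto simp: dist_real_def)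
            also have "\<dots> \<le> C * \<delta>" using p(5)[OF False] C by (intro mult_left_mono) (auto simp: dist_commute)
            finally show ?thesis using p(2)[of a u] by (simp add: abs_mult mult_left_mono)
          qed simp
        qed
        also have "\<dots> = C * \<delta>" using p(4)[OF u] by (simp flip: sum_distrib_right)
        finally show ?thesis .
      qed
      then show ?thesis unfolding eq using intf
        by (intro cube_integral_abs_le Bochner_Integration.integrable_diff Bochner_Integration.integrable_sum
            integrable_mult_left int) auto
    qed
    then show ?thesis using y by blast
  qed
  define E where "E f = (\<integral>t. f (point (\<sigma> t)) \<partial>cube) - f z" for f :: "'a \<Rightarrow> real"
  have "\<forall>n. \<exists>y. y \<in> Y \<and> (\<forall>f C. C-lipschitz_on K f \<longrightarrow> \<bar>pr y f - E f\<bar> \<le> C * (1 / Suc n))"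
  proof
    fix n :: nat
    have "1 / Suc n > (0::real)" by simp
    from approx[OF this] show "\<exists>y. y \<in> Y \<and> (\<forall>f C. C-lipschitz_on K f \<longrightarrow> \<bar>pr y f - E f\<bar> \<le> C * (1 / Suc n))"
      unfolding E_def by blast
  qed
  from choice[OF this] obtain y :: "nat \<Rightarrow> linf" where yY: "\<And>n. y n \<in> Y"
    and y: "\<And>n f C. C-lipschitz_on K f \<Longrightarrow> \<bar>pr (y n) f - E f\<bar> \<le> C * (1 / Suc n)"
    by auto
  \<comment> \<open>The error is uniform over all 1-Lipschitz functions, so
    \<open>norm_le_pr\<close> converts it into a norm estimate.\<close>
  have "norm (y m - y n) \<le> 1 / Suc m + 1 / Suc n" for m n
  proof (rule norm_le_pr[OF subspace_diff[OF Y yY yY]])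
    show "\<bar>pr (y m - y n) f\<bar> \<le> 1 / Suc m + 1 / Suc n" if "1-lipschitz_on K f" for f
      using y[OF that, of m] y[OF that, of n]
      by (simp add: linear_map_on_diff[OF pr_linear[OF that] Y yY yY])
  qed
  moreover have "1 / Suc m + 1 / Suc n \<le> 2 / Suc N" if "m \<ge> N" "n \<ge> N" for m n N
  proof -
    have "1 / Suc m \<le> 1 / real (Suc N)" "1 / Suc n \<le> 1 / real (Suc N)"
      using that by (intro divide_left_mono; simp)+
    then show ?thesis by simp
  qed
  ultimately have yd: "norm (y m - y n) \<le> 2 / Suc N" if "m \<ge> N" "n \<ge> N" for m n N
    using that order_trans by blast
  have "Cauchy y"
  proof (rule metric_CauchyI)
    fix e :: real assume "e > 0"
    then obtain N where N: "1 / Suc N < e / 2" using nat_approx_posE[of "e / 2"] by auto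
    have "dist (y m) (y n) < e" if "m \<ge> N" "n \<ge> N" for m n
      using yd[OF that] N by (simp add: dist_norm)
    then show "\<exists>N. \<forall>m\<ge>N. \<forall>n\<ge>N. dist (y m) (y n) < e" by blast
  qed
  then obtain l where l: "y \<longlonglongrightarrow> l" by (rule linf_Cauchy_convergent)
  have lY: "l \<in> Y" using closed_sequentially[OF closed_Y yY l] .
  have "pr l f = E f" if f: "C-lipschitz_on K f" for f C
  proof (rule LIMSEQ_unique)
    have "(\<lambda>n. pr (y n) f - pr l f) \<longlonglongrightarrow> 0"
    proof (rule Lim_null_comparison)
      show "\<forall>\<^sub>F n in sequentially. norm (pr (y n) f - pr l f) \<le> C * norm (y n - l)"
        using pr_bound[OF f subspace_diff[OF Y yY lY]]
        by (simp add: linear_map_on_diff[OF pr_linear[OF f] Y yY lY])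
      show "(\<lambda>n. C * norm (y n - l)) \<longlonglongrightarrow> 0"
        using l by (intro tendsto_mult_right_zero tendsto_norm_zero) (simp add: LIM_zero)
    qed
    then show "(\<lambda>n. pr (y n) f) \<longlonglongrightarrow> pr l f" by (simp add: LIM_zero_iff)
    have "(\<lambda>n. pr (y n) f - E f) \<longlonglongrightarrow> 0"
    proof (rule Lim_null_comparison)
      show "\<forall>\<^sub>F n in sequentially. norm (pr (y n) f - E f) \<le> C * (1 / Suc n)"
        using y[OF f] by simp
      show "(\<lambda>n. C * (1 / Suc n)) \<longlonglongrightarrow> 0"
        using LIMSEQ_inverse_real_of_nat by (intro tendsto_mult_right_zero) (simp add: inverse_eq_divide)
    qed
    then show "(\<lambda>n. pr (y n) f) \<longlonglongrightarrow> E f" by (simp add: LIM_zero_iff)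
  qed
  then show ?thesis using that lY unfolding E_def by blast
qed


section \<open>The barycentre map\<close>

lemma coeff_diff: "basis_coeff x (u - v) k = basis_coeff x u k - basis_coeff x v k"
  using basis_coeff_add[OF basis, of "u - v" v k] by simp

lemma coeff_point: "basis_coeff x (point t) k = clip (t k)"
  using basis_coeff_eqI[OF basis summable_sums[OF summable_point[of t]]] by (simp add: point_def)

lemma proj_Suc: "basis_proj x (Suc n) v = basis_proj x n v + basis_coeff x v n *\<^sub>R x n"
  by (simp add: basis_proj_def)

lemma proj_diff: "basis_proj x n (u - v) = basis_proj x n u - basis_proj x n v"
  by (rule linear_diff[OF basis_proj_linear[OF basis]])

lemma coeff_bound: "\<bar>basis_coeff x v k\<bar> \<le> 2 * M / norm (x k) * norm v"
proof -
  have "\<bar>basis_coeff x v k\<bar> * norm (x k) = norm (basis_proj x (Suc k) v - basis_proj x k v)"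
    by (simp add: proj_Suc)
  also have "\<dots> \<le> 2 * M * norm v"
    using norm_triangle_ineq4[of "basis_proj x (Suc k) v" "basis_proj x k v"]
      proj_bound[of "Suc k" v] proj_bound[of k v] by linarith
  finally show ?thesis using basis_nonzero[OF basis, of k] by (simp add: field_simps)
qed

lemma coeff_lipschitz: "(2 * M / norm (x k))-lipschitz_on A (\<lambda>v. basis_coeff x v k)"
proof (rule lipschitz_onI)
  show "dist (basis_coeff x u k) (basis_coeff x v k) \<le> 2 * M / norm (x k) * dist u v" for u v
    using coeff_bound[of "u - v" k] by (simp add: dist_norm coeff_diff)
  show "0 \<le> 2 * M / norm (x k)" using M1 by simp
qed

text \<open>Coefficient functionals are Lipschitz, so they can be paired with \<open>y\<close>;
  these are the partial sums of the resulting candidate for the barycentre, whose convergence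
  remains to be shown.\<close>

definition bary :: "nat \<Rightarrow> linf \<Rightarrow> 'a"
  where "bary n y = (\<Sum>k<n. pr y (\<lambda>v. basis_coeff x v k) *\<^sub>R x k)"

lemma bary_linear: "linear_map_on Y (bary n)"
  using pr_linear[OF coeff_lipschitz]
  by (simp add: linear_map_on_def bary_def sum.distrib scaleR_add_left scaleR_sum_right)

text \<open>Estimating the coefficients one by one would give a constant depending on
  \<open>n\<close>. A norming functional composed with the projection is instead a single
  \<open>M\<close>-Lipschitz function.\<close>

lemma bary_bound:
  assumes y: "y \<in> Y"
  shows "norm (bary n y) \<le> M * norm y"
proof -
  obtain \<phi> where \<phi>: "bounded_linear \<phi>" "\<And>v. \<bar>\<phi> v\<bar> \<le> norm v" "\<phi> (bary n y) = norm (bary n y)"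
    using norming_functional[of "bary n y"] by blast
  interpret \<phi>: bounded_linear \<phi> by (rule \<phi>(1))
  have lip: "M-lipschitz_on K (\<lambda>v. \<phi> (basis_proj x n v))"
  proof (rule lipschitz_onI)
    show "dist (\<phi> (basis_proj x n u)) (\<phi> (basis_proj x n v)) \<le> M * dist u v" for u v
      using order_trans[OF \<phi>(2) proj_bound, of n "u - v"]
      by (simp add: dist_norm proj_diff \<phi>.diff)
  qed (use M1 in simp)
  have "norm (bary n y) = (\<Sum>k<n. \<phi> (x k) * pr y (\<lambda>v. basis_coeff x v k))"
    using \<phi>(3) by (simp add: bary_def \<phi>.sum \<phi>.scaleR mult.commute)
  also have "\<dots> = pr y (\<lambda>v. \<phi> (basis_proj x n v))"
  proof (rule pr_sum[symmetric, OF coeff_lipschitz lip _ y])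
    show "\<phi> (basis_proj x n p) - \<phi> (basis_proj x n z) =
        (\<Sum>k<n. \<phi> (x k) * (basis_coeff x p k - basis_coeff x z k))" for p
      by (simp add: basis_proj_def \<phi>.sum \<phi>.scaleR right_diff_distrib sum_subtractf mult.commute)
  qed
  also have "\<dots> \<le> M * norm y" using pr_bound[OF lip y] by linarith
  finally show ?thesis .
qed

lemma bary_j: "p \<in> K \<Longrightarrow> bary n (j p) = basis_proj x n p - basis_proj x n z"
  by (simp add: bary_def basis_proj_def pr_j[OF coeff_lipschitz] scaleR_diff_left sum_subtractf)

text \<open>At \<open>j p\<close> these are the partial sums of the expansion of
  \<open>p - z\<close>; the bound uniform in \<open>n\<close> carries the Cauchy property to the
  closure of the span.\<close>

lemma bary_convergent:
  assumes y: "y \<in> Y"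
  shows "convergent (\<lambda>n. bary n y)"
proof -
  have span: "w \<in> Y \<and> convergent (\<lambda>n. bary n w)" if "w \<in> span (j ` K)" for w
    using that
  proof (induction rule: span_induct_alt)
    case base
    show ?case using linear_map_on_zero[OF bary_linear Y] subspace_0[OF Y] by (simp add: convergent_const)
  next
    case (step c u v)
    then obtain p where p: "p \<in> K" "u = j p" by auto
    have u: "u \<in> Y" using p j by simp
    have v: "v \<in> Y" "convergent (\<lambda>n. bary n v)" using step.IH by auto
    have "convergent (\<lambda>n. bary n u)"
      unfolding p(2) bary_j[OF p(1)]
      by (rule convergentI[OF tendsto_diff[OF basis_proj_tendsto[OF basis] basis_proj_tendsto[OF basis]]])
    then have "convergent (\<lambda>n. c *\<^sub>R bary n u + bary n v)"
      by (rule convergent_add[OF bounded_linear.convergent[OF bounded_linear_scaleR_right] v(2)])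
    then show ?case
      using u v(1) Y by (simp add: linear_map_on_add[OF bary_linear Y] linear_map_on_scaleR[OF bary_linear Y]
          subspace_add subspace_scale)
  qed
  have "Cauchy (\<lambda>n. bary n y)"
  proof (rule metric_CauchyI)
    fix e :: real assume e: "e > 0"
    have "e / 3 / M > 0" using e M1 by simp
    then obtain w where w: "w \<in> span (j ` K)" "norm (y - w) < e / 3 / M" using span_j[OF y] by blast
    have wY: "w \<in> Y" using span[OF w(1)] by simp
    have close: "norm (bary n y - bary n w) < e / 3" for n
    proof -
      have "norm (bary n (y - w)) \<le> M * norm (y - w)" by (rule bary_bound[OF subspace_diff[OF Y y wY]])
      also have "\<dots> < e / 3" using w(2) M1 by (simp add: field_simps)
      finally show ?thesis by (simp add: linear_map_on_diff[OF bary_linear Y y wY])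
    qed
    have "Cauchy (\<lambda>n. bary n w)" using span[OF w(1)] by (simp add: Cauchy_convergent_iff)
    then obtain N where N: "\<And>m n. m \<ge> N \<Longrightarrow> n \<ge> N \<Longrightarrow> dist (bary m w) (bary n w) < e / 3"
      using metric_CauchyD[of _ "e / 3"] e by (metis zero_less_divide_iff zero_less_numeral)
    have "dist (bary m y) (bary n y) < e" if "m \<ge> N" "n \<ge> N" for m n
    proof -
      have "bary m y - bary n y =
          (bary m y - bary m w) + (bary m w - bary n w) - (bary n y - bary n w)" by simp
      then have "norm (bary m y - bary n y) \<le>
          norm (bary m y - bary m w) + norm (bary m w - bary n w) + norm (bary n y - bary n w)"
        by (smt (verit) norm_triangle_ineq norm_triangle_ineq4)
      then show ?thesis using close[of m] close[of n] N[OF that] by (simp add: dist_norm)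
    qed
    then show "\<exists>N. \<forall>m\<ge>N. \<forall>n\<ge>N. dist (bary m y) (bary n y) < e" by blast
  qed
  then show ?thesis by (simp add: Cauchy_convergent_iff)
qed

definition barycentre :: "linf \<Rightarrow> 'a"
  where "barycentre y = lim (\<lambda>n. bary n y)"

lemma bary_tendsto: "y \<in> Y \<Longrightarrow> (\<lambda>n. bary n y) \<longlonglongrightarrow> barycentre y"
  using bary_convergent[of y] by (simp add: barycentre_def convergent_LIMSEQ_iff)

lemma barycentre_linear: "linear_map_on Y barycentre"
proof (rule linear_map_onI)
  fix u v assume uv: "u \<in> Y" "v \<in> Y"
  have "(\<lambda>n. bary n (u + v)) \<longlonglongrightarrow> barycentre u + barycentre v"
    unfolding linear_map_on_add[OF bary_linear Y uv] by (intro tendsto_add bary_tendsto uv)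
  then show "barycentre (u + v) = barycentre u + barycentre v"
    using bary_tendsto[OF subspace_add[OF Y uv]] LIMSEQ_unique by blast
next
  fix c u assume u: "u \<in> Y"
  have "(\<lambda>n. bary n (c *\<^sub>R u)) \<longlonglongrightarrow> c *\<^sub>R barycentre u"
    unfolding linear_map_on_scaleR[OF bary_linear Y u] by (intro tendsto_scaleR tendsto_const bary_tendsto u)
  then show "barycentre (c *\<^sub>R u) = c *\<^sub>R barycentre u"
    using bary_tendsto[OF subspace_scale[OF Y u]] LIMSEQ_unique by blast
qed

lemma barycentre_bound: "y \<in> Y \<Longrightarrow> norm (barycentre y) \<le> M * norm y"
  by (rule tendsto_upperbound[OF tendsto_norm[OF bary_tendsto]]) (auto simp: bary_bound)

text \<open>
  The element \<open>face k\<close> is the mean of \<open>\<delta>(p + x k) - \<delta>(p)\<close> over the points \<open>p\<close> of the face \<open>t k = 0\<close>,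
  that is, the mean of the partial derivative in direction \<open>x k\<close> over the cube.
\<close>

lemma face_exists: "\<exists>y\<in>Y. \<forall>f C. C-lipschitz_on K f \<longrightarrow>
    pr y f = (\<integral>t. f (point (t(k := 1))) \<partial>cube) - (\<integral>t. f (point (t(k := 0))) \<partial>cube)"
proof -
  obtain y1 where y1: "y1 \<in> Y"
    "\<And>f C. C-lipschitz_on K f \<Longrightarrow> pr y1 f = (\<integral>t. f (point (t(k := 1))) \<partial>cube) - f z"
    using average_element[OF continuous_upd] by metis
  obtain y0 where y0: "y0 \<in> Y"
    "\<And>f C. C-lipschitz_on K f \<Longrightarrow> pr y0 f = (\<integral>t. f (point (t(k := 0))) \<partial>cube) - f z"
    using average_element[OF continuous_upd] by metis
  show ?thesis
  proof (intro bexI[of _ "y1 - y0"] allI impI)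
    show "y1 - y0 \<in> Y" by (rule subspace_diff[OF Y y1(1) y0(1)])
    fix f :: "'a \<Rightarrow> real" and C assume f: "C-lipschitz_on K f"
    show "pr (y1 - y0) f = (\<integral>t. f (point (t(k := 1))) \<partial>cube) - (\<integral>t. f (point (t(k := 0))) \<partial>cube)"
      using y1(2)[OF f] y0(2)[OF f] by (simp add: linear_map_on_diff[OF pr_linear[OF f] Y y1(1) y0(1)])
  qed
qed

definition face :: "nat \<Rightarrow> linf"
  where "face k = (SOME y. y \<in> Y \<and> (\<forall>f C. C-lipschitz_on K f \<longrightarrow>
    pr y f = (\<integral>t. f (point (t(k := 1))) \<partial>cube) - (\<integral>t. f (point (t(k := 0))) \<partial>cube)))"

lemma face_in_Y: "face k \<in> Y"
  and pr_face: "C-lipschitz_on K f \<Longrightarrow>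
    pr (face k) f = (\<integral>t. f (point (t(k := 1))) \<partial>cube) - (\<integral>t. f (point (t(k := 0))) \<partial>cube)"
proof -
  have "face k \<in> Y \<and> (\<forall>f C. C-lipschitz_on K f \<longrightarrow>
    pr (face k) f = (\<integral>t. f (point (t(k := 1))) \<partial>cube) - (\<integral>t. f (point (t(k := 0))) \<partial>cube))"
    unfolding face_def by (rule someI_ex) (use face_exists[of k] in blast)
  then show "face k \<in> Y" "C-lipschitz_on K f \<Longrightarrow>
    pr (face k) f = (\<integral>t. f (point (t(k := 1))) \<partial>cube) - (\<integral>t. f (point (t(k := 0))) \<partial>cube)"
    by blast+
qed

text \<open>Passing from the face \<open>t k = 0\<close> to the face \<open>t k = 1\<close> raises
  the coefficient of \<open>x k\<close> by 1 and changes no other.\<close>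

lemma barycentre_face: "barycentre (face k) = x k"
proof (rule LIMSEQ_unique[OF bary_tendsto[OF face_in_Y]])
  have "pr (face k) (\<lambda>v. basis_coeff x v i) = (if i = k then 1 else 0)" for i
    by (simp add: pr_face[OF coeff_lipschitz] coeff_point clip_def cube.prob_space)
  then have "bary n (face k) = (\<Sum>i<n. if i = k then x k else 0)" for n
    unfolding bary_def by (intro sum.cong) auto
  then have "bary n (face k) = x k" if "n \<ge> Suc k" for n using that by simp
  then show "(\<lambda>n. bary n (face k)) \<longlonglongrightarrow> x k"
    by (intro tendsto_eventually) (auto simp: eventually_sequentially)
qed

text \<open>
  The combination of the face functionals with coefficients \<open>v\<close> is the derivative at \<open>0\<close>
  in the direction \<open>\<Sum>k<n. v k *\<^sub>R x k\<close> of the map sending \<open>u\<close> to the mean of \<open>f (u + p)\<close> over the cube,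
  and this map is as Lipschitz as \<open>f\<close>.
\<close>

lemma face_functional_bound:
  assumes f: "1-lipschitz_on K f"
  shows "\<bar>\<Sum>k<n. v k * pr (face k) f\<bar> \<le> norm (\<Sum>k<n. v k *\<^sub>R x k)"
proof -
  have "K \<noteq> {}" using z by blast
  \<comment> \<open>Translates of \<open>K\<close> leave \<open>K\<close>, so the averages need an
    extension with the same Lipschitz constant.\<close>
  with f obtain F where F: "1-lipschitz_on UNIV F" "\<And>p. p \<in> K \<Longrightarrow> F p = f p"
    by (rule lipschitz_extension) blast
  have Fd: "\<bar>F p - F q\<bar> \<le> norm (p - q)" for p q
    using lipschitz_onD[OF F(1), of p q] by (simp add: dist_norm)
  have Fc: "continuous_on UNIV F" by (rule lipschitz_on_continuous_on[OF F(1)])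
  define G where "G u = (\<integral>t. F (u + 1 *\<^sub>R point t) \<partial>cube)" for u
  have intG: "integrable cube (\<lambda>t. F (u + 1 *\<^sub>R point t))" for u
    using integrable_point[OF Fc continuous_on_id, where w = u and c = 1] by simp
  have Gd: "\<bar>G u - G w\<bar> \<le> norm (u - w)" for u w
  proof -
    have "G u - G w = (\<integral>t. F (u + 1 *\<^sub>R point t) - F (w + 1 *\<^sub>R point t) \<partial>cube)"
      unfolding G_def using intG by simp
    also have "\<bar>\<dots>\<bar> \<le> norm (u - w)"
    proof (rule cube_integral_abs_le)
      show "\<bar>F (u + 1 *\<^sub>R point t) - F (w + 1 *\<^sub>R point t)\<bar> \<le> norm (u - w)" for t
        using Fd[of "u + 1 *\<^sub>R point t" "w + 1 *\<^sub>R point t"] by simp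
    qed (use intG in simp)
    finally show ?thesis .
  qed
  define w where "w k = (\<Sum>i<k. v i *\<^sub>R x i)" for k
  define D where "D k = pr (face k) f" for k
  \<comment> \<open>Translation by \<open>s *\<^sub>R w k\<close>, combined with a move of length at
    most \<open>s * \<bar>v k\<bar>\<close> in units of \<open>x k\<close>, displaces a point of a
    face by at most \<open>s * \<delta> k\<close>.\<close>
  define \<delta> where "\<delta> k = norm (w k) + \<bar>v k\<bar> * norm (x k)" for k
  have intface: "integrable cube (\<lambda>t. F (point (t(k := s))))" for k s
    using integrable_point[OF Fc continuous_upd, where w = 0 and c = 1] by simp
  \<comment> \<open>First order expansion along one coordinate. The error is quadratic in
    \<open>s\<close> because both the length of the move and the deviation of \<open>F\<close> from
    its values on the faces are of order \<open>s\<close>.\<close>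
  have step: "\<bar>G (s *\<^sub>R w (Suc k)) - G (s *\<^sub>R w k) - s * v k * D k\<bar> \<le> s * s * (2 * \<bar>v k\<bar> * \<delta> k)"
    if s: "s > 0" for s k
  proof -
    have D: "D k = (\<integral>t. F (point (t(k := 1))) - F (point (t(k := 0))) \<partial>cube)"
      using intface by (simp add: D_def pr_face[OF f] F(2))
    have near: "\<bar>F (s *\<^sub>R w k + 1 *\<^sub>R (point (t(k := 0)) + \<tau> *\<^sub>R x k)) - F (point (t(k := c)))\<bar> \<le> s * \<delta> k"
      if "c \<in> {0..1}" "\<bar>\<tau> - c\<bar> \<le> \<bar>s * v k\<bar>" for c \<tau> t
    proof -
      have "\<bar>F (s *\<^sub>R w k + 1 *\<^sub>R (point (t(k := 0)) + \<tau> *\<^sub>R x k)) - F (point (t(k := c)))\<bar> \<le>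
          norm (s *\<^sub>R w k + (\<tau> - c) *\<^sub>R x k)"
        using Fd[of "s *\<^sub>R w k + 1 *\<^sub>R (point (t(k := 0)) + \<tau> *\<^sub>R x k)" "point (t(k := c))"]
          point_upd[of t k c] clip_id[OF that(1)] by (simp add: algebra_simps)
      also have "\<dots> \<le> s * norm (w k) + \<bar>\<tau> - c\<bar> * norm (x k)"
        using norm_triangle_ineq[of "s *\<^sub>R w k" "(\<tau> - c) *\<^sub>R x k"] s by simp
      also have "\<bar>\<tau> - c\<bar> * norm (x k) \<le> s * \<bar>v k\<bar> * norm (x k)"
        using that(2) s by (intro mult_right_mono) (auto simp: abs_mult)
      finally show ?thesis by (simp add: \<delta>_def algebra_simps)
    qed
    have "\<bar>(\<integral>t. F (s *\<^sub>R w k + 1 *\<^sub>R (point t + (s * v k) *\<^sub>R x k)) \<partial>cube)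
        - (\<integral>t. F (s *\<^sub>R w k + 1 *\<^sub>R point t) \<partial>cube)
        - (s * v k) * (\<integral>t. F (point (t(k := 1))) - F (point (t(k := 0))) \<partial>cube)\<bar> \<le> 2 * \<bar>s * v k\<bar> * (s * \<delta> k)"
      by (rule translate_average[OF Fc intface intface]) (use near[of 1] near[of 0] in auto)
    moreover have "(\<integral>t. F (s *\<^sub>R w k + 1 *\<^sub>R (point t + (s * v k) *\<^sub>R x k)) \<partial>cube) = G (s *\<^sub>R w (Suc k))"
      unfolding G_def by (simp add: w_def algebra_simps)
    moreover have "(\<integral>t. F (s *\<^sub>R w k + 1 *\<^sub>R point t) \<partial>cube) = G (s *\<^sub>R w k)" by (simp add: G_def)
    moreover have "2 * \<bar>s * v k\<bar> * (s * \<delta> k) = s * s * (2 * \<bar>v k\<bar> * \<delta> k)"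
      using s by (simp add: abs_mult)
    ultimately show ?thesis unfolding D by simp
  qed
  define B where "B = (\<Sum>k<n. 2 * \<bar>v k\<bar> * \<delta> k)"
  have B0: "B \<ge> 0" unfolding B_def \<delta>_def by (intro sum_nonneg mult_nonneg_nonneg add_nonneg_nonneg) auto
  \<comment> \<open>The expansions telescope from \<open>w 0\<close> to \<open>w n\<close>; after
    division by \<open>s\<close> the error is \<open>s * B\<close>, and \<open>s\<close> may be
    taken arbitrarily small.\<close>
  have main: "\<bar>\<Sum>k<n. v k * D k\<bar> \<le> norm (w n) + s * B" if s: "s > 0" for s
  proof -
    have "G (s *\<^sub>R w n) - G 0 - s * (\<Sum>k<n. v k * D k) =
        (\<Sum>k<n. G (s *\<^sub>R w (Suc k)) - G (s *\<^sub>R w k) - s * v k * D k)"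
      using sum_lessThan_telescope[of "\<lambda>k. G (s *\<^sub>R w k)" n]
      by (simp add: sum_subtractf sum_distrib_left mult.assoc w_def)
    also have "\<bar>\<dots>\<bar> \<le> (\<Sum>k<n. s * s * (2 * \<bar>v k\<bar> * \<delta> k))"
      by (rule order_trans[OF sum_abs]) (intro sum_mono step s)
    also have "\<dots> = s * s * B" by (simp add: B_def sum_distrib_left)
    finally have "\<bar>s * (\<Sum>k<n. v k * D k)\<bar> \<le> \<bar>G (s *\<^sub>R w n) - G 0\<bar> + s * s * B" by linarith
    also have "\<bar>G (s *\<^sub>R w n) - G 0\<bar> \<le> s * norm (w n)" using Gd[of "s *\<^sub>R w n" 0] s by simp
    finally have "s * \<bar>\<Sum>k<n. v k * D k\<bar> \<le> s * (norm (w n) + s * B)"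
      using s by (simp add: abs_mult algebra_simps)
    then show ?thesis using s by simp
  qed
  have "\<bar>\<Sum>k<n. v k * D k\<bar> \<le> norm (w n)"
  proof (rule field_le_epsilon)
    fix e :: real assume e: "e > 0"
    have "\<bar>\<Sum>k<n. v k * D k\<bar> \<le> norm (w n) + e / (B + 1) * B" using e B0 by (intro main) simp
    also have "e / (B + 1) * B \<le> e" using e B0 by (simp add: divide_le_eq algebra_simps)
    finally show "\<bar>\<Sum>k<n. v k * D k\<bar> \<le> norm (w n) + e" by simp
  qed
  then show ?thesis by (simp add: D_def w_def)
qed

section \<open>The linear lifting of the whole space\<close>

lemma face_sum_in_Y: "(\<Sum>k<n. v k *\<^sub>R face k) \<in> Y"
  by (intro subspace_sum[OF Y] subspace_scale[OF Y] face_in_Y)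

lemma face_sum_bound: "norm (\<Sum>k<n. v k *\<^sub>R face k) \<le> norm (\<Sum>k<n. v k *\<^sub>R x k)"
proof (rule norm_le_pr[OF face_sum_in_Y])
  fix f :: "'a \<Rightarrow> real" assume f: "1-lipschitz_on K f"
  have "pr (\<Sum>k<n. v k *\<^sub>R face k) f = (\<Sum>k<n. v k * pr (face k) f)"
    by (simp add: linear_map_on_sum[OF pr_linear[OF f] Y] linear_map_on_scaleR[OF pr_linear[OF f] Y]
        subspace_scale[OF Y] face_in_Y)
  then show "\<bar>pr (\<Sum>k<n. v k *\<^sub>R face k) f\<bar> \<le> norm (\<Sum>k<n. v k *\<^sub>R x k)"
    using face_functional_bound[OF f] by simp
qed

definition lift_n :: "nat \<Rightarrow> 'a \<Rightarrow> linf"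
  where "lift_n n v = (\<Sum>k<n. basis_coeff x v k *\<^sub>R face k)"

lemma lift_n_Cauchy: "Cauchy (\<lambda>n. lift_n n v)"
proof (rule metric_CauchyI)
  have diff: "norm (lift_n n v - lift_n m v) \<le> norm (basis_proj x n v - basis_proj x m v)" if "m \<le> n" for m n
  proof -
    define c where "c k = (if k < m then 0 else basis_coeff x v k)" for k
    \<comment> \<open>Stated for arbitrary \<open>g\<close> in order to be used with
      \<open>face\<close> and with \<open>x\<close>: a block of the series is a partial sum with
      coefficients zeroed below \<open>m\<close>, so \<open>face_sum_bound\<close> applies to
      it.\<close>
    have *: "(\<Sum>k<n. basis_coeff x v k *\<^sub>R g k) - (\<Sum>k<m. basis_coeff x v k *\<^sub>R g k) = (\<Sum>k<n. c k *\<^sub>R g k)"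
      for g :: "nat \<Rightarrow> 'v::real_vector"
    proof -
      have "{..<n} = {..<m} \<union> {m..<n}" using that by auto
      then show ?thesis by (simp add: sum.union_disjoint ivl_disj_int c_def)
    qed
    show ?thesis unfolding lift_n_def basis_proj_def * by (rule face_sum_bound)
  qed
  fix e :: real assume e: "e > 0"
  have "Cauchy (\<lambda>n. basis_proj x n v)" by (rule LIMSEQ_imp_Cauchy[OF basis_proj_tendsto[OF basis]])
  then obtain N where N: "\<And>m n. m \<ge> N \<Longrightarrow> n \<ge> N \<Longrightarrow> norm (basis_proj x m v - basis_proj x n v) < e"
    using CauchyD[OF _ e] by blast
  have "dist (lift_n m v) (lift_n n v) < e" if "m \<ge> N" "n \<ge> N" for m n
  proof (cases "m \<le> n")
    case True
    then show ?thesis using diff[OF True] N[OF that(2,1)] by (simp add: dist_norm norm_minus_commute)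
  next
    case False
    then show ?thesis using diff[of n m] N[OF that] by (simp add: dist_norm)
  qed
  then show "\<exists>N. \<forall>m\<ge>N. \<forall>n\<ge>N. dist (lift_n m v) (lift_n n v) < e" by blast
qed

definition lift :: "'a \<Rightarrow> linf"
  where "lift v = lim (\<lambda>n. lift_n n v)"

lemma lift_tendsto: "(\<lambda>n. lift_n n v) \<longlonglongrightarrow> lift v"
proof -
  obtain l where "(\<lambda>n. lift_n n v) \<longlonglongrightarrow> l" by (rule linf_Cauchy_convergent[OF lift_n_Cauchy])
  then show ?thesis by (simp add: lift_def limI)
qed

lemma lift_n_in_Y: "lift_n n v \<in> Y"
  unfolding lift_n_def by (rule face_sum_in_Y)

lemma lift_in_Y: "lift v \<in> Y"
  by (rule closed_sequentially[OF closed_Y lift_n_in_Y lift_tendsto])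

lemma lift_linear: "linear_map_on UNIV lift"
proof (rule linear_map_onI)
  fix u v
  have "(\<lambda>n. lift_n n (u + v)) \<longlonglongrightarrow> lift u + lift v"
    using tendsto_add[OF lift_tendsto[of u] lift_tendsto[of v]]
    by (simp add: lift_n_def basis_coeff_add[OF basis] scaleR_add_left sum.distrib)
  then show "lift (u + v) = lift u + lift v" by (rule LIMSEQ_unique[OF lift_tendsto])
next
  fix c u
  have "(\<lambda>n. lift_n n (c *\<^sub>R u)) \<longlonglongrightarrow> c *\<^sub>R lift u"
    using tendsto_scaleR[OF tendsto_const lift_tendsto[of u], of c]
    by (simp add: lift_n_def basis_coeff_scaleR[OF basis] scaleR_sum_right)
  then show "lift (c *\<^sub>R u) = c *\<^sub>R lift u" by (rule LIMSEQ_unique[OF lift_tendsto])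
qed

lemma lift_bound: "norm (lift v) \<le> M * norm v"
proof (rule tendsto_upperbound[OF tendsto_norm[OF lift_tendsto]])
  show "\<forall>\<^sub>F n in sequentially. norm (lift_n n v) \<le> M * norm v"
    using order_trans[OF face_sum_bound proj_bound[unfolded basis_proj_def]]
    by (simp add: lift_n_def)
qed simp

text \<open>On partial sums this is \<open>barycentre_face\<close>; boundedness of the barycentre
  map passes to the limit.\<close>

lemma barycentre_lift: "barycentre (lift v) = v"
proof (rule LIMSEQ_unique)
  have "barycentre (lift_n n v) = basis_proj x n v" for n
    unfolding lift_n_def basis_proj_def
    by (simp add: linear_map_on_sum[OF barycentre_linear Y] linear_map_on_scaleR[OF barycentre_linear Y]
        subspace_scale[OF Y] face_in_Y barycentre_face)
  then show "(\<lambda>n. barycentre (lift_n n v)) \<longlonglongrightarrow> v" by (simp add: basis_proj_tendsto[OF basis])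
  have "(\<lambda>n. barycentre (lift_n n v) - barycentre (lift v)) \<longlonglongrightarrow> 0"
  proof (rule Lim_null_comparison)
    show "\<forall>\<^sub>F n in sequentially. norm (barycentre (lift_n n v) - barycentre (lift v)) \<le> M * norm (lift_n n v - lift v)"
      using barycentre_bound[OF subspace_diff[OF Y lift_n_in_Y lift_in_Y]]
      by (simp add: linear_map_on_diff[OF barycentre_linear Y lift_n_in_Y lift_in_Y])
    show "(\<lambda>n. M * norm (lift_n n v - lift v)) \<longlonglongrightarrow> 0"
      using lift_tendsto[of v] by (intro tendsto_mult_right_zero tendsto_norm_zero) (simp add: LIM_zero)
  qed
  then show "(\<lambda>n. barycentre (lift_n n v)) \<longlonglongrightarrow> barycentre (lift v)" by (simp add: LIM_zero_iff)
qed

lemma retract_free: "retract (UNIV :: 'a set) Y"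
  by (rule retractI[OF lift_linear barycentre_linear, where C = M and D = M])
     (auto simp: lift_in_Y barycentre_lift lift_bound barycentre_bound)

end

subsection \<open>The bounded approximation property\<close>

context free_cube
begin

text \<open>The contraction by \<open>1 - h\<close> makes room for a copy of the cube scaled by
  \<open>h\<close>: by convexity, for \<open>u\<close> in \<open>K\<close> the function
  \<open>g\<close> is evaluated only at points of \<open>K\<close>.\<close>

definition smear :: "nat \<Rightarrow> real \<Rightarrow> ('a \<Rightarrow> real) \<Rightarrow> 'a \<Rightarrow> real"
  where "smear n h g u = (\<integral>t. g ((1 - h) *\<^sub>R basis_proj x n u + h *\<^sub>R point t) \<partial>cube)"

text \<open>For a function bounded by 1, changing the coefficient of \<open>x k\<close> by
  \<open>a\<close> alters the average by at most \<open>2 * \<bar>a\<bar> / h\<close>; the second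
  factor is the Lipschitz constant of that coefficient.\<close>

definition smear_const :: "nat \<Rightarrow> real \<Rightarrow> real"
  where "smear_const n h = (\<Sum>k<n. 2 / h * (2 * M / norm (x k)))"

lemma smear_const_nonneg: "h > 0 \<Longrightarrow> smear_const n h \<ge> 0"
  unfolding smear_const_def using M1 by (intro sum_nonneg) simp

text \<open>One coordinate is moved at a time. In \<open>translate_average\<close> both limit
  functions are taken to be 0 and the tolerance is the bound \<open>B\<close> itself.\<close>

lemma translate_bound:
  assumes g: "continuous_on UNIV g" "\<And>p. \<bar>g p\<bar> \<le> B" and h: "h > 0"
  shows "\<bar>(\<integral>t. g (u + (\<Sum>k<n. a k *\<^sub>R x k) + h *\<^sub>R point t) \<partial>cube) - (\<integral>t. g (u + h *\<^sub>R point t) \<partial>cube)\<bar>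
    \<le> (\<Sum>k<n. 2 * \<bar>a k / h\<bar> * B)"
proof (induction n)
  case (Suc n)
  let ?u = "u + (\<Sum>k<n. a k *\<^sub>R x k)"
  have "\<bar>(\<integral>t. g (?u + h *\<^sub>R (point t + (a n / h) *\<^sub>R x n)) \<partial>cube) - (\<integral>t. g (?u + h *\<^sub>R point t) \<partial>cube)
      - (a n / h) * (\<integral>t. (\<lambda>_. 0) t - (\<lambda>_. 0) t \<partial>cube)\<bar> \<le> 2 * \<bar>a n / h\<bar> * B"
    by (rule translate_average[OF g(1)]) (use g(2) in auto)
  moreover have "?u + h *\<^sub>R (point t + (a n / h) *\<^sub>R x n) = u + (\<Sum>k<Suc n. a k *\<^sub>R x k) + h *\<^sub>R point t" for t
    using h by (simp add: algebra_simps)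
  ultimately show ?case using Suc.IH by (simp add: abs_le_iff)
qed simp

text \<open>This is the gain of regularity: a small supremum of a continuous function becomes a
  small Lipschitz constant, because only the first \<open>n\<close> coefficients of the argument
  enter and each is smoothed at scale \<open>h\<close>.\<close>

lemma smear_lipschitz_bounded:
  assumes g: "continuous_on UNIV g" "\<And>p. \<bar>g p\<bar> \<le> B" and h: "0 < h" "h \<le> 1"
  shows "(B * smear_const n h)-lipschitz_on A (smear n h g)"
proof (rule lipschitz_onI)
  have B: "B \<ge> 0" using g(2)[of 0] by simp
  then show "0 \<le> B * smear_const n h" using smear_const_nonneg[OF h(1)] by simp
  fix p q
  define a where "a k = (1 - h) * (basis_coeff x p k - basis_coeff x q k)" for k
  have eq: "(1 - h) *\<^sub>R basis_proj x n q + (\<Sum>k<n. a k *\<^sub>R x k) = (1 - h) *\<^sub>R basis_proj x n p"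
  proof -
    have "(\<Sum>k<n. a k *\<^sub>R x k) = (1 - h) *\<^sub>R basis_proj x n (p - q)"
      by (simp add: a_def basis_proj_def coeff_diff scaleR_sum_right)
    then show ?thesis by (simp add: proj_diff scaleR_diff_right)
  qed
  have "\<bar>smear n h g p - smear n h g q\<bar> \<le> (\<Sum>k<n. 2 * \<bar>a k / h\<bar> * B)"
    using translate_bound[OF g h(1), of "(1 - h) *\<^sub>R basis_proj x n q" a n]
    by (simp add: smear_def eq)
  also have "\<dots> \<le> (\<Sum>k<n. 2 / h * (2 * M / norm (x k)) * (B * norm (p - q)))"
  proof (rule sum_mono)
    fix k
    have "\<bar>a k\<bar> \<le> 1 * \<bar>basis_coeff x p k - basis_coeff x q k\<bar>"
      unfolding a_def abs_mult using h by (intro mult_right_mono) auto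
    also have "\<dots> \<le> 2 * M / norm (x k) * norm (p - q)"
      using coeff_bound[of "p - q" k] by (simp add: coeff_diff)
    finally have "2 / h * B * \<bar>a k\<bar> \<le> 2 / h * B * (2 * M / norm (x k) * norm (p - q))"
      using h B by (intro mult_left_mono) auto
    then show "2 * \<bar>a k / h\<bar> * B \<le> 2 / h * (2 * M / norm (x k)) * (B * norm (p - q))"
      using h by (simp add: abs_divide mult_ac)
  qed
  also have "\<dots> = B * smear_const n h * dist p q"
    unfolding smear_const_def dist_norm by (subst sum_distrib_right[symmetric]) (simp add: mult_ac)
  finally show "dist (smear n h g p) (smear n h g q) \<le> B * smear_const n h * dist p q"
    by (simp add: dist_real_def)
qed

text \<open>Truncating an expansion sets the later parameters to 0, an admissible value.\<close>

lemma proj_in_K: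
  assumes "p \<in> K"
  shows "basis_proj x n p \<in> K"
proof -
  obtain t where t: "p = point t" using assms by (auto simp: K_def)
  let ?s = "\<lambda>j. if j < n then clip (t j) else 0"
  have "(\<lambda>j. ?s j *\<^sub>R x j) sums (\<Sum>j<n. ?s j *\<^sub>R x j)"
    by (rule sums_finite) auto
  then have "(\<Sum>j. ?s j *\<^sub>R x j) = basis_proj x n p"
    by (simp add: sums_iff t basis_proj_def coeff_point)
  moreover have "point ?s = (\<Sum>j. ?s j *\<^sub>R x j)"
    by (rule point_eq_sum) (simp add: clip_bounds)
  ultimately show ?thesis using point_in_K by metis
qed

lemma smear_in_K:
  assumes "p \<in> K" "0 < h" "h \<le> 1"
  shows "(1 - h) *\<^sub>R basis_proj x n p + h *\<^sub>R point t \<in> K"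
  using convexD[OF convex_K proj_in_K[OF assms(1)] point_in_K] assms(2,3) by auto

lemma integrable_smear:
  "continuous_on UNIV g \<Longrightarrow> integrable cube (\<lambda>t. g (w + h *\<^sub>R point t) :: real)"
  using integrable_point[OF _ continuous_on_id, of g w h] by simp

text \<open>Averaging translates of a Lipschitz function costs nothing; only the projection enlarges
  the constant, to a value independent of \<open>n\<close> and \<open>h\<close>.\<close>

lemma smear_lipschitz:
  assumes F: "1-lipschitz_on UNIV F" and h: "0 < h" "h \<le> 1"
  shows "M-lipschitz_on A (smear n h F)"
proof (rule lipschitz_onI)
  have Fc: "continuous_on UNIV F" by (rule lipschitz_on_continuous_on[OF F])
  fix p q
  let ?w = "\<lambda>p t. (1 - h) *\<^sub>R basis_proj x n p + h *\<^sub>R point t"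
  have "smear n h F p - smear n h F q = (\<integral>t. F (?w p t) - F (?w q t) \<partial>cube)"
    unfolding smear_def using integrable_smear[OF Fc] by simp
  also have "\<bar>\<dots>\<bar> \<le> M * norm (p - q)"
  proof (rule cube_integral_abs_le)
    fix t
    have "\<bar>F (?w p t) - F (?w q t)\<bar> \<le> norm (?w p t - ?w q t)"
      using lipschitz_onD[OF F, of "?w p t" "?w q t"] by (simp add: dist_norm)
    also have "?w p t - ?w q t = (1 - h) *\<^sub>R basis_proj x n (p - q)"
      by (simp add: proj_diff algebra_simps)
    also have "norm \<dots> \<le> 1 * norm (basis_proj x n (p - q))"
      unfolding norm_scaleR using h by (intro mult_right_mono) auto
    also have "\<dots> \<le> M * norm (p - q)" using proj_bound by simp
    finally show "\<bar>F (?w p t) - F (?w q t)\<bar> \<le> M * norm (p - q)" .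
  qed (use integrable_smear[OF Fc] in simp)
  finally show "dist (smear n h F p) (smear n h F q) \<le> M * dist p q" by (simp add: dist_norm)
qed (use M1 in simp)

text \<open>
  The finite rank operators are preadjoint to \<open>f \<mapsto> smear n h (\<Sum>a\<in>A. f a * P a)\<close> with a partition of
  unity \<open>P\<close> so fine that the error of this discretisation of \<open>f\<close>, once averaged, has small Lipschitz
  constant.
\<close>

lemma finite_rank_operator:
  assumes h: "0 < h" "h \<le> 1" and \<delta>: "\<delta> > 0" "\<delta> * smear_const n h \<le> 1"
  obtains T where "linear_map_on Y T" "T ` Y \<subseteq> Y" "\<exists>B. finite B \<and> T ` Y \<subseteq> span B"
    "\<And>y. y \<in> Y \<Longrightarrow> norm (T y) \<le> (M + 1) * norm y"
    "\<And>p R. p \<in> K \<Longrightarrow> (\<And>q. q \<in> K \<Longrightarrow> norm q \<le> R) \<Longrightarrow> norm (T (j p) - j p)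
      \<le> 2 * (\<delta> + 2 * h * R) + norm (basis_proj x n p - p) + norm (basis_proj x n z - z)"
proof -
  obtain A and P :: "'a \<Rightarrow> 'a \<Rightarrow> real" where A: "finite A" "A \<subseteq> K" and P: "\<And>a. continuous_on UNIV (P a)"
    "\<And>a u. 0 \<le> P a u" "\<And>u. (\<Sum>a\<in>A. P a u) \<le> 1" "\<And>u. u \<in> K \<Longrightarrow> (\<Sum>a\<in>A. P a u) = 1"
    "\<And>a u. P a u \<noteq> 0 \<Longrightarrow> dist u a < \<delta>"
    using partition_of_unity[OF compact_K \<delta>(1)] by blast
  have jA: "j a \<in> Y" if "a \<in> A" for a using that A(2) j by blast
  \<comment> \<open>The zero function stands in for \<open>P a\<close> off \<open>A\<close>, so that
    one Lipschitz bound holds for every index; the bound by 1 in \<open>Pb\<close> is for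
    \<open>a\<close> in \<open>A\<close>.\<close>
  define Q where "Q a = smear n h (if a \<in> A then P a else (\<lambda>_. 0))" for a
  have Pb: "\<bar>P a u\<bar> \<le> 1" if "a \<in> A" for a u
  proof -
    have "P a u \<le> (\<Sum>a\<in>A. P a u)" using that A(1) P(2) by (intro member_le_sum) auto
    then show ?thesis using P(2)[of a u] P(3)[of u] by simp
  qed
  have Qlip: "(1 * smear_const n h)-lipschitz_on S (Q a)" for a S
    unfolding Q_def by (rule smear_lipschitz_bounded[OF _ _ h]) (use P(1) Pb in auto)
  define T where "T y = (\<Sum>a\<in>A. pr y (Q a) *\<^sub>R j a)" for y
  have lin: "linear_map_on Y T"
    using pr_linear[OF Qlip]
    by (simp add: linear_map_on_def T_def sum.distrib scaleR_add_left scaleR_sum_right)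
  have TY: "T y \<in> Y" for y unfolding T_def using jA by (intro subspace_sum subspace_scale Y)
  have fin: "T y \<in> span (j ` A)" for y
    unfolding T_def by (intro span_sum span_scale span_base) auto
  \<comment> \<open>\<open>r\<close> is the adjoint of \<open>T\<close> in the pairing:
    \<open>pr (T y) f\<close> will equal \<open>pr y (r f)\<close>.\<close>
  define r where "r f u = (\<Sum>a\<in>A. f a * Q a u)" for f u
  have prT: "pr (T y) f = (\<Sum>a\<in>A. (f a - f z) * pr y (Q a))" if f: "1-lipschitz_on K f" for f y
    unfolding T_def using jA A(2)
    by (simp add: linear_map_on_sum[OF pr_linear[OF f] Y] linear_map_on_scaleR[OF pr_linear[OF f] Y]
        subspace_scale[OF Y] pr_j[OF f] subset_iff mult.commute)
  have Qint: "integrable cube (\<lambda>t. P a ((1 - h) *\<^sub>R basis_proj x n u + h *\<^sub>R point t))" for a u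
    by (rule integrable_smear[OF P(1)])
  have Q_sum: "(\<Sum>a\<in>A. c a * Q a u) = (\<integral>t. (\<Sum>a\<in>A. c a * P a ((1 - h) *\<^sub>R basis_proj x n u + h *\<^sub>R point t)) \<partial>cube)"
    for c u
    using Qint[of _ u] by (simp add: Q_def smear_def Bochner_Integration.integral_sum)
  have Q_one: "(\<Sum>a\<in>A. Q a u) = 1" if "u \<in> K" for u
    using Q_sum[of "\<lambda>_. 1" u] P(4)[OF smear_in_K[OF that h]] by (simp add: cube.prob_space)
  have disc: "\<bar>\<Sum>a\<in>A. (F a - F u) * P a u\<bar> \<le> \<delta>" if F: "1-lipschitz_on UNIV F" for F :: "'a \<Rightarrow> real" and u
  proof -
    have "\<bar>\<Sum>a\<in>A. (F a - F u) * P a u\<bar> \<le> (\<Sum>a\<in>A. \<delta> * P a u)"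
    proof (rule order_trans[OF sum_abs], rule sum_mono)
      fix a
      show "\<bar>(F a - F u) * P a u\<bar> \<le> \<delta> * P a u"
      proof (cases "P a u = 0")
        case False
        have "\<bar>F a - F u\<bar> \<le> \<delta>"
          using lipschitz_onD[OF F, of a u] P(5)[OF False] by (simp add: dist_real_def dist_commute)
        then show ?thesis using P(2)[of a u] by (simp add: abs_mult mult_right_mono)
      qed simp
    qed
    also have "\<dots> = \<delta> * (\<Sum>a\<in>A. P a u)" by (rule sum_distrib_left[symmetric])
    also have "\<dots> \<le> \<delta> * 1" using P(3) \<delta>(1) by (intro mult_left_mono) auto
    finally show ?thesis by simp
  qed
  \<comment> \<open>The averaged points lie in \<open>K\<close>, where the partition sums to 1. The
    discretised function is there \<open>F\<close> plus an error of size at most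
    \<open>\<delta>\<close>, and averaging is linear.\<close>
  have r_eq: "r f u = smear n h F u + smear n h (\<lambda>u. \<Sum>a\<in>A. (F a - F u) * P a u) u"
    if u: "u \<in> K" and F: "1-lipschitz_on UNIV F" "\<And>p. p \<in> K \<Longrightarrow> F p = f p" for f F u
  proof -
    have Fc: "continuous_on UNIV F" by (rule lipschitz_on_continuous_on[OF F(1)])
    define \<phi> where "\<phi> u = (\<Sum>a\<in>A. (F a - F u) * P a u)" for u
    have \<phi>c: "continuous_on UNIV \<phi>"
      unfolding \<phi>_def by (intro continuous_intros P(1) Fc)
    let ?w = "\<lambda>t. (1 - h) *\<^sub>R basis_proj x n u + h *\<^sub>R point t"
    have "r f u = (\<integral>t. (\<Sum>a\<in>A. f a * P a (?w t)) \<partial>cube)" unfolding r_def by (rule Q_sum)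
    also have "\<dots> = (\<integral>t. F (?w t) + \<phi> (?w t) \<partial>cube)"
    proof (rule Bochner_Integration.integral_cong)
      fix t
      have "(\<Sum>a\<in>A. F (?w t) * P a (?w t)) = F (?w t)"
        using P(4)[OF smear_in_K[OF u h]] by (simp flip: sum_distrib_left)
      moreover have "(\<Sum>a\<in>A. f a * P a (?w t)) = (\<Sum>a\<in>A. F a * P a (?w t))"
        using A(2) F(2) by (intro sum.cong) auto
      ultimately show "(\<Sum>a\<in>A. f a * P a (?w t)) = F (?w t) + \<phi> (?w t)"
        by (simp add: \<phi>_def left_diff_distrib sum_subtractf)
    qed simp
    also have "\<dots> = smear n h F u + smear n h \<phi> u"
      unfolding smear_def using integrable_smear[OF Fc] integrable_smear[OF \<phi>c] by simp
    finally show ?thesis by (simp only: \<phi>_def[abs_def])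
  qed
  have disc_cont: "continuous_on UNIV (\<lambda>u. \<Sum>a\<in>A. (F a - F u) * P a u)"
    if "1-lipschitz_on UNIV F" for F :: "'a \<Rightarrow> real"
    by (intro continuous_intros P(1) lipschitz_on_continuous_on[OF that])
  \<comment> \<open>\<open>F\<close> contributes \<open>M\<close>, and the averaged error
    contributes \<open>\<delta> * smear_const n h\<close>, which is at most 1.\<close>
  have r_lip: "(M + 1)-lipschitz_on K (r f)" if f: "1-lipschitz_on K f" for f
  proof -
    have "K \<noteq> {}" using z by blast
    with f obtain F where F: "1-lipschitz_on UNIV F" "\<And>p. p \<in> K \<Longrightarrow> F p = f p"
      by (rule lipschitz_extension) blast
    have "(M + \<delta> * smear_const n h)-lipschitz_on K
        (\<lambda>u. smear n h F u + smear n h (\<lambda>u. \<Sum>a\<in>A. (F a - F u) * P a u) u)"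
      by (rule lipschitz_on_add[OF smear_lipschitz[OF F(1) h]
            smear_lipschitz_bounded[OF disc_cont[OF F(1)] disc[OF F(1)] h]])
    then have "(M + \<delta> * smear_const n h)-lipschitz_on K (r f)"
      by (simp add: lipschitz_on_def r_eq[OF _ F])
    then show ?thesis using \<delta>(2) by (auto intro: lipschitz_on_mono)
  qed
  show ?thesis
  proof (rule that[OF lin])
    show "T ` Y \<subseteq> Y" using TY by auto
    show "\<exists>B. finite B \<and> T ` Y \<subseteq> span B" using A(1) fin by (intro exI[of _ "j ` A"]) auto
    show "norm (T y) \<le> (M + 1) * norm y" if y: "y \<in> Y" for y
    proof (rule norm_le_pr[OF TY])
      fix f :: "'a \<Rightarrow> real" assume f: "1-lipschitz_on K f"
      \<comment> \<open>On \<open>K\<close> the functions \<open>Q a\<close> sum to 1, so the terms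
        containing \<open>f z\<close> cancel.\<close>
      have "r f p - r f z = (\<Sum>a\<in>A. (f a - f z) * (Q a p - Q a z))" if "p \<in> K" for p
      proof -
        have "(\<Sum>a\<in>A. (f a - f z) * (Q a p - Q a z)) =
            r f p - r f z - f z * ((\<Sum>a\<in>A. Q a p) - (\<Sum>a\<in>A. Q a z))"
          by (simp add: r_def sum_subtractf algebra_simps sum_distrib_left sum.distrib)
        then show ?thesis by (simp add: Q_one that z)
      qed
      from pr_sum[OF Qlip r_lip[OF f] this y] have "pr (T y) f = pr y (r f)"
        by (simp add: prT[OF f])
      then show "\<bar>pr (T y) f\<bar> \<le> (M + 1) * norm y" using pr_bound[OF r_lip[OF f] y] by simp
    qed
    fix p and R :: real assume p: "p \<in> K" and R: "\<And>q. q \<in> K \<Longrightarrow> norm q \<le> R"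
    show "norm (T (j p) - j p)
      \<le> 2 * (\<delta> + 2 * h * R) + norm (basis_proj x n p - p) + norm (basis_proj x n z - z)"
    proof (rule norm_le_pr[OF subspace_diff[OF Y TY j[OF p]]])
      fix f :: "'a \<Rightarrow> real" assume f: "1-lipschitz_on K f"
      have "K \<noteq> {}" using z by blast
      with f obtain F where F: "1-lipschitz_on UNIV F" "\<And>p. p \<in> K \<Longrightarrow> F p = f p"
        by (rule lipschitz_extension) blast
      \<comment> \<open>Three errors add up: discretisation, displacement by the small box, and
        truncation of the expansion.\<close>
      have close: "\<bar>r f u - f u\<bar> \<le> \<delta> + 2 * h * R + norm (basis_proj x n u - u)" if u: "u \<in> K" for u
      proof -
        let ?w = "\<lambda>t. (1 - h) *\<^sub>R basis_proj x n u + h *\<^sub>R point t"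
        have Fc: "continuous_on UNIV F" by (rule lipschitz_on_continuous_on[OF F(1)])
        have "smear n h F u - F u = (\<integral>t. F (?w t) - F u \<partial>cube)"
          unfolding smear_def using integrable_smear[OF Fc] by (simp add: cube.prob_space)
        also have "\<bar>\<dots>\<bar> \<le> norm (basis_proj x n u - u) + 2 * h * R"
        proof (rule cube_integral_abs_le)
          fix t
          have "\<bar>F (?w t) - F u\<bar> \<le> norm (?w t - u)"
            using lipschitz_onD[OF F(1), of "?w t" u] by (simp add: dist_norm)
          also have "?w t - u = (basis_proj x n u - u) + h *\<^sub>R (point t - basis_proj x n u)"
            by (simp add: algebra_simps)
          also have "norm \<dots> \<le> norm (basis_proj x n u - u) + h * (norm (point t) + norm (basis_proj x n u))"
            using h by (intro order_trans[OF norm_triangle_ineq] add_left_mono)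
              (simp add: norm_triangle_ineq4)
          also have "h * (norm (point t) + norm (basis_proj x n u)) \<le> h * (R + R)"
            using h R[OF point_in_K] R[OF proj_in_K[OF u]] by (intro mult_left_mono add_mono) auto
          finally show "\<bar>F (?w t) - F u\<bar> \<le> norm (basis_proj x n u - u) + 2 * h * R" by simp
        qed (use integrable_smear[OF Fc] in simp)
        moreover have "\<bar>smear n h (\<lambda>u. \<Sum>a\<in>A. (F a - F u) * P a u) u\<bar> \<le> \<delta>"
          unfolding smear_def
          by (rule cube_integral_abs_le[OF integrable_smear[OF disc_cont[OF F(1)]] disc[OF F(1)]])
        ultimately show ?thesis using r_eq[OF u F] F(2)[OF u] by linarith
      qed
      have "pr (T (j p)) f = (\<Sum>a\<in>A. (f a - f z) * (Q a p - Q a z))"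
        by (simp add: prT[OF f] pr_j[OF Qlip p])
      also have "\<dots> = r f p - r f z - f z * ((\<Sum>a\<in>A. Q a p) - (\<Sum>a\<in>A. Q a z))"
        by (simp add: r_def sum_subtractf algebra_simps sum_distrib_left sum.distrib)
      finally have "pr (T (j p)) f = r f p - r f z" by (simp add: Q_one p z)
      then have "pr (T (j p) - j p) f = (r f p - f p) - (r f z - f z)"
        by (simp add: linear_map_on_diff[OF pr_linear[OF f] Y TY j[OF p]] pr_j[OF f p])
      then show "\<bar>pr (T (j p) - j p) f\<bar>
          \<le> 2 * (\<delta> + 2 * h * R) + norm (basis_proj x n p - p) + norm (basis_proj x n z - z)"
        using close[OF p] close[OF z] by simp
    qed
  qed
qed

lemma BAP_free: "bounded_approximation_property Y"
proof -
  obtain R where R: "R \<ge> 0" "\<And>q. q \<in> K \<Longrightarrow> norm q \<le> R" using K_bound by blast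
  define h where "h n = 1 / real (Suc n)" for n
  \<comment> \<open>The mesh is chosen after \<open>n\<close> and \<open>h n\<close>, to compensate
    \<open>smear_const\<close>; the summand \<open>Suc n\<close> gives
    \<open>\<delta> n \<le> h n\<close>, so the mesh tends to 0.\<close>
  define \<delta> where "\<delta> n = 1 / (real (Suc n) + smear_const n (h n))" for n
  have h: "0 < h n" "h n \<le> 1" for n by (simp_all add: h_def)
  have sc: "smear_const n (h n) \<ge> 0" for n by (rule smear_const_nonneg[OF h(1)])
  have \<delta>: "\<delta> n > 0" "\<delta> n * smear_const n (h n) \<le> 1" "\<delta> n \<le> h n" for n
    using sc[of n] by (simp_all add: \<delta>_def h_def frac_le add_pos_nonneg divide_le_eq)
  let ?e = "\<lambda>n p. 2 * (\<delta> n + 2 * h n * R) + norm (basis_proj x n p - p) + norm (basis_proj x n z - z)"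
  have "\<forall>n. \<exists>T. linear_map_on Y T \<and> T ` Y \<subseteq> Y \<and> (\<exists>B. finite B \<and> T ` Y \<subseteq> span B) \<and>
      (\<forall>y\<in>Y. norm (T y) \<le> (M + 1) * norm y) \<and> (\<forall>p\<in>K. norm (T (j p) - j p) \<le> ?e n p)"
  proof
    fix n
    obtain T where "linear_map_on Y T" "T ` Y \<subseteq> Y" "\<exists>B. finite B \<and> T ` Y \<subseteq> span B"
      "\<And>y. y \<in> Y \<Longrightarrow> norm (T y) \<le> (M + 1) * norm y"
      "\<And>p R. p \<in> K \<Longrightarrow> (\<And>q. q \<in> K \<Longrightarrow> norm q \<le> R) \<Longrightarrow> norm (T (j p) - j p)
        \<le> 2 * (\<delta> n + 2 * h n * R) + norm (basis_proj x n p - p) + norm (basis_proj x n z - z)"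
      by (rule finite_rank_operator[OF h \<delta>(1,2)]) blast
    then show "\<exists>T. linear_map_on Y T \<and> T ` Y \<subseteq> Y \<and> (\<exists>B. finite B \<and> T ` Y \<subseteq> span B) \<and>
      (\<forall>y\<in>Y. norm (T y) \<le> (M + 1) * norm y) \<and> (\<forall>p\<in>K. norm (T (j p) - j p) \<le> ?e n p)"
      using R(2) by (intro exI[of _ T]) auto
  qed
  from choice[OF this] obtain T where T0: "\<forall>n. linear_map_on Y (T n) \<and> T n ` Y \<subseteq> Y \<and>
      (\<exists>B. finite B \<and> T n ` Y \<subseteq> span B) \<and>
      (\<forall>y\<in>Y. norm (T n y) \<le> (M + 1) * norm y) \<and> (\<forall>p\<in>K. norm (T n (j p) - j p) \<le> ?e n p)" ..
  have T: "linear_map_on Y (T n)" "T n ` Y \<subseteq> Y" "\<exists>B. finite B \<and> T n ` Y \<subseteq> span B"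
    "y \<in> Y \<Longrightarrow> norm (T n y) \<le> (M + 1) * norm y"
    "p \<in> K \<Longrightarrow> norm (T n (j p) - j p) \<le> ?e n p" for n y p
    using T0 by blast+
  \<comment> \<open>The bound \<open>M + 2\<close>, uniform in \<open>n\<close>, reduces convergence
    to point evaluations, where all errors tend to 0.\<close>
  have lim: "(\<lambda>n. T n y - y) \<longlonglongrightarrow> 0" if y: "y \<in> Y" for y
  proof (rule null_on_span[OF _ _ _ y])
    show "linear_map_on Y (\<lambda>y. T n y - y)" for n
      using T(1)[of n] by (simp add: linear_map_on_def scaleR_diff_right)
    show "norm (T n y - y) \<le> (M + 2) * norm y" if "y \<in> Y" for n y
      using norm_triangle_ineq4[of "T n y" y] T(4)[OF that, of n] by (simp add: algebra_simps)
    fix p assume p: "p \<in> K"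
    have h0: "h \<longlonglongrightarrow> 0"
      using LIMSEQ_inverse_real_of_nat by (simp add: h_def[abs_def] inverse_eq_divide)
    have \<delta>0: "\<delta> \<longlonglongrightarrow> 0"
      by (rule tendsto_sandwich[OF _ _ tendsto_const h0]) (simp_all add: \<delta> less_imp_le)
    have proj0: "(\<lambda>n. norm (basis_proj x n q - q)) \<longlonglongrightarrow> 0" for q
      using tendsto_norm_zero[OF LIM_zero[OF basis_proj_tendsto[OF basis]]] .
    have "(\<lambda>n. ?e n p) \<longlonglongrightarrow> 2 * (0 + 2 * 0 * R) + 0 + 0"
      by (intro tendsto_intros h0 \<delta>0 proj0)
    then have "(\<lambda>n. ?e n p) \<longlonglongrightarrow> 0" by simp
    then show "(\<lambda>n. T n (j p) - j p) \<longlonglongrightarrow> 0"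
      by (rule Lim_null_comparison[rotated]) (use T(5)[OF p] in simp)
  qed
  have "\<exists>S. linear_map_on Y S \<and> S ` Y \<subseteq> Y \<and> (\<exists>B. finite B \<and> S ` Y \<subseteq> span B) \<and>
      (\<forall>y\<in>Y. norm (S y) \<le> (M + 1) * norm y) \<and> (\<forall>y\<in>F. norm (y - S y) \<le> \<epsilon>)"
    if F: "finite F" "F \<subseteq> Y" "\<epsilon> > 0" for F \<epsilon>
  proof -
    have "\<forall>\<^sub>F n in sequentially. norm (T n y - y) \<le> \<epsilon>" if y: "y \<in> F" for y
    proof -
      have "(\<lambda>n. T n y - y) \<longlonglongrightarrow> 0" using lim y F(2) by blast
      then have "(\<lambda>n. norm (T n y - y)) \<longlonglongrightarrow> 0" by (rule tendsto_norm_zero)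
      from order_tendstoD(2)[OF this F(3)] show ?thesis by eventually_elim simp
    qed
    then have "\<forall>\<^sub>F n in sequentially. \<forall>y\<in>F. norm (T n y - y) \<le> \<epsilon>"
      using F(1) by (simp add: eventually_ball_finite)
    then obtain n where "\<forall>y\<in>F. norm (T n y - y) \<le> \<epsilon>"
      by (auto simp: eventually_sequentially)
    then show ?thesis using T by (intro exI[of _ "T n"]) (simp add: norm_minus_commute)
  qed
  moreover have "M + 1 > 0" using M1 by simp
  ultimately show ?thesis unfolding bounded_approximation_property_def by auto
qed

text \<open>The embedding \<open>j\<close> is 1-Lipschitz, so rational combinations of the images of
  a dense sequence of \<open>K\<close> suffice.\<close>

lemma separable_free: "separable_space (top_of_set Y)"
proof -
  have "K \<noteq> {}" using z by blast
  with compact_K obtain d :: "nat \<Rightarrow> 'a" where d: "\<And>i. d i \<in> K"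
    "\<And>p \<epsilon>. p \<in> K \<Longrightarrow> \<epsilon> > 0 \<Longrightarrow> \<exists>i. dist p (d i) < \<epsilon>"
    by (rule compact_dense_sequence) blast
  have jd: "norm (j p - j q) \<le> norm (p - q)" if "p \<in> K" "q \<in> K" for p q
  proof (rule norm_le_pr[OF subspace_diff[OF Y j[OF that(1)] j[OF that(2)]]])
    show "\<bar>pr (j p - j q) f\<bar> \<le> norm (p - q)" if f: "1-lipschitz_on K f" for f
      using lipschitz_onD[OF f \<open>p \<in> K\<close> \<open>q \<in> K\<close>] \<open>p \<in> K\<close> \<open>q \<in> K\<close>
      by (simp add: linear_map_on_diff[OF pr_linear[OF f] Y] j pr_j[OF f] dist_norm)
  qed
  define val where "val l = sum_list (map (\<lambda>(r, i). real_of_rat r *\<^sub>R j (d i)) l)" for l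
  have val: "val l \<in> span (j ` K)" for l
  proof (induction l)
    case (Cons a l)
    obtain r i where a: "a = (r, i)" by (cases a)
    have "real_of_rat r *\<^sub>R j (d i) + val l \<in> span (j ` K)"
      using d(1) by (intro span_add[OF span_scale[OF span_base] Cons.IH]) simp
    then show ?case by (simp add: val_def a)
  qed (simp add: val_def span_zero)
  have approx: "\<exists>l. norm (w - val l) < \<epsilon>" if "w \<in> span (j ` K)" "\<epsilon> > 0" for w \<epsilon>
    using that
  proof (induction arbitrary: \<epsilon> rule: span_induct_alt)
    case base
    then show ?case by (intro exI[of _ "[]"]) (simp add: val_def)
  next
    case (step c u w)
    then obtain p where p: "p \<in> K" "u = j p" by auto
    obtain l where l: "norm (w - val l) < \<epsilon> / 2" using step.IH[of "\<epsilon> / 2"] step.prems by auto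
    \<comment> \<open>The rational coefficient is fixed before the point, whose precision depends on
      it. The errors are a quarter of \<open>\<epsilon>\<close> for each of the two and half of
      \<open>\<epsilon>\<close> for the rest of the combination.\<close>
    have "\<epsilon> / 4 / (norm u + 1) > 0" using step.prems by (simp add: add_nonneg_pos)
    then obtain r :: rat where r: "c < real_of_rat r" "real_of_rat r < c + \<epsilon> / 4 / (norm u + 1)"
      using of_rat_dense[of c "c + \<epsilon> / 4 / (norm u + 1)"] by auto
    have pos: "\<epsilon> / 4 / (\<bar>real_of_rat r\<bar> + 1) > 0"
      using step.prems by (intro divide_pos_pos add_nonneg_pos) auto
    with d(2)[OF p(1)] obtain i where i: "dist p (d i) < \<epsilon> / 4 / (\<bar>real_of_rat r\<bar> + 1)" by blast
    have n1: "norm ((c - real_of_rat r) *\<^sub>R u) \<le> \<epsilon> / 4"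
    proof -
      have "\<bar>c - real_of_rat r\<bar> * norm u \<le> \<bar>c - real_of_rat r\<bar> * (norm u + 1)" by (simp add: mult_left_mono)
      also have "\<dots> \<le> \<epsilon> / 4 / (norm u + 1) * (norm u + 1)"
        using r by (intro mult_right_mono) auto
      also have "\<dots> = \<epsilon> / 4"
        by (rule nonzero_eq_divide_eq[THEN iffD1, OF _ refl]) (use norm_ge_zero[of u] in linarith)
      finally show ?thesis by simp
    qed
    have n2: "norm (real_of_rat r *\<^sub>R (u - j (d i))) \<le> \<epsilon> / 4"
    proof -
      have "norm (u - j (d i)) * \<bar>real_of_rat r\<bar> \<le> \<epsilon> / 4 / (\<bar>real_of_rat r\<bar> + 1) * (\<bar>real_of_rat r\<bar> + 1)"
        using jd[OF p(1) d(1)[of i]] i p(2)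
        by (intro mult_mono less_imp_le[OF pos]) (auto simp: dist_norm)
      also have "\<dots> = \<epsilon> / 4"
        by (rule nonzero_eq_divide_eq[THEN iffD1, OF _ refl]) linarith
      finally show ?thesis by (simp add: mult.commute)
    qed
    have eq: "c *\<^sub>R u + w - val ((r, i) # l) =
        (c - real_of_rat r) *\<^sub>R u + real_of_rat r *\<^sub>R (u - j (d i)) + (w - val l)"
      by (simp add: val_def algebra_simps)
    have "norm (c *\<^sub>R u + w - val ((r, i) # l)) < \<epsilon>"
      unfolding eq using n1 n2 l norm_triangle_ineq[of "(c - real_of_rat r) *\<^sub>R u + real_of_rat r *\<^sub>R (u - j (d i))" "w - val l"]
        norm_triangle_ineq[of "(c - real_of_rat r) *\<^sub>R u" "real_of_rat r *\<^sub>R (u - j (d i))"]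
      by linarith
    then show ?case by blast
  qed
  show ?thesis
  proof (rule separable_subsetI)
    show "countable (range val)" by simp
    show "range val \<subseteq> Y" using val span_j_subset by auto
    fix y and \<epsilon> :: real assume "y \<in> Y" "\<epsilon> > 0"
    then obtain w where w: "w \<in> span (j ` K)" "norm (y - w) < \<epsilon> / 2" using span_j[of y "\<epsilon> / 2"] by auto
    obtain l where "norm (w - val l) < \<epsilon> / 2" using approx[OF w(1), of "\<epsilon> / 2"] \<open>\<epsilon> > 0\<close> by auto
    then have "dist (val l) y < \<epsilon>"
      using w(2) norm_triangle_ineq[of "y - w" "w - val l"] by (simp add: dist_norm norm_minus_commute)
    then show "\<exists>d\<in>range val. dist d y < \<epsilon>" by blast
  qed
qed

end

section \<open>Rescaling the basis and the decomposition argument\<close>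

lemma normalised_basis:
  fixes e :: "nat \<Rightarrow> 'a::real_normed_vector"
  assumes e: "schauder_basis e"
  obtains x :: "nat \<Rightarrow> 'a" where "schauder_basis x" "summable (\<lambda>j. norm (x j))"
proof -
  \<comment> \<open>The rescaled vectors have norm \<open>(1 / 2) ^ k\<close>; positive factors
    preserve existence and uniqueness of expansions.\<close>
  define c where "c k = (1 / 2) ^ k / norm (e k)" for k
  have c: "c k > 0" for k using basis_nonzero[OF e, of k] by (simp add: c_def)
  have "schauder_basis (\<lambda>k. c k *\<^sub>R e k)"
    unfolding schauder_basis_def
  proof (intro allI ex1I)
    fix v
    show "(\<lambda>n. (basis_coeff e v n / c n) *\<^sub>R c n *\<^sub>R e n) sums v"
      using basis_coeff_sums[OF e, of v] c by (simp add: less_imp_neq[OF c, symmetric])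
    fix a assume "(\<lambda>n. a n *\<^sub>R c n *\<^sub>R e n) sums v"
    then have "basis_coeff e v = (\<lambda>n. a n * c n)" by (intro basis_coeff_eqI[OF e]) simp
    then show "a = (\<lambda>n. basis_coeff e v n / c n)" using less_imp_neq[OF c, symmetric] by auto
  qed
  moreover have "norm (c k *\<^sub>R e k) = (1 / 2) ^ k" for k
    using basis_nonzero[OF e, of k] by (simp add: c_def)
  then have "summable (\<lambda>k. norm (c k *\<^sub>R e k))" by (simp add: summable_geometric)
  ultimately show ?thesis by (rule that)
qed

lemma complemented_retract:
  fixes V :: "'a::real_normed_vector set" and Z :: "'b::real_normed_vector set"
  assumes "complemented V" "isomorphic_normed Z norm V norm" "subspace Z"
  shows "retract Z (UNIV :: 'a set)"
proof -
  obtain p where p: "bounded_linear p" "p \<circ> p = p" "range p = V"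
    using assms(1) by (auto simp: complemented_def)
  interpret p: bounded_linear p by (rule p(1))
  obtain T S C D where T: "linear_map_on Z T" "linear_map_on V S" "T ` Z \<subseteq> V" "S ` V \<subseteq> Z"
    "\<And>z. z \<in> Z \<Longrightarrow> S (T z) = z" "\<And>v. v \<in> V \<Longrightarrow> T (S v) = v"
    "\<And>z. z \<in> Z \<Longrightarrow> norm (T z) \<le> C * norm z" "\<And>v. v \<in> V \<Longrightarrow> norm (S v) \<le> D * norm v"
    using isomorphic_normedE[OF assms(2,3)] by metis
  obtain E where E: "\<And>v. norm (p v) \<le> E * norm v" using p.bounded by (auto simp: mult.commute)
  have pV: "p v = v" if "v \<in> V" for v using that p(2,3) by (auto simp: fun_eq_iff)
  have pr: "p v \<in> V" for v using p(3) by blast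
  show ?thesis
  proof (rule retractI)
    show "linear_map_on Z T" by (rule T(1))
    show "linear_map_on UNIV (\<lambda>v. S (p v))"
      using T(2) pr by (simp add: linear_map_on_def p.add p.scaleR)
    show "T ` Z \<subseteq> UNIV" "(\<lambda>v. S (p v)) ` UNIV \<subseteq> Z" using T(4) pr by auto
    show "S (p (T z)) = z" if "z \<in> Z" for z using that T(3,5) pV by auto
    show "norm (T z) \<le> C * norm z" if "z \<in> Z" for z by (rule T(7)[OF that])
    show "norm (S (p v)) \<le> (\<bar>D\<bar> * E) * norm v" for v
      by (rule bound_compose[OF E T(8)[OF pr]]) simp
  qed
qed

text \<open>Write P for the whole space, with P = c0(Y) + W and Y = P + V up to isomorphism. As
  c0(Y) absorbs every retract of Y, so does P; taking P and Y as retracts gives P = P + P and P = Y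
  + P. Then Y = P + V = P + P + V = P + Y = P.\<close>

lemma pelczynski_decomposition:
  fixes Y :: "linf set"
  assumes Y: "subspace Y" and Z: "retract (c0_sum Y) (UNIV :: 'a::real_normed_vector set)"
    and P: "retract (UNIV :: 'a set) Y"
  shows "(UNIV :: 'a set) \<simeq> Y"
proof -
  note sZ = subspace_c0_sum[OF Y]
  obtain W :: "'a set" where W: "subspace W" "(UNIV :: 'a set) \<simeq> c0_sum Y \<times> W"
    using retract_complement[OF Z sZ subspace_UNIV] by metis
  obtain V :: "linf set" where V: "subspace V" "Y \<simeq> (UNIV :: 'a set) \<times> V"
    using retract_complement[OF P subspace_UNIV Y] by metis
  \<comment> \<open>The absorbing summand \<open>c0_sum Y\<close> passes its property to the whole
    space, the complement \<open>W\<close> being carried along.\<close>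
  have absorb: "(UNIV :: 'a set) \<simeq> A \<times> (UNIV :: 'a set)" if A: "retract A Y" "subspace A"
    for A :: "'b::real_normed_vector set"
  proof -
    have "(UNIV :: 'a set) \<simeq> c0_sum Y \<times> W" by (rule W(2))
    also have "c0_sum Y \<times> W \<simeq> (A \<times> c0_sum Y) \<times> W"
      by (rule iso_Times[OF c0_sum_absorbs[OF A Y] iso_refl sZ W(1)])
    also have "(A \<times> c0_sum Y) \<times> W \<simeq> A \<times> (c0_sum Y \<times> W)" by (rule iso_Times_assoc)
    also have "A \<times> (c0_sum Y \<times> W) \<simeq> A \<times> (UNIV :: 'a set)"
      by (rule iso_Times[OF iso_refl isomorphic_normed_sym[OF W(2)]])
         (simp_all add: A sZ W(1) subspace_Times)
    finally show ?thesis by (simp_all add: A sZ W(1) subspace_Times)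
  qed
  have "Y \<simeq> (UNIV :: 'a set) \<times> V" by (rule V(2))
  also have "(UNIV :: 'a set) \<times> V \<simeq> ((UNIV :: 'a set) \<times> (UNIV :: 'a set)) \<times> V"
    by (rule iso_Times[OF absorb[OF P subspace_UNIV] iso_refl subspace_UNIV V(1)])
  also have "((UNIV :: 'a set) \<times> (UNIV :: 'a set)) \<times> V \<simeq> (UNIV :: 'a set) \<times> ((UNIV :: 'a set) \<times> V)"
    by (rule iso_Times_assoc)
  also have "(UNIV :: 'a set) \<times> ((UNIV :: 'a set) \<times> V) \<simeq> (UNIV :: 'a set) \<times> Y"
    by (rule iso_Times[OF iso_refl isomorphic_normed_sym[OF V(2) Y]])
       (simp_all add: V(1) subspace_Times del: UNIV_Times_UNIV)
  also have "(UNIV :: 'a set) \<times> Y \<simeq> Y \<times> (UNIV :: 'a set)" by (rule iso_Times_commute)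
  also have "Y \<times> (UNIV :: 'a set) \<simeq> (UNIV :: 'a set)"
    by (rule isomorphic_normed_sym[OF absorb[OF retract_refl Y] subspace_UNIV])
  finally have "Y \<simeq> (UNIV :: 'a set)"
    by (simp_all add: Y V(1) subspace_Times del: UNIV_Times_UNIV)
  then show ?thesis by (rule isomorphic_normed_sym[OF _ Y])
qed

text \<open>\<open>K \<noteq> {}\<close> keeps the quantifier over base points from being vacuous;
  the isomorphism is obtained for every choice of distinguished point.\<close>

theorem theorem1:
  assumes "pelczynski_space TYPE('p::banach)"
  shows "\<exists>K :: 'p set. compact K \<and> convex K \<and> K \<noteq> {} \<and>
    (\<forall>z\<in>K. isomorphic_normed (UNIV :: 'p set) norm (lip_free K z) (lip_free_norm K z))"
proof -
  obtain e :: "nat \<Rightarrow> 'p" where e: "schauder_basis e"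
    and universal: "\<And>X :: linf set. subspace X \<Longrightarrow> closed X \<Longrightarrow> separable_space (top_of_set X) \<Longrightarrow>
      bounded_approximation_property X \<Longrightarrow> \<exists>V :: 'p set. complemented V \<and> X \<simeq> V"
    using assms unfolding pelczynski_space_def by blast
  obtain x :: "nat \<Rightarrow> 'p" where x: "schauder_basis x" "summable (\<lambda>j. norm (x j))"
    by (rule normalised_basis[OF e])
  obtain M where M: "M \<ge> 1" "\<And>n v. norm (basis_proj x n v) \<le> M * norm v"
    by (rule basis_constant[OF x(1)]) blast
  interpret hilbert_cube x by standard (rule x(2))
  have "isomorphic_normed (UNIV :: 'p set) norm (lip_free K z) (lip_free_norm K z)" if z: "z \<in> K" for z
  proof -
    obtain Y :: "linf set" and j :: "'p \<Rightarrow> linf" and pr :: "linf \<Rightarrow> ('p \<Rightarrow> real) \<Rightarrow> real"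
      where Ys: "subspace Y" and Yc: "closed Y" and iso: "isomorphic_normed Y norm (lip_free K z) (lip_free_norm K z)"
      and pr: "\<And>p. p \<in> K \<Longrightarrow> j p \<in> Y"
        "\<And>y \<epsilon>. y \<in> Y \<Longrightarrow> \<epsilon> > 0 \<Longrightarrow> \<exists>w\<in>span (j ` K). norm (y - w) < \<epsilon>"
        "\<And>f C. C-lipschitz_on K f \<Longrightarrow> linear_map_on Y (\<lambda>y. pr y f)"
        "\<And>f C y. C-lipschitz_on K f \<Longrightarrow> y \<in> Y \<Longrightarrow> \<bar>pr y f\<bar> \<le> C * norm y"
        "\<And>f C p. C-lipschitz_on K f \<Longrightarrow> p \<in> K \<Longrightarrow> pr (j p) f = f p - f z"
        "\<And>y C. y \<in> Y \<Longrightarrow> (\<And>f. 1-lipschitz_on K f \<Longrightarrow> \<bar>pr y f\<bar> \<le> C) \<Longrightarrow> norm y \<le> C"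
      by (rule free_space_in_linf[OF compact_K z]) blast
    interpret free_cube x z Y j pr M
      by standard (fact x M z Ys Yc pr)+
    \<comment> \<open>Universality is applied to \<open>c0_sum Y\<close> rather than to
      \<open>Y\<close>, because the sum is what absorbs further copies.\<close>
    have "\<exists>V :: 'p set. complemented V \<and> c0_sum Y \<simeq> V"
      by (intro universal subspace_c0_sum closed_c0_sum separable_c0_sum BAP_c0_sum Ys Yc
          separable_free BAP_free)
    then have "retract (c0_sum Y) (UNIV :: 'p set)"
      using complemented_retract subspace_c0_sum[OF Ys] by blast
    then have "(UNIV :: 'p set) \<simeq> Y"
      by (rule pelczynski_decomposition[OF Ys _ retract_free])
    then show ?thesis
      by (rule isomorphic_normed_trans[OF _ iso subspace_UNIV Ys]) simp
  qed
  then show ?thesis using compact_K convex_K zero_in_K by blast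
qed

end
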